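(* Let $k$ be a field with separable closure $k^{\mathrm{sep}}$, and let $C$ be a curve over $k$ of genus $g$ and separable gonality $\gamma^{\mathrm{sep}}$. If the gonal map $f\colon C_{k^{\mathrm{sep}}}\to\mathbb{P}^1_{k^{\mathrm{sep}}}$ over $k^{\mathrm{sep}}$ is simple (in particular, this is always the case if $\gamma^{\mathrm{sep}}$ is prime) and $(\gamma^{\mathrm{sep}}-1)^2<g$, then the gonal map over $k^{\mathrm{sep}}$ is unique.
   Context: "Curve over $k$" means a smooth projective geometrically connected curve defined over $k$. The separable gonality $\gamma^{\mathrm{sep}}$ of $C$ is the gonality of $C_{k^{\mathrm{sep}}}$ over $k^{\mathrm{sep}}$, i.e. the minimal degree of a non-constant rational map $C_{k^{\mathrm{sep}}}\to\mathbb{P}^1_{k^{\mathrm{sep}}}$ defined over $k^{\mathrm{sep}}$; a gonal map over $k^{\mathrm{sep}}$ is such a map of degree $\gamma^{\mathrm{sep}}$. The gonal map over $k^{\mathrm{sep}}$ is unique if there is a unique subfield $F$ of the function field $k^{\mathrm{sep}}(C)$ (containing $k^{\mathrm{sep}}$) that is $k^{\mathrm{sep}}$-isomorphic to $k^{\mathrm{sep}}(\mathbb{P}^1)$ and satisfies $[k^{\mathrm{sep}}(C):F]=\gamma^{\mathrm{sep}}$. A non-constant rational map $f\colon C\to D$ between curves is simple if there is no smooth curve $D'$ with maps $f_1\colon C\to D'$ and $f_2\colon D'\to D$ such that $\deg f_i\ge 2$ for $i=1,2$ and $f=f_2\circ f_1$. *)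

theory Defs
  imports "HOL-Algebra.Algebraic_Closure_Type" "HOL-Algebra.Generated_Fields"
begin

text \<open>
  Curves are handled through their function fields.  Over a field \<open>k\<close>, regular projective curves
  with their non-constant rational maps are anti-equivalent to function fields in one variable
  over \<open>k\<close> with their \<open>k\<close>-embeddings.  The closed points of the curve with function field \<open>K\<close>
  correspond to the valuation rings of \<open>K/k\<close>, which are its local rings there.

  All fields are subfields of an algebraically closed type, the universal domain.  This loses no
  generality: every extension \<open>K/k\<close> embeds into an algebraic closure of \<open>K\<close>.  Closures of \<open>k\<close> and
  composita are formed in the universal domain, and every finite-dimensionality notion is the one
  of HOL-Algebra for the ring \<open>\<Omega>\<close> of all its elements.
\<close>

abbreviation universal_domain :: "'a::alg_closed_field ring" (\<open>\<Omega>\<close>)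
  where "\<Omega> \<equiv> ring_of_type_algebra"

definition poly_over :: "'a::alg_closed_field set \<Rightarrow> 'a poly set"
  where "poly_over A = {p. \<forall>i. Polynomial.coeff p i \<in> A}"

definition alg_closure_of :: "'a::alg_closed_field set \<Rightarrow> 'a set"
  where "alg_closure_of k = {x. \<not> ring.transcendental \<Omega> k x}"

text \<open>
  A polynomial is separable if its roots in an algebraically closed field are simple.  Since
  \<open>rsquarefree\<close> speaks about all roots in the type, it expresses exactly this.
\<close>

definition sep_closure_of :: "'a::alg_closed_field set \<Rightarrow> 'a set"
  where "sep_closure_of k = {x. \<exists>p \<in> poly_over k. rsquarefree p \<and> poly p x = 0}"

definition integral_over :: "'a::alg_closed_field set \<Rightarrow> 'a \<Rightarrow> bool"
  where "integral_over A x \<longleftrightarrow>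
    (\<exists>p \<in> poly_over A. Polynomial.lead_coeff p = 1 \<and> poly p x = 0)"

definition compositum :: "'a::alg_closed_field set \<Rightarrow> 'a set \<Rightarrow> 'a set"
  where "compositum K L = generate_field \<Omega> (K \<union> L)"

definition adjoin :: "'a::alg_closed_field set \<Rightarrow> 'a \<Rightarrow> 'a set"
  where "adjoin k x = generate_field \<Omega> (insert x k)"

definition ext_degree :: "'a::alg_closed_field set \<Rightarrow> 'a set \<Rightarrow> nat"
  where "ext_degree F E = ring.dim \<Omega> F E"


section \<open>Function fields, places and smooth curves\<close>

definition function_field :: "'a::alg_closed_field set \<Rightarrow> 'a set \<Rightarrow> bool"
  where "function_field k K \<longleftrightarrow>
    subfield k \<Omega> \<and> subfield K \<Omega> \<and> k \<subseteq> K \<and>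
    (\<exists>x \<in> K. ring.transcendental \<Omega> k x \<and> ring.finite_dimension \<Omega> (adjoin k x) K)"

definition places :: "'a::alg_closed_field set \<Rightarrow> 'a set \<Rightarrow> 'a set set"
  where "places k K = {R. subring R \<Omega> \<and> k \<subseteq> R \<and> R \<subset> K \<and> (\<forall>x \<in> K. x \<in> R \<or> inverse x \<in> R)}"

definition linearly_disjoint :: "'a::alg_closed_field set \<Rightarrow> 'a set \<Rightarrow> 'a set \<Rightarrow> bool"
  where "linearly_disjoint k K L \<longleftrightarrow>
    (\<forall>us. set us \<subseteq> K \<and> ring.independent \<Omega> k us \<longrightarrow> ring.independent \<Omega> L us)"

text \<open>
  Write \<open>kbar\<close> for the algebraic closure of \<open>k\<close>.  Linear disjointness of \<open>K\<close> and \<open>kbar\<close> over \<open>k\<close>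
  says that \<open>K \<otimes>\<^sub>k kbar\<close> is a domain, i.e. that the curve is geometrically integral (for smooth
  curves this is the same as geometrically connected).  In that case \<open>R \<otimes>\<^sub>k kbar\<close> is the subring
  generated by \<open>R\<close> and \<open>kbar\<close>, for every valuation ring \<open>R\<close> of \<open>K/k\<close>.  Smoothness at \<open>R\<close> means that
  this ring is regular.  It is a one-dimensional Noetherian domain whose fraction field is the
  compositum of \<open>K\<close> and \<open>kbar\<close>, so it is regular iff it is integrally closed.
\<close>

definition smooth_at :: "'a::alg_closed_field set \<Rightarrow> 'a set \<Rightarrow> 'a set \<Rightarrow> bool"
  where "smooth_at k K R \<longleftrightarrow>
    (\<forall>z \<in> compositum K (alg_closure_of k).
       integral_over (generate_ring \<Omega> (R \<union> alg_closure_of k)) z \<longrightarrow>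
       z \<in> generate_ring \<Omega> (R \<union> alg_closure_of k))"

definition smooth_curve :: "'a::alg_closed_field set \<Rightarrow> 'a set \<Rightarrow> bool"
  where "smooth_curve k K \<longleftrightarrow>
    function_field k K \<and> linearly_disjoint k K (alg_closure_of k) \<and>
    (\<forall>R \<in> places k K. smooth_at k K R)"

text \<open>
  The function field of the base change of the curve to the separable closure.  For a smooth
  curve, linear disjointness identifies \<open>K \<otimes>\<^sub>k ksep\<close> with this compositum.
\<close>

definition base_change_sep :: "'a::alg_closed_field set \<Rightarrow> 'a set \<Rightarrow> 'a set"
  where "base_change_sep k K = compositum K (sep_closure_of k)"


section \<open>Divisors and the genus\<close>

definition max_ideal :: "'a::alg_closed_field set \<Rightarrow> 'a set"
  where "max_ideal R = {x \<in> R. x = 0 \<or> inverse x \<notin> R}"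

text \<open>The normalized valuation of a nonzero element, with \<open>t\<close> a uniformizer.\<close>

definition ord_at :: "'a::alg_closed_field set \<Rightarrow> 'a \<Rightarrow> int"
  where "ord_at R z = (THE n. \<exists>t u. max_ideal R = (\<lambda>a. t * a) ` R \<and>
     u \<in> R - max_ideal R \<and> z = t powi n * u)"

text \<open>The degree of the residue field over the image of \<open>k\<close> in it.\<close>

definition place_degree :: "'a::alg_closed_field set \<Rightarrow> 'a set \<Rightarrow> nat"
  where "place_degree k R =
    (let A = \<Omega>\<lparr>carrier := R\<rparr>; kappa = A Quot max_ideal R
     in ring.dim kappa ((\<lambda>a. max_ideal R +>\<^bsub>A\<^esub> a) ` k) (carrier kappa))"

definition divisors :: "'a::alg_closed_field set \<Rightarrow> 'a set \<Rightarrow> ('a set \<Rightarrow> int) set"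
  where "divisors k K = {D. finite {R. D R \<noteq> 0} \<and> {R. D R \<noteq> 0} \<subseteq> places k K}"

definition div_degree :: "'a::alg_closed_field set \<Rightarrow> ('a set \<Rightarrow> int) \<Rightarrow> int"
  where "div_degree k D = (\<Sum>R | D R \<noteq> 0. D R * int (place_degree k R))"

definition riemann_roch_space ::
    "'a::alg_closed_field set \<Rightarrow> 'a set \<Rightarrow> ('a set \<Rightarrow> int) \<Rightarrow> 'a set"
  where "riemann_roch_space k K D =
    {z \<in> K. z = 0 \<or> (\<forall>R \<in> places k K. ord_at R z \<ge> - D R)}"

text \<open>
  By Riemann's theorem this supremum of integers is a maximum; it equals the dimension of the
  first cohomology of the structure sheaf.
\<close>

definition genus :: "'a::alg_closed_field set \<Rightarrow> 'a set \<Rightarrow> int"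
  where "genus k K = (SUP D \<in> divisors k K.
    div_degree k D - int (ring.dim \<Omega> k (riemann_roch_space k K D)) + 1)"


section \<open>Maps to the projective line, gonality, simple maps\<close>

text \<open>
  A non-constant rational map from the curve to the projective line over \<open>k\<close> is a non-constant
  rational function \<open>f\<close>.  The function field of the line is pulled back to the subfield \<open>k(f)\<close>.
\<close>

definition nonconstant_maps_P1 :: "'a::alg_closed_field set \<Rightarrow> 'a set \<Rightarrow> 'a set"
  where "nonconstant_maps_P1 k K = K - k"

definition map_degree :: "'a::alg_closed_field set \<Rightarrow> 'a set \<Rightarrow> 'a \<Rightarrow> nat"
  where "map_degree k K f = ext_degree (adjoin k f) K"

definition gonality :: "'a::alg_closed_field set \<Rightarrow> 'a set \<Rightarrow> nat"
  where "gonality k K = (LEAST n. \<exists>f \<in> nonconstant_maps_P1 k K. map_degree k K f = n)"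

definition gonal_map :: "'a::alg_closed_field set \<Rightarrow> 'a set \<Rightarrow> 'a \<Rightarrow> bool"
  where "gonal_map k K f \<longleftrightarrow>
    f \<in> nonconstant_maps_P1 k K \<and> map_degree k K f = gonality k K"

text \<open>
  For the map of curves over \<open>k\<close> given by an inclusion \<open>F \<subseteq> K\<close> of function fields.  After replacing
  a factorization by an isomorphic one, the function field of the intermediate smooth curve is a
  field \<open>M\<close> between \<open>F\<close> and \<open>K\<close>.
\<close>

definition simple_cover :: "'a::alg_closed_field set \<Rightarrow> 'a set \<Rightarrow> 'a set \<Rightarrow> bool"
  where "simple_cover k F K \<longleftrightarrow>
    \<not> (\<exists>M. smooth_curve k M \<and> F \<subseteq> M \<and> M \<subseteq> K \<and> ext_degree M K \<ge> 2 \<and> ext_degree F M \<ge> 2)"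

definition simple_map_P1 :: "'a::alg_closed_field set \<Rightarrow> 'a set \<Rightarrow> 'a \<Rightarrow> bool"
  where "simple_map_P1 k K f \<longleftrightarrow> simple_cover k (adjoin k f) K"

text \<open>Being \<open>k\<close>-isomorphic to the function field of the projective line.\<close>

definition rational_function_field :: "'a::alg_closed_field set \<Rightarrow> 'a set \<Rightarrow> bool"
  where "rational_function_field k F \<longleftrightarrow>
    (\<exists>t. ring.transcendental \<Omega> k t \<and> F = adjoin k t)"

definition unique_gonal_map :: "'a::alg_closed_field set \<Rightarrow> 'a set \<Rightarrow> bool"
  where "unique_gonal_map k K \<longleftrightarrow>
    (\<exists>!F. F \<subseteq> K \<and> rational_function_field k F \<and> ext_degree F K = gonality k K)"

definition sep_gonality :: "'a::alg_closed_field set \<Rightarrow> 'a set \<Rightarrow> nat"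
  where "sep_gonality k K = gonality (sep_closure_of k) (base_change_sep k K)"

end

theory Submission
  imports Defs
begin

text \<open>
  Let \<open>L\<close> be the separable closure of \<open>k\<close>, let \<open>x\<close> be a simple gonal map and \<open>y\<close> another gonal map, both of
  degree \<open>n\<close>, and let \<open>M\<close> be the compositum of \<open>L(x)\<close> and \<open>L(y)\<close> in \<open>L(C)\<close>.  The curve of \<open>M\<close> is dominated by a
  smooth curve, hence smooth, so simplicity of \<open>x\<close> leaves \<open>M = L(x)\<close>, where degrees give \<open>L(y) = L(x)\<close>, or
  \<open>M = L(C)\<close>.  The second case contradicts Castelnuovo's inequality \<open>g \<le> (n - 1)^2\<close>.

  That inequality is obtained by counting.  For an effective divisor \<open>E\<close> on \<open>C\<close> choose a polynomial \<open>q\<close> of degree \<open>d\<close>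
  such that \<open>q(x)\<close> vanishes along \<open>E\<close> where \<open>x\<close> is finite.  For large \<open>a\<close> the \<open>(a + d + 1) n\<close> independent functions
  \<open>x^i y^j / q(x)\<close> with \<open>i \<le> a + d\<close> and \<open>j < n\<close> belong to a divisor of degree at most \<open>(a + d + n - 1) n\<close> that contains \<open>E\<close>.
  Imposing the conditions of \<open>E\<close> on them leaves a space of dimension at least \<open>deg E + 1 - (n - 1)^2\<close>.

  Only dimensions of quotients over the constant field are used over \<open>L\<close>; linear disjointness and smoothness
  transfer them to \<open>k\<close>, so that neither degrees of places nor the genus have to be base changed.
\<close>

text \<open>The field \<open>L\<close> need not be perfect, so a place of \<open>L(C)\<close> may
  have an inseparable residue field and its degree is hard to compare with degrees over
  \<open>k\<close>. What is counted over \<open>L\<close> are therefore modules cut out by local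
  equations. Their dimensions are bounded from above by one principle: if the field has degree at
  most \<open>N\<close> over \<open>L(f)\<close>, imposing one more zero of \<open>f\<close> costs
  at most \<open>N\<close> dimensions. From below they are bounded by families that are independent
  over \<open>k\<close> and stay so over the algebraic closure. Smoothness enters because it makes
  \<open>R \<otimes> L\<close> the intersection of the places above \<open>R\<close>, which turns
  local conditions over \<open>L\<close> back into conditions over \<open>k\<close>. With
  \<open>n'\<close> the degree of \<open>y\<close>, the constant is \<open>(a + d + 1) n - ((n - 1)
  n' + (a + d) n) = 1 - (n - 1) (n' - 1)\<close>: the \<open>n - 1\<close> is the largest exponent
  of \<open>y\<close> that is needed once \<open>y\<close> generates the field over
  \<open>L(x)\<close>. Effective divisors suffice for the genus, since passing to the positive part
  of a divisor does not lower degree minus dimension.\<close>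

lemma Omega_simps [simp]:
  "carrier \<Omega> = UNIV" "x \<otimes>\<^bsub>\<Omega>\<^esub> y = x * y" "x \<oplus>\<^bsub>\<Omega>\<^esub> y = x + y" "\<zero>\<^bsub>\<Omega>\<^esub> = 0" "\<one>\<^bsub>\<Omega>\<^esub> = 1"
  by (simp_all add: ring_of_type_algebra_def)

lemma Omega_field: "Ring.field (\<Omega> :: 'a::alg_closed_field ring)"
  by (rule field_from_type_algebra)

interpretation Om: domain "\<Omega> :: 'a::alg_closed_field ring"
  using Omega_field by (rule field.axioms)

lemma Omega_a_inv [simp]: "\<ominus>\<^bsub>\<Omega>\<^esub> x = - x"
  by (rule Om.minus_equality) auto

lemma Omega_m_inv [simp]: "x \<noteq> 0 \<Longrightarrow> inv\<^bsub>\<Omega>\<^esub> x = inverse x"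
  by (rule sym, rule Om.inv_unique') auto

lemma Omega_pow [simp]: "x [^]\<^bsub>\<Omega>\<^esub> (n::nat) = x ^ n"
  by (induction n) (auto simp: nat_pow_def)

section \<open>Subrings and subfields of the universal domain\<close>

lemma subring_Omega_iff:
  "subring R \<Omega> \<longleftrightarrow> 1 \<in> R \<and> (\<forall>x\<in>R. - x \<in> R) \<and> (\<forall>x\<in>R. \<forall>y\<in>R. x + y \<in> R \<and> x * y \<in> R)"
proof
  assume "subring R \<Omega>"
  then show "1 \<in> R \<and> (\<forall>x\<in>R. - x \<in> R) \<and> (\<forall>x\<in>R. \<forall>y\<in>R. x + y \<in> R \<and> x * y \<in> R)"
    using subringE[of R \<Omega>] by auto
next
  assume "1 \<in> R \<and> (\<forall>x\<in>R. - x \<in> R) \<and> (\<forall>x\<in>R. \<forall>y\<in>R. x + y \<in> R \<and> x * y \<in> R)"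
  then show "subring R \<Omega>" by (intro Om.subringI) auto
qed

lemma subfield_Omega_iff:
  "subfield R \<Omega> \<longleftrightarrow> subring R \<Omega> \<and> (\<forall>x\<in>R. inverse x \<in> R)"
proof
  assume s: "subfield R \<Omega>"
  then have r: "subring R \<Omega>" by (rule subfieldE)
  have "inverse x \<in> R" if "x \<in> R" for x
  proof (cases "x = 0")
    case False
    then show ?thesis using Om.subfield_m_inv(1)[OF s, of x] that by auto
  qed (use that in auto)
  then show "subring R \<Omega> \<and> (\<forall>x\<in>R. inverse x \<in> R)" using r by auto
next
  assume "subring R \<Omega> \<and> (\<forall>x\<in>R. inverse x \<in> R)"
  then show "subfield R \<Omega>" by (intro field.subfieldI'[OF Omega_field]) auto
qed

lemma sr_1: "subring R \<Omega> \<Longrightarrow> 1 \<in> R"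
  and sr_0: "subring R \<Omega> \<Longrightarrow> 0 \<in> R"
  and sr_minus: "subring R \<Omega> \<Longrightarrow> x \<in> R \<Longrightarrow> - x \<in> R"
  and sr_add: "subring R \<Omega> \<Longrightarrow> x \<in> R \<Longrightarrow> y \<in> R \<Longrightarrow> x + y \<in> R"
  and sr_mult: "subring R \<Omega> \<Longrightarrow> x \<in> R \<Longrightarrow> y \<in> R \<Longrightarrow> x * y \<in> R"
  and sr_diff: "subring R \<Omega> \<Longrightarrow> x \<in> R \<Longrightarrow> y \<in> R \<Longrightarrow> x - y \<in> R"
proof -
  assume a: "subring R \<Omega>"
  then have b: "1 \<in> R" "\<And>x. x \<in> R \<Longrightarrow> - x \<in> R" "\<And>x y. x \<in> R \<Longrightarrow> y \<in> R \<Longrightarrow> x + y \<in> R"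
     "\<And>x y. x \<in> R \<Longrightarrow> y \<in> R \<Longrightarrow> x * y \<in> R"
    unfolding subring_Omega_iff by blast+
  show "1 \<in> R" "x \<in> R \<Longrightarrow> - x \<in> R"  "x \<in> R \<Longrightarrow> y \<in> R \<Longrightarrow> x + y \<in> R"
    "x \<in> R \<Longrightarrow> y \<in> R \<Longrightarrow> x * y \<in> R" using b by blast+
  show "x \<in> R \<Longrightarrow> y \<in> R \<Longrightarrow> x - y \<in> R" using b(3)[OF _ b(2), of x y] by simp
  show "0 \<in> R" using b(3)[OF b(1) b(2)[OF b(1)]] by simp
qed

lemma sr_sum: "subring R \<Omega> \<Longrightarrow> (\<And>i. i \<in> I \<Longrightarrow> f i \<in> R) \<Longrightarrow> sum f I \<in> R"
  by (induction I rule: infinite_finite_induct) (auto intro: sr_0 sr_add)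

lemma sr_prod: "subring R \<Omega> \<Longrightarrow> (\<And>i. i \<in> I \<Longrightarrow> f i \<in> R) \<Longrightarrow> prod f I \<in> R"
  by (induction I rule: infinite_finite_induct) (auto intro: sr_1 sr_mult)

lemma sr_power: "subring R \<Omega> \<Longrightarrow> x \<in> R \<Longrightarrow> x ^ n \<in> R"
  by (induction n) (auto intro: sr_1 sr_mult)

lemma sf_sr: "subfield k \<Omega> \<Longrightarrow> subring k \<Omega>"
  by (simp add: subfield_Omega_iff)

lemma sf_inverse: "subfield k \<Omega> \<Longrightarrow> x \<in> k \<Longrightarrow> inverse x \<in> k"
  by (simp add: subfield_Omega_iff)

lemma sf_divide: "subfield k \<Omega> \<Longrightarrow> x \<in> k \<Longrightarrow> y \<in> k \<Longrightarrow> x / y \<in> k"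
  by (simp add: divide_inverse sf_inverse sf_sr sr_mult)

lemmas sr_intros = sr_0 sr_1 sr_minus sr_add sr_mult sr_diff sr_sum sr_prod sr_power sf_sr sf_inverse sf_divide

subsection \<open>Subspaces and relative dimension\<close>

definition subspc :: "'a::field set \<Rightarrow> 'a set \<Rightarrow> bool"
  where "subspc k M \<longleftrightarrow> 0 \<in> M \<and> (\<forall>x\<in>M. \<forall>y\<in>M. x + y \<in> M) \<and> (\<forall>c\<in>k. \<forall>x\<in>M. c * x \<in> M)"

lemma subspc_0: "subspc k M \<Longrightarrow> 0 \<in> M"
  and subspc_add: "subspc k M \<Longrightarrow> x \<in> M \<Longrightarrow> y \<in> M \<Longrightarrow> x + y \<in> M"
  and subspc_scale: "subspc k M \<Longrightarrow> c \<in> k \<Longrightarrow> x \<in> M \<Longrightarrow> c * x \<in> M"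
  unfolding subspc_def by auto

lemma subspc_sum: "subspc k M \<Longrightarrow> (\<And>i. i \<in> I \<Longrightarrow> f i \<in> M) \<Longrightarrow> sum f I \<in> M"
  by (induction I rule: infinite_finite_induct) (auto intro: subspc_0 subspc_add)

lemma subspc_minus: "subspc k M \<Longrightarrow> subring k \<Omega> \<Longrightarrow> x \<in> M \<Longrightarrow> - x \<in> M"
  using subspc_scale[of k M "-1" x] sr_minus[of k 1] sr_1[of k] by auto

lemma subspc_diff: "subspc k M \<Longrightarrow> subring k \<Omega> \<Longrightarrow> x \<in> M \<Longrightarrow> y \<in> M \<Longrightarrow> x - y \<in> M"
  using subspc_add[of k M x "-y"] subspc_minus[of k M y] by auto

lemma subspc_zero [simp]: "subspc k {0}"
  by (auto simp: subspc_def)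

lemma subspc_subring: "subring R \<Omega> \<Longrightarrow> k \<subseteq> R \<Longrightarrow> subspc k R"
  by (auto simp: subspc_def intro: sr_intros)

text \<open>For a subspace \<open>N\<close> this is independence of the classes in the quotient by
  \<open>N\<close>; \<open>N = {0}\<close> gives ordinary independence. Indexed families make
  reindexing, subfamilies and disjoint sums easy.\<close>

definition indep_mod :: "'a::field set \<Rightarrow> 'a set \<Rightarrow> 'i set \<Rightarrow> ('i \<Rightarrow> 'a) \<Rightarrow> bool"
  where "indep_mod k N I v \<longleftrightarrow>
    (\<forall>c. (\<forall>i\<in>I. c i \<in> k) \<longrightarrow> (\<Sum>i\<in>I. c i * v i) \<in> N \<longrightarrow> (\<forall>i\<in>I. c i = 0))"

lemma indep_modD:
  "indep_mod k N I v \<Longrightarrow> (\<And>i. i \<in> I \<Longrightarrow> c i \<in> k) \<Longrightarrow> (\<Sum>i\<in>I. c i * v i) \<in> N \<Longrightarrow> i \<in> I \<Longrightarrow> c i = 0"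
  unfolding indep_mod_def by blast

lemma indep_mod_reindex:
  assumes "bij_betw h J I"
  shows "indep_mod k N J (\<lambda>j. v (h j)) \<longleftrightarrow> indep_mod k N I v"
proof
  assume ind: "indep_mod k N J (\<lambda>j. v (h j))"
  show "indep_mod k N I v" unfolding indep_mod_def
  proof (intro allI impI ballI)
    fix c i assume c: "\<forall>i\<in>I. c i \<in> k" and s: "(\<Sum>i\<in>I. c i * v i) \<in> N" and i: "i \<in> I"
    have "(\<Sum>j\<in>J. c (h j) * v (h j)) = (\<Sum>i\<in>I. c i * v i)"
      by (rule sum.reindex_bij_betw[OF assms])
    with s have "(\<Sum>j\<in>J. c (h j) * v (h j)) \<in> N" by simp
    moreover obtain j where j: "j \<in> J" "i = h j" using assms i by (auto simp: bij_betw_def)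
    ultimately show "c i = 0"
      using indep_modD[OF ind, of "\<lambda>j. c (h j)" j] c assms by (auto simp: bij_betw_def)
  qed
next
  assume ind: "indep_mod k N I v"
  show "indep_mod k N J (\<lambda>j. v (h j))" unfolding indep_mod_def
  proof (intro allI impI ballI)
    fix c i assume c: "\<forall>i\<in>J. c i \<in> k" and s: "(\<Sum>i\<in>J. c i * v (h i)) \<in> N" and i: "i \<in> J"
    have "(\<Sum>i\<in>I. c (the_inv_into J h i) * v i) = (\<Sum>j\<in>J. c (the_inv_into J h (h j)) * v (h j))"
      by (rule sum.reindex_bij_betw[OF assms, symmetric])
    also have "\<dots> = (\<Sum>j\<in>J. c j * v (h j))"
      using assms by (intro sum.cong) (auto simp: the_inv_into_f_f bij_betw_def)
    finally have "(\<Sum>i\<in>I. c (the_inv_into J h i) * v i) \<in> N" using s by simp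
    moreover have "c (the_inv_into J h i) \<in> k" if "i \<in> I" for i
      using bij_betw_the_inv_into[OF assms] that c by (auto simp: bij_betw_def)
    moreover have "h i \<in> I" using assms i by (auto simp: bij_betw_def)
    ultimately have "c (the_inv_into J h (h i)) = 0"
      using indep_modD[OF ind, of "\<lambda>i. c (the_inv_into J h i)" "h i"] by auto
    then show "c i = 0" using assms i by (auto simp: the_inv_into_f_f bij_betw_def)
  qed
qed

lemma indep_mod_subset:
  assumes "indep_mod k N I v" "J \<subseteq> I" "finite I" "0 \<in> k"
  shows "indep_mod k N J v"
  unfolding indep_mod_def
proof (intro allI impI ballI)
  fix c i assume c: "\<forall>i\<in>J. c i \<in> k" and s: "(\<Sum>i\<in>J. c i * v i) \<in> N" and i: "i \<in> J"
  define d where "d i = (if i \<in> J then c i else 0)" for i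
  have "(\<Sum>i\<in>I. d i * v i) = (\<Sum>i\<in>J. c i * v i)"
    by (rule sum.mono_neutral_cong_right) (use assms in \<open>auto simp: d_def\<close>)
  then have "d i = 0"
    using indep_modD[OF assms(1), of d i] c s i assms(2,4) by (auto simp: d_def)
  then show "c i = 0" using i by (simp add: d_def)
qed

lemma indep_mod_antimono:
  assumes "indep_mod k N I v" "N' \<subseteq> N" "k' \<subseteq> k"
  shows "indep_mod k' N' I v"
  unfolding indep_mod_def
proof (intro allI impI)
  fix c assume "\<forall>i\<in>I. c i \<in> k'" "(\<Sum>i\<in>I. c i * v i) \<in> N'"
  then have "\<forall>i\<in>I. c i \<in> k" "(\<Sum>i\<in>I. c i * v i) \<in> N" using assms(2,3) by auto
  with assms(1) show "\<forall>i\<in>I. c i = 0" unfolding indep_mod_def by simp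
qed

text \<open>Greedy choice of a basis of the span modulo \<open>N\<close>: a vector that cannot be
  added has a nonzero coefficient in some relation and can be solved for. Besides dimension counts
  it serves to choose coordinates: \<open>c\<close> gives them, and the difference is the component
  in \<open>N\<close>.\<close>

lemma maximal_indep_mod:
  assumes k: "subfield k \<Omega>" and N: "subspc k N" and fin: "finite I"
  shows "\<exists>J c. J \<subseteq> I \<and> indep_mod k N J v \<and>
    (\<forall>i\<in>I. (\<forall>j\<in>J. c i j \<in> k) \<and> v i - (\<Sum>j\<in>J. c i j * v j) \<in> N)"
proof -
  have sr: "subring k \<Omega>" using k by (rule sf_sr)
  have "\<exists>J. J \<subseteq> I \<and> indep_mod k N J v \<and>
    (\<forall>i\<in>I. \<exists>c. (\<forall>j\<in>J. c j \<in> k) \<and> v i - (\<Sum>j\<in>J. c j * v j) \<in> N)"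
    using fin
  proof (induction I)
    case empty
    then show ?case by (auto simp: indep_mod_def)
  next
    case (insert x I)
    then obtain J where J: "J \<subseteq> I" "indep_mod k N J v"
      "\<And>i. i \<in> I \<Longrightarrow> \<exists>c. (\<forall>j\<in>J. c j \<in> k) \<and> v i - (\<Sum>j\<in>J. c j * v j) \<in> N" by blast
    have finJ: "finite J" using J(1) insert by (auto intro: finite_subset)
    have xJ: "x \<notin> J" using J insert by auto
    show ?case
    proof (cases "indep_mod k N (insert x J) v")
      case True
      have "\<exists>c. (\<forall>j\<in>insert x J. c j \<in> k) \<and> v i - (\<Sum>j\<in>insert x J. c j * v j) \<in> N" if "i \<in> insert x I" for i
      proof (cases "i = x")
        case True
        have "(\<Sum>j\<in>J. (if j = x then 1 else 0) * v j) = 0"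
          using xJ by (intro sum.neutral) auto
        then show ?thesis using True xJ finJ sr N
          by (intro exI[of _ "\<lambda>j. if j = x then 1 else 0"]) (auto simp: sr_intros subspc_0)
      next
        case False
        then have "i \<in> I" using that by simp
        then obtain c where c: "\<forall>j\<in>J. c j \<in> k" "v i - (\<Sum>j\<in>J. c j * v j) \<in> N" using J(3) by blast
        have "(\<Sum>j\<in>J. (if j = x then 0 else c j) * v j) = (\<Sum>j\<in>J. c j * v j)"
          using xJ by (intro sum.cong) auto
        then show ?thesis using c xJ finJ sr
          by (intro exI[of _ "\<lambda>j. if j = x then 0 else c j"]) (auto simp: sr_intros)
      qed
      then have "\<forall>i\<in>insert x I. \<exists>c. (\<forall>j\<in>insert x J. c j \<in> k) \<and> v i - (\<Sum>j\<in>insert x J. c j * v j) \<in> N"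
        by blast
      moreover have "insert x J \<subseteq> insert x I" using J(1) by blast
      ultimately show ?thesis using True by blast
    next
      case False
      then obtain c i where c: "\<And>i. i \<in> insert x J \<Longrightarrow> c i \<in> k" "(\<Sum>i\<in>insert x J. c i * v i) \<in> N"
        and i: "i \<in> insert x J" "c i \<noteq> 0" unfolding indep_mod_def by blast
      have s: "c x * v x + (\<Sum>i\<in>J. c i * v i) \<in> N" using c(2) finJ xJ by simp
      have cx: "c x \<noteq> 0"
      proof
        assume 0: "c x = 0"
        then have "i \<in> J" using i by auto
        with indep_modD[OF J(2), of c i] c(1) s 0 i show False by auto
      qed
      have "inverse (c x) * (c x * v x + (\<Sum>i\<in>J. c i * v i)) \<in> N"
        using N s c(1)[of x] k by (intro subspc_scale) (auto intro: sr_intros)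
      also have "inverse (c x) * (c x * v x + (\<Sum>i\<in>J. c i * v i)) = v x - (\<Sum>j\<in>J. (- inverse (c x) * c j) * v j)"
        using cx by (simp add: distrib_left sum_distrib_left sum_negf mult.assoc)
      finally have "v x - (\<Sum>j\<in>J. (- inverse (c x) * c j) * v j) \<in> N" .
      moreover have "\<forall>j\<in>J. - inverse (c x) * c j \<in> k"
        using c(1) k by (auto intro!: sr_intros)
      ultimately have "\<exists>c. (\<forall>j\<in>J. c j \<in> k) \<and> v x - (\<Sum>j\<in>J. c j * v j) \<in> N"
        by (intro exI[of _ "\<lambda>j. - inverse (c x) * c j"]) auto
      then have "\<forall>i\<in>insert x I. \<exists>c. (\<forall>j\<in>J. c j \<in> k) \<and> v i - (\<Sum>j\<in>J. c j * v j) \<in> N"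
        using J(3) by blast
      moreover have "J \<subseteq> insert x I" using J(1) by blast
      ultimately show ?thesis using J(2) by blast
    qed
  qed
  then obtain J where J: "J \<subseteq> I" "indep_mod k N J v"
    "\<forall>i\<in>I. \<exists>c. (\<forall>j\<in>J. c j \<in> k) \<and> v i - (\<Sum>j\<in>J. c j * v j) \<in> N" by blast
  from bchoice[OF J(3)] J(1,2) show ?thesis by blast
qed

text \<open>For subspaces: \<open>(M + N) / N\<close> has dimension at least \<open>n\<close>, where
  \<open>N\<close> need not lie in \<open>M\<close>. Upper bounds are negations of this predicate,
  so counting never presupposes that a dimension is finite.\<close>

definition dim_ge :: "'a::field set \<Rightarrow> 'a set \<Rightarrow> 'a set \<Rightarrow> nat \<Rightarrow> bool"
  where "dim_ge k M N n \<longleftrightarrow> (\<exists>v. (\<forall>i<n. v i \<in> M) \<and> indep_mod k N {..<n} v)"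

lemma dim_geI:
  assumes "finite I" "n \<le> card I" "\<And>i. i \<in> I \<Longrightarrow> v i \<in> M" "indep_mod k N I v" "0 \<in> k"
  shows "dim_ge k M N n"
proof -
  obtain J where J: "J \<subseteq> I" "card J = n" using assms(1,2) by (meson obtain_subset_with_card_n)
  have "finite J" using J assms(1) finite_subset by blast
  then obtain h where h: "bij_betw h {..<n} J" using J(2) ex_bij_betw_nat_finite[of J]
    by (auto simp: lessThan_atLeast0)
  have "indep_mod k N {..<n} (\<lambda>j. v (h j))"
    using indep_mod_reindex[OF h] indep_mod_subset[OF assms(4) J(1) assms(1,5)] by blast
  moreover have "\<forall>i<n. v (h i) \<in> M" using h J(1) assms(3) by (auto simp: bij_betw_def)
  ultimately show ?thesis unfolding dim_ge_def by (intro exI[of _ "\<lambda>j. v (h j)"]) simp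
qed

lemma dim_ge_mono:
  assumes "dim_ge k M N n" "M \<subseteq> M'" "N' \<subseteq> N" "n' \<le> n" "0 \<in> k"
  shows "dim_ge k M' N' n'"
proof -
  obtain v where v: "\<forall>i<n. v i \<in> M" "indep_mod k N {..<n} v" using assms unfolding dim_ge_def by blast
  show ?thesis
    by (rule dim_geI[of "{..<n}" _ v, OF _ _ _ indep_mod_antimono[OF v(2) assms(3) order_refl]]) (use assms v in auto)
qed

lemma dim_ge_0 [simp]: "dim_ge k M N 0"
  unfolding dim_ge_def indep_mod_def by simp

text \<open>Combinations of vectors of \<open>M\<close> stay in \<open>M\<close>, so only
  \<open>M \<inter> N\<close> matters. This allows conditions at all places to be traded for
  conditions at selected ones.\<close>

lemma dim_ge_Int:
  assumes "dim_ge k M N n" "subspc k M" "M \<inter> N' \<subseteq> N"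
  shows "dim_ge k M N' n"
proof -
  obtain v where v: "\<forall>i<n. v i \<in> M" "indep_mod k N {..<n} v" using assms unfolding dim_ge_def by blast
  have "indep_mod k N' {..<n} v" unfolding indep_mod_def
  proof (intro allI impI)
    fix c assume c: "\<forall>i\<in>{..<n}. c i \<in> k" and s: "(\<Sum>i<n. c i * v i) \<in> N'"
    have "(\<Sum>i<n. c i * v i) \<in> M" using c v(1) assms(2) by (auto intro!: subspc_sum subspc_scale)
    with s assms(3) have "(\<Sum>i<n. c i * v i) \<in> N" by auto
    then show "\<forall>i\<in>{..<n}. c i = 0" using v(2) c unfolding indep_mod_def by blast
  qed
  with v show ?thesis unfolding dim_ge_def by blast
qed

lemma dim_ge_add:
  assumes 1: "dim_ge k M M1 a" and 2: "dim_ge k M1 M0 b" and M1: "subspc k M1" and sub: "M1 \<subseteq> M" "M0 \<subseteq> M1"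
    and k: "subring k \<Omega>"
  shows "dim_ge k M M0 (a + b)"
proof -
  obtain v where v: "\<forall>i<a. v i \<in> M" "indep_mod k M1 {..<a} v" using 1 unfolding dim_ge_def by blast
  obtain w where w: "\<forall>i<b. w i \<in> M1" "indep_mod k M0 {..<b} w" using 2 unfolding dim_ge_def by blast
  define u where "u i = (case i of Inl i \<Rightarrow> v i | Inr i \<Rightarrow> w i)" for i
  have "indep_mod k M0 ({..<a} <+> {..<b}) u" unfolding indep_mod_def
  proof (intro allI impI)
    fix c assume c: "\<forall>i\<in>{..<a} <+> {..<b}. c i \<in> k" and s: "(\<Sum>i\<in>{..<a} <+> {..<b}. c i * u i) \<in> M0"
    have e: "(\<Sum>i\<in>{..<a} <+> {..<b}. c i * u i) = (\<Sum>i<a. c (Inl i) * v i) + (\<Sum>i<b. c (Inr i) * w i)"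
      by (subst sum.Plus) (auto simp: u_def)
    have s2: "(\<Sum>i<b. c (Inr i) * w i) \<in> M1" using w(1) c M1 by (auto intro!: subspc_sum subspc_scale)
    have "(\<Sum>i<a. c (Inl i) * v i) = (\<Sum>i\<in>{..<a} <+> {..<b}. c i * u i) - (\<Sum>i<b. c (Inr i) * w i)"
      by (simp add: e)
    also have "\<dots> \<in> M1" using s sub s2 M1 k by (intro subspc_diff) auto
    finally have z: "c (Inl i) = 0" if "i < a" for i
      using indep_modD[OF v(2), of "\<lambda>i. c (Inl i)" i] c that by auto
    then have "(\<Sum>i<b. c (Inr i) * w i) \<in> M0" using s e by simp
    then have z2: "c (Inr i) = 0" if "i < b" for i
      using indep_modD[OF w(2), of "\<lambda>i. c (Inr i)" i] c that by auto
    show "\<forall>i\<in>{..<a} <+> {..<b}. c i = 0" using z z2 by auto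
  qed
  then show ?thesis
    by (rule dim_geI[rotated 3]) (use v w sub sr_0[OF k] in \<open>auto simp: u_def card_Plus\<close>)
qed

text \<open>Take a maximal subfamily that is independent modulo \<open>M1\<close>. If it has at most
  \<open>a\<close> members, then each of the at least \<open>b + 1\<close> other vectors can be
  corrected by a combination of it to lie in \<open>M1\<close>, and the corrected vectors stay
  independent modulo \<open>M0\<close>. The contrapositive is subadditivity of upper bounds.\<close>

lemma dim_ge_split:
  assumes ge: "dim_ge k M M0 (a + b + 1)" and k: "subfield k \<Omega>" and M: "subspc k M" and M1: "subspc k M1"
  shows "dim_ge k M M1 (a + 1) \<or> dim_ge k (M1 \<inter> M) M0 (b + 1)"
proof -
  have sr: "subring k \<Omega>" using k by (rule sf_sr)
  let ?I = "{..<a+b+1}"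
  obtain v where v: "\<And>i. i < a + b + 1 \<Longrightarrow> v i \<in> M" "indep_mod k M0 ?I v" using ge unfolding dim_ge_def by blast
  obtain J c where J: "J \<subseteq> ?I" "indep_mod k M1 J v"
    and Jc: "\<forall>i\<in>?I. (\<forall>j\<in>J. c i j \<in> k) \<and> v i - (\<Sum>j\<in>J. c i j * v j) \<in> M1"
    using maximal_indep_mod[OF k M1 finite_lessThan] by blast
  have c: "\<And>i j. i \<in> ?I \<Longrightarrow> j \<in> J \<Longrightarrow> c i j \<in> k" "\<And>i. i \<in> ?I \<Longrightarrow> v i - (\<Sum>j\<in>J. c i j * v j) \<in> M1"
    using Jc by blast+
  have finJ: "finite J" using J finite_subset by blast
  show ?thesis
  proof (cases "card J \<ge> a + 1")
    case True
    have "dim_ge k M M1 (a + 1)"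
      by (rule dim_geI[OF finJ True _ J(2)]) (use v J sr in \<open>auto intro: sr_intros\<close>)
    then show ?thesis ..
  next
    case False
    have card: "card (?I - J) \<ge> b + 1" using False J(1) by (subst card_Diff_subset) (auto simp: finJ)
    define w where "w i = v i - (\<Sum>j\<in>J. c i j * v j)" for i
    have wM: "w i \<in> M1 \<inter> M" if "i \<in> ?I - J" for i
      using c(2)[of i] that v(1) J(1) M sr c(1)[of i]
      by (auto simp: w_def intro!: subspc_diff[of k] subspc_sum[of k] subspc_scale[of k])
    have ind: "indep_mod k M0 (?I - J) w" unfolding indep_mod_def
    proof (intro allI impI)
      fix d assume d: "\<forall>i\<in>?I - J. d i \<in> k" and s: "(\<Sum>i\<in>?I-J. d i * w i) \<in> M0"
      \<comment> \<open>A relation among the corrected vectors is one among the original ones; the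
        coefficient at an index in \<open>J\<close> collects everything that the corrections
        subtract.\<close>
      define e where "e j = (if j \<in> J then - (\<Sum>i\<in>?I-J. d i * c i j) else d j)" for j
      have "(\<Sum>i\<in>?I-J. d i * w i) = (\<Sum>i\<in>?I-J. d i * v i) - (\<Sum>i\<in>?I-J. \<Sum>j\<in>J. d i * c i j * v j)"
        by (simp add: w_def right_diff_distrib sum_subtractf sum_distrib_left mult.assoc)
      also have "(\<Sum>i\<in>?I-J. \<Sum>j\<in>J. d i * c i j * v j) = (\<Sum>j\<in>J. (\<Sum>i\<in>?I-J. d i * c i j) * v j)"
        by (subst sum.swap) (simp add: sum_distrib_right)
      also have "(\<Sum>i\<in>?I-J. d i * v i) = (\<Sum>i\<in>?I-J. e i * v i)"
        by (intro sum.cong) (auto simp: e_def)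
      also have "(\<Sum>j\<in>J. (\<Sum>i\<in>?I-J. d i * c i j) * v j) = - (\<Sum>j\<in>J. e j * v j)"
        by (simp add: e_def sum_negf)
      also have "(\<Sum>i\<in>?I-J. e i * v i) - - (\<Sum>j\<in>J. e j * v j) = (\<Sum>i\<in>?I. e i * v i)"
        using sum.subset_diff[OF J(1), of "\<lambda>i. e i * v i"] by simp
      finally have s': "(\<Sum>i\<in>?I. e i * v i) \<in> M0" using s by simp
      have e: "e i \<in> k" if "i \<in> ?I" for i
        using that d c(1) sr by (auto simp: e_def intro!: sr_intros)
      have "e i = 0" if "i \<in> ?I" for i
        by (rule indep_modD[OF v(2) e s' that])
      then show "\<forall>i\<in>?I-J. d i = 0" using e_def by (metis DiffE)
    qed
    have "dim_ge k (M1 \<inter> M) M0 (b + 1)"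
      by (rule dim_geI[OF _ card wM ind]) (use sr in \<open>auto intro: sr_intros\<close>)
    then show ?thesis ..
  qed
qed

lemma dim_le_add:
  assumes "\<not> dim_ge k M M1 (Suc a)" "\<not> dim_ge k M1 M0 (Suc b)"
    "subfield k \<Omega>" "subspc k M" "subspc k M1"
  shows "\<not> dim_ge k M M0 (Suc (a + b))"
  using dim_ge_split[of k M M0 a b M1] assms dim_ge_mono[of k "M1 \<inter> M" M0 _ M1 M0]
  by (auto simp: sr_intros)

lemma dim_ge_scale:
  assumes "dim_ge k M N n" "\<And>x. x \<in> M \<Longrightarrow> h * x \<in> M'" "\<And>x. h * x \<in> N' \<Longrightarrow> x \<in> N"
  shows "dim_ge k M' N' n"
proof -
  obtain v where v: "\<forall>i<n. v i \<in> M" "indep_mod k N {..<n} v" using assms unfolding dim_ge_def by blast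
  have "indep_mod k N' {..<n} (\<lambda>i. h * v i)" unfolding indep_mod_def
  proof (intro allI impI)
    fix c assume c: "\<forall>i\<in>{..<n}. c i \<in> k" and s: "(\<Sum>i<n. c i * (h * v i)) \<in> N'"
    have "(\<Sum>i<n. c i * (h * v i)) = h * (\<Sum>i<n. c i * v i)" by (simp add: sum_distrib_left mult_ac)
    with s assms(3) have "(\<Sum>i<n. c i * v i) \<in> N" by simp
    then show "\<forall>i\<in>{..<n}. c i = 0" using indep_modD[OF v(2), of c] c by blast
  qed
  with v assms(2) show ?thesis unfolding dim_ge_def by (intro exI[of _ "\<lambda>i. h * v i"]) auto
qed

declare Om.Span.simps [simp del]

subsection \<open>Comparison with the linear algebra and the polynomials of HOL-Algebra\<close>

lemma combine_eq_sum:
  "length cs = length us \<Longrightarrow> Om.combine cs us = (\<Sum>i<length us. cs ! i * us ! i)"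
proof (induction cs arbitrary: us)
  case Nil
  then show ?case by simp
next
  case (Cons c cs)
  then obtain u us' where "us = u # us'" by (cases us) auto
  with Cons show ?case by (simp add: sum.lessThan_Suc_shift del: sum.lessThan_Suc)
qed

lemma Span_iff:
  assumes k: "subfield k \<Omega>"
  shows "x \<in> Om.Span k us \<longleftrightarrow> (\<exists>c. (\<forall>i<length us. c i \<in> k) \<and> x = (\<Sum>i<length us. c i * us ! i))"
proof
  assume "x \<in> Om.Span k us"
  then obtain cs where cs: "set cs \<subseteq> k" "length cs = length us" "x = Om.combine cs us"
    using Om.Span_mem_iff_length_version[OF k, of us x] by auto
  then show "\<exists>c. (\<forall>i<length us. c i \<in> k) \<and> x = (\<Sum>i<length us. c i * us ! i)"
    by (intro exI[of _ "\<lambda>i. cs ! i"]) (auto simp: combine_eq_sum)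
next
  assume "\<exists>c. (\<forall>i<length us. c i \<in> k) \<and> x = (\<Sum>i<length us. c i * us ! i)"
  then obtain c where c: "\<forall>i<length us. c i \<in> k" "x = (\<Sum>i<length us. c i * us ! i)" by blast
  have "x = Om.combine (map c [0..<length us]) us" using c(2) by (simp add: combine_eq_sum)
  then show "x \<in> Om.Span k us"
    using Om.Span_mem_iff_length_version[OF k, of us x] c(1)
    by (auto intro!: exI[of _ "map c [0..<length us]"])
qed

lemma independent_iff:
  assumes k: "subfield k \<Omega>"
  shows "Om.independent k us \<longleftrightarrow> indep_mod k {0} {..<length us} (\<lambda>i. us ! i)"
proof
  assume ind: "Om.independent k us"
  show "indep_mod k {0} {..<length us} (\<lambda>i. us ! i)" unfolding indep_mod_def
  proof (intro allI impI)
    fix c assume c: "\<forall>i\<in>{..<length us}. c i \<in> k" and s: "(\<Sum>i<length us. c i * us ! i) \<in> {0}"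
    have "Om.combine (map c [0..<length us]) us = 0" using s by (simp add: combine_eq_sum)
    moreover have "set (map c [0..<length us]) \<subseteq> k" using c by auto
    ultimately have "set (take (length us) (map c [0..<length us])) \<subseteq> {0}"
      using Om.independent_imp_trivial_combine[OF k ind, of "map c [0..<length us]"] by simp
    then have "c ` {0..<length us} \<subseteq> {0}" by simp
    then show "\<forall>i\<in>{..<length us}. c i = 0" by (auto simp: image_subset_iff)
  qed
next
  assume ind: "indep_mod k {0} {..<length us} (\<lambda>i. us ! i)"
  show "Om.independent k us"
  proof (rule ccontr)
    assume "\<not> ?thesis"
    then obtain cs where cs: "length cs = length us" "Om.combine cs us = 0" "set cs \<subseteq> k" "set cs \<noteq> {0}"
      using Om.dependent_imp_non_trivial_combine[OF k, of us] by auto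
    have "cs ! i = 0" if "i < length us" for i
    proof (rule indep_modD[OF ind])
      show "cs ! j \<in> k" if "j \<in> {..<length us}" for j
        using cs(1,3) that by (auto simp: subset_iff)
    qed (use that cs(1,2) in \<open>auto simp: combine_eq_sum\<close>)
    then have "set cs \<subseteq> {0}" using cs(1) by (auto simp: in_set_conv_nth)
    then have "us = []" using cs by (auto simp: subset_singleton_iff)
    then show False using \<open>\<not> Om.independent k us\<close> by simp
  qed
qed

lemma dimension_imp:
  assumes k: "subfield k \<Omega>" and d: "Om.dimension n k E"
  shows "subspc k E" "dim_ge k E {0} m \<longleftrightarrow> m \<le> n"
    "\<exists>b. (\<forall>i<n. b i \<in> E) \<and> (\<forall>x\<in>E. \<exists>c. (\<forall>i<n. c i \<in> k) \<and> x = (\<Sum>i<n. c i * b i))"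
proof -
  obtain us where us: "Om.independent k us" "length us = n" "Om.Span k us = E"
    using Om.exists_base[OF k d] by auto
  have incl: "set us \<subseteq> E" using Om.Span_base_incl[OF k, of us] us(3) by auto
  show sp: "subspc k E"
    using Om.space_subgroup_props[OF k d] by (auto simp: subspc_def)
  have k0: "0 \<in> k" using k by (auto intro: sr_intros)
  have "m \<le> n" if dg: "dim_ge k E {0} m"
  proof -
    obtain v where v: "\<forall>i<m. v i \<in> E" "indep_mod k {0} {..<m} v"
      using dg unfolding dim_ge_def by blast
    have "indep_mod k {0} {..<m} (\<lambda>i. map v [0..<m] ! i)"
      using v(2) unfolding indep_mod_def by simp
    then have "Om.independent k (map v [0..<m])" by (simp add: independent_iff[OF k])
    moreover have "set (map v [0..<m]) \<subseteq> E" using v by auto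
    ultimately show ?thesis using Om.independent_length_le_dimension[OF k d] by fastforce
  qed
  moreover have "dim_ge k E {0} n"
    by (rule dim_geI[of "{..<n}" _ "\<lambda>i. us ! i"]) (use us incl k0 independent_iff[OF k] in auto)
  ultimately show "dim_ge k E {0} m \<longleftrightarrow> m \<le> n"
    using dim_ge_mono[of k E "{0}" n E "{0}" m] k0 by blast
  show "\<exists>b. (\<forall>i<n. b i \<in> E) \<and> (\<forall>x\<in>E. \<exists>c. (\<forall>i<n. c i \<in> k) \<and> x = (\<Sum>i<n. c i * b i))"
  proof (rule exI[of _ "\<lambda>i. us ! i"], intro conjI allI impI ballI)
    show "us ! i \<in> E" if "i < n" for i using us incl that by (auto simp: subset_iff)
    show "\<exists>c. (\<forall>i<n. c i \<in> k) \<and> x = (\<Sum>i<n. c i * us ! i)" if "x \<in> E" for x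
      using us Span_iff[OF k, of x us] that by auto
  qed
qed

lemma not_dim_ge_ex:
  assumes "\<not> dim_ge k M N (Suc m)"
  shows "\<exists>n\<le>m. dim_ge k M N n \<and> \<not> dim_ge k M N (Suc n)"
  using assms
proof (induction m)
  case (Suc m)
  then show ?case by (cases "dim_ge k M N (Suc m)") (auto intro: le_SucI)
qed (auto intro: exI[of _ 0])

lemma dimension_ex:
  assumes k: "subfield k \<Omega>" and E: "subspc k E" and "\<not> dim_ge k E {0} (Suc N)"
  shows "\<exists>n\<le>N. Om.dimension n k E"
proof -
  have k0: "0 \<in> k" "1 \<in> k" using k by (auto intro: sr_intros)
  obtain n where n: "n \<le> N" "dim_ge k E {0} n" "\<not> dim_ge k E {0} (Suc n)"
    using not_dim_ge_ex[OF assms(3)] by blast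
  then obtain v where v: "\<forall>i<n. v i \<in> E" "indep_mod k {0} {..<n} v"
    unfolding dim_ge_def by blast
  define us where "us = map v [0..<n]"
  have len: "length us = n" by (simp add: us_def)
  have "indep_mod k {0} {..<n} (\<lambda>i. us ! i)"
    using v(2) unfolding indep_mod_def us_def by simp
  then have ind: "Om.independent k us" by (simp add: independent_iff[OF k] len)
  have "Om.Span k us = E"
  proof
    show "Om.Span k us \<subseteq> E"
      using v(1) E by (auto simp: Span_iff[OF k] us_def intro!: subspc_sum subspc_scale)
    show "E \<subseteq> Om.Span k us"
    proof
      fix x assume x: "x \<in> E"
      show "x \<in> Om.Span k us"
      proof (rule ccontr)
        assume "x \<notin> Om.Span k us"
        then have "Om.independent k (x # us)" using ind by (intro Om.li_Cons) auto
        then have i: "indep_mod k {0} {..<Suc n} (\<lambda>i. (x # us) ! i)" using len by (simp add: independent_iff[OF k])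
        have "(x # us) ! i \<in> E" if "i < Suc n" for i
          using x v(1) that by (cases i) (auto simp: us_def)
        then have "dim_ge k E {0} (Suc n)" unfolding dim_ge_def using i by (intro exI[of _ "\<lambda>i. (x # us) ! i"]) simp
        with n show False by blast
      qed
    qed
  qed
  then have "Om.dimension n k E" using Om.dimensionI[OF k ind] len by simp
  with n show ?thesis by blast
qed

lemma ext_degree_eq: "subfield k \<Omega> \<Longrightarrow> Om.dimension n k E \<Longrightarrow> ext_degree k E = n"
  using Om.dimI[of k n E] by (simp add: ext_degree_def over_def)

lemma poly_over_0 [simp]: "0 \<in> k \<Longrightarrow> 0 \<in> poly_over k"
  by (simp add: poly_over_def)

lemma pCons_poly_over_iff [simp]: "pCons a p \<in> poly_over k \<longleftrightarrow> a \<in> k \<and> p \<in> poly_over k"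
  unfolding poly_over_def
  by (auto simp: coeff_pCons split: nat.splits dest: spec[of _ 0] spec[of _ "Suc _"])

lemma poly_over_mono: "p \<in> poly_over k \<Longrightarrow> k \<subseteq> R \<Longrightarrow> p \<in> poly_over R"
  by (auto simp: poly_over_def)

lemma poly_in_subring:
  "subring R \<Omega> \<Longrightarrow> p \<in> poly_over R \<Longrightarrow> x \<in> R \<Longrightarrow> poly p x \<in> R"
  unfolding poly_altdef by (auto simp: poly_over_def intro!: sr_intros)

lemma poly_over_add: "subring R \<Omega> \<Longrightarrow> p \<in> poly_over R \<Longrightarrow> q \<in> poly_over R \<Longrightarrow> p + q \<in> poly_over R"
  by (auto simp: poly_over_def intro: sr_intros)

lemma poly_over_diff: "subring R \<Omega> \<Longrightarrow> p \<in> poly_over R \<Longrightarrow> q \<in> poly_over R \<Longrightarrow> p - q \<in> poly_over R"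
  by (auto simp: poly_over_def intro: sr_intros)

lemma poly_over_mult: "subring R \<Omega> \<Longrightarrow> p \<in> poly_over R \<Longrightarrow> q \<in> poly_over R \<Longrightarrow> p * q \<in> poly_over R"
  by (auto simp: poly_over_def coeff_mult intro!: sr_intros)

lemma poly_over_smult: "subring R \<Omega> \<Longrightarrow> c \<in> R \<Longrightarrow> q \<in> poly_over R \<Longrightarrow> Polynomial.smult c q \<in> poly_over R"
  by (auto simp: poly_over_def intro!: sr_intros)

lemma poly_over_1: "subring R \<Omega> \<Longrightarrow> 1 \<in> poly_over R"
  by (auto simp: poly_over_def coeff_1 intro: sr_intros)

lemma poly_over_monom: "subring R \<Omega> \<Longrightarrow> c \<in> R \<Longrightarrow> Polynomial.monom c n \<in> poly_over R"
  by (auto simp: poly_over_def intro: sr_intros)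

lemma poly_over_sum: "subring R \<Omega> \<Longrightarrow> (\<And>i. i \<in> I \<Longrightarrow> f i \<in> poly_over R) \<Longrightarrow> sum f I \<in> poly_over R"
  by (induction I rule: infinite_finite_induct) (auto intro: poly_over_add poly_over_0 sr_0)

lemma poly_over_prod: "subring R \<Omega> \<Longrightarrow> (\<And>i. i \<in> I \<Longrightarrow> f i \<in> poly_over R) \<Longrightarrow> prod f I \<in> poly_over R"
  by (induction I rule: infinite_finite_induct) (auto intro: poly_over_mult poly_over_1)

lemma poly_over_power: "subring R \<Omega> \<Longrightarrow> p \<in> poly_over R \<Longrightarrow> p ^ n \<in> poly_over R"
  by (induction n) (auto intro: poly_over_mult poly_over_1)

lemmas poly_over_intros = poly_over_add poly_over_diff poly_over_mult poly_over_smult poly_over_1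
  poly_over_monom poly_over_sum poly_over_prod poly_over_power poly_over_0

text \<open>HOL-Algebra lists the coefficients of a polynomial from the leading one downwards, hence
  the reversal.\<close>

lemma eval_eq_poly: "Om.eval xs x = poly (Poly (rev xs)) x"
proof (induction xs)
  case (Cons a xs)
  have "Poly (rev xs @ [a]) = Poly (rev xs) + Polynomial.monom a (length xs)"
    by (rule poly_eqI) (auto simp: nth_default_def nth_append)
  with Cons show ?case by (simp add: poly_monom add.commute)
qed simp

lemma carrier_univ_poly: "xs \<in> carrier (k[X]\<^bsub>\<Omega>\<^esub>) \<longleftrightarrow> xs = [] \<or> set xs \<subseteq> k \<and> hd xs \<noteq> 0"
  by (simp add: univ_poly_def polynomial_def)

lemma rev_coeffs_in_carrier:
  assumes "p \<in> poly_over k"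
  shows "rev (coeffs p) \<in> carrier (k[X]\<^bsub>\<Omega>\<^esub>)"
proof (cases "p = 0")
  case False
  then have "hd (rev (coeffs p)) \<noteq> 0" by (simp add: hd_rev last_coeffs_eq_coeff_degree)
  moreover have "set (coeffs p) \<subseteq> k" using assms by (auto simp: coeffs_def poly_over_def)
  ultimately show ?thesis by (simp add: carrier_univ_poly)
qed (simp add: carrier_univ_poly)

lemma eval_rev_coeffs: "Om.eval (rev (coeffs p)) x = poly p x"
  by (simp add: eval_eq_poly)

lemma algebraic_iff:
  assumes k: "subfield k \<Omega>"
  shows "\<not> Om.transcendental k x \<longleftrightarrow> (\<exists>p\<in>poly_over k. p \<noteq> 0 \<and> poly p x = 0)"
proof
  assume "\<not> Om.transcendental k x"
  then obtain xs where xs: "xs \<in> carrier (k[X]\<^bsub>\<Omega>\<^esub>)" "xs \<noteq> []" "Om.eval xs x = 0"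
    using Om.algebraicE[of k x] sf_sr[OF k] by (auto simp: over_def)
  have "Poly (rev xs) \<noteq> 0"
  proof
    assume "Poly (rev xs) = 0"
    then obtain n where n: "rev xs = replicate n 0" by (auto simp: Poly_eq_0)
    then have "rev (rev xs) = rev (replicate n 0)" by (rule arg_cong)
    then have "xs = replicate n 0" by simp
    then show False using xs by (cases n) (auto simp: carrier_univ_poly)
  qed
  moreover have "Poly (rev xs) \<in> poly_over k"
  proof -
    have "nth_default 0 (rev xs) i \<in> k" for i
    proof (cases "i < length xs")
      case True
      then have "rev xs ! i \<in> set (rev xs)" by (intro nth_mem) simp
      then show ?thesis using True xs(1,2) by (auto simp: nth_default_def carrier_univ_poly)
    qed (use k in \<open>auto simp: nth_default_def intro: sr_intros\<close>)
    then show ?thesis by (simp add: poly_over_def)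
  qed
  ultimately show "\<exists>p\<in>poly_over k. p \<noteq> 0 \<and> poly p x = 0" using xs(3) by (auto simp: eval_eq_poly)
next
  assume "\<exists>p\<in>poly_over k. p \<noteq> 0 \<and> poly p x = 0"
  then obtain p where "p \<in> poly_over k" "p \<noteq> 0" "poly p x = 0" by blast
  then show "\<not> Om.transcendental k x"
    using Om.algebraicI[of "rev (coeffs p)" k x] rev_coeffs_in_carrier[of p k]
    by (auto simp: over_def eval_rev_coeffs)
qed

lemma simple_extension_eq_polys:
  assumes k: "subfield k \<Omega>"
  shows "Om.simple_extension k x = {poly p x |p. p \<in> poly_over k}"
proof
  show "Om.simple_extension k x \<subseteq> {poly p x |p. p \<in> poly_over k}"
  proof
    fix y assume "y \<in> Om.simple_extension k x"
    then show "y \<in> {poly p x |p. p \<in> poly_over k}"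
    proof induction
      case zero
      then show ?case using k by (auto intro!: exI[of _ 0] poly_over_0 sr_intros)
    next
      case (lin k1 k2)
      then obtain p where "k1 = poly p x" "p \<in> poly_over k" by blast
      then show ?case using lin by (auto intro!: exI[of _ "pCons k2 p"])
    qed
  qed
  show "{poly p x |p. p \<in> poly_over k} \<subseteq> Om.simple_extension k x"
  proof safe
    fix p assume "p \<in> poly_over k"
    then show "poly p x \<in> Om.simple_extension k x"
    proof (induction p)
      case 0
      then show ?case using Om.simple_extension.zero by simp
    next
      case (pCons a p)
      then show ?case using Om.simple_extension.lin[of "poly p x" k x a] by (simp add: add.commute mult.commute)
    qed
  qed
qed

text \<open>The minimal polynomial divides \<open>p\<close>, so the degree of the extension is
  bounded by that of \<open>p\<close>, which may be reducible.\<close>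

lemma simple_extension_algebraic:
  assumes k: "subfield k \<Omega>" and p: "p \<in> poly_over k" "p \<noteq> 0" "poly p x = 0"
  shows "subfield (Om.simple_extension k x) \<Omega>"
    "\<exists>m\<le>Polynomial.degree p. Om.dimension m k (Om.simple_extension k x)"
proof -
  have alg: "(Om.algebraic over k) x" using algebraic_iff[OF k, of x] p by (auto simp: over_def)
  show "subfield (Om.simple_extension k x) \<Omega>"
    using Om.simple_extension_is_subfield[OF k, of x] alg by (auto simp: over_def)
  have "Om.Irr k x pdivides\<^bsub>\<Omega>\<^esub> rev (coeffs p)"
    using Om.Irr_minimal[OF k _ alg rev_coeffs_in_carrier[OF p(1)]] p by (auto simp: eval_rev_coeffs)
  then have "length (Om.Irr k x) - 1 \<le> length (rev (coeffs p)) - 1"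
    using Om.pdivides_imp_degree_le[OF sf_sr[OF k] Om.IrrE(1)[OF k _ alg] rev_coeffs_in_carrier[OF p(1)]] p(2)
    by auto
  also have "\<dots> = Polynomial.degree p" using p(2) by (simp add: length_coeffs)
  finally show "\<exists>m\<le>Polynomial.degree p. Om.dimension m k (Om.simple_extension k x)"
    using Om.dimension_simple_extension[OF k _ alg] by auto
qed

subsection \<open>Linear disjointness\<close>

text \<open>The image of the tensor product of \<open>L\<close> and \<open>M\<close> in the
  universal domain. For linearly disjoint fields it is the tensor product itself, and the base
  changes of fields, local rings and Riemann-Roch spaces are all treated in this form.\<close>

definition lspan :: "'a::field set \<Rightarrow> 'a set \<Rightarrow> 'a set"
  where "lspan L M = {z. \<exists>(n::nat) l m. (\<forall>i<n. l i \<in> L \<and> m i \<in> M) \<and> z = (\<Sum>i<n. l i * m i)}"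

lemma lspanI:
  assumes "finite I" "\<And>i. i \<in> I \<Longrightarrow> l i \<in> L" "\<And>i. i \<in> I \<Longrightarrow> m i \<in> M"
  shows "(\<Sum>i\<in>I. l i * m i) \<in> lspan L M"
proof -
  obtain h where h: "bij_betw h {..<card I} I"
    using ex_bij_betw_nat_finite[OF assms(1)] by (auto simp: lessThan_atLeast0)
  have "(\<Sum>i\<in>I. l i * m i) = (\<Sum>i<card I. l (h i) * m (h i))"
    by (rule sum.reindex_bij_betw[OF h, symmetric])
  moreover have "\<forall>i<card I. l (h i) \<in> L \<and> m (h i) \<in> M" using h assms(2,3) by (auto simp: bij_betw_def)
  ultimately show ?thesis unfolding lspan_def mem_Collect_eq
    by (intro exI[of _ "card I"] exI[of _ "\<lambda>i. l (h i)"] exI[of _ "\<lambda>i. m (h i)"]) simp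
qed

lemma lspanE:
  assumes "z \<in> lspan L M"
  obtains n :: nat and l m where "\<And>i. i < n \<Longrightarrow> l i \<in> L" "\<And>i. i < n \<Longrightarrow> m i \<in> M" "z = (\<Sum>i<n. l i * m i)"
  using assms unfolding lspan_def by blast

lemma lspan_mult: "l \<in> L \<Longrightarrow> m \<in> M \<Longrightarrow> l * m \<in> lspan L M"
  using lspanI[of "{()}" "\<lambda>_. l" L "\<lambda>_. m" M] by simp

lemma lspan_0 [simp]: "0 \<in> lspan L M"
  using lspanI[of "{}" undefined L undefined M] by simp

lemma lspan_add: "x \<in> lspan L M \<Longrightarrow> y \<in> lspan L M \<Longrightarrow> x + y \<in> lspan L M"
proof (elim lspanE)
  fix n n' :: nat and l m l' m'
  assume a: "\<And>i. i < n \<Longrightarrow> l i \<in> L" "\<And>i. i < n \<Longrightarrow> m i \<in> M" "x = (\<Sum>i<n. l i * m i)"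
    "\<And>i. i < n' \<Longrightarrow> l' i \<in> L" "\<And>i. i < n' \<Longrightarrow> m' i \<in> M" "y = (\<Sum>i<n'. l' i * m' i)"
  have "(\<Sum>i\<in>{..<n} <+> {..<n'}. case_sum l l' i * case_sum m m' i) \<in> lspan L M"
    by (rule lspanI) (use a in auto)
  also have "(\<Sum>i\<in>{..<n} <+> {..<n'}. case_sum l l' i * case_sum m m' i) = x + y"
    by (subst sum.Plus) (auto simp: a)
  finally show ?thesis .
qed

lemma lspan_sum: "(\<And>i. i \<in> I \<Longrightarrow> f i \<in> lspan L M) \<Longrightarrow> sum f I \<in> lspan L M"
  by (induction I rule: infinite_finite_induct) (auto intro: lspan_add)

lemma lspan_scale:
  assumes "x \<in> lspan L M" "\<And>l. l \<in> L \<Longrightarrow> c * l \<in> L"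
  shows "c * x \<in> lspan L M"
  using assms(1)
proof (elim lspanE)
  fix n :: nat and l m
  assume a: "\<And>i. i < n \<Longrightarrow> l i \<in> L" "\<And>i. i < n \<Longrightarrow> m i \<in> M" "x = (\<Sum>i<n. l i * m i)"
  have "c * x = (\<Sum>i<n. (c * l i) * m i)" by (simp add: a sum_distrib_left mult.assoc)
  also have "\<dots> \<in> lspan L M" by (rule lspanI) (use a assms(2) in auto)
  finally show ?thesis .
qed

lemma lspan_scale':
  assumes "x \<in> lspan L M" "\<And>l. l \<in> M \<Longrightarrow> c * l \<in> M'"
  shows "c * x \<in> lspan L M'"
  using assms(1)
proof (elim lspanE)
  fix n :: nat and l m
  assume a: "\<And>i. i < n \<Longrightarrow> l i \<in> L" "\<And>i. i < n \<Longrightarrow> m i \<in> M" "x = (\<Sum>i<n. l i * m i)"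
  have "c * x = (\<Sum>i<n. l i * (c * m i))" by (simp add: a sum_distrib_left mult_ac)
  also have "\<dots> \<in> lspan L M'" by (rule lspanI) (use a assms(2) in auto)
  finally show ?thesis .
qed

lemma subspc_lspan: "subring L \<Omega> \<Longrightarrow> subspc L (lspan L M)"
  by (auto simp: subspc_def intro: lspan_add lspan_scale sr_intros)

lemma lspan_incl: "1 \<in> L \<Longrightarrow> M \<subseteq> lspan L M"
  using lspan_mult[of 1 L] by fastforce

lemma lspan_incl': "1 \<in> M \<Longrightarrow> L \<subseteq> lspan L M"
  using lspan_mult[of _ L 1 M] by fastforce

lemma lspan_mono: "L \<subseteq> L' \<Longrightarrow> M \<subseteq> M' \<Longrightarrow> lspan L M \<subseteq> lspan L' M'"
  by (auto elim!: lspanE intro!: lspanI)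

lemma lspan_commute: "lspan L M = lspan M L"
proof -
  have "lspan L M \<subseteq> lspan M L" for L M :: "'a set"
  proof
    fix z assume "z \<in> lspan L M"
    then show "z \<in> lspan M L"
    proof (elim lspanE)
      fix n :: nat and l m
      assume a: "\<And>i. i < n \<Longrightarrow> l i \<in> L" "\<And>i. i < n \<Longrightarrow> m i \<in> M" "z = (\<Sum>i<n. l i * m i)"
      have "(\<Sum>i<n. m i * l i) \<in> lspan M L" by (rule lspanI) (use a in auto)
      then show ?thesis by (simp add: a(3) mult.commute)
    qed
  qed
  then show ?thesis by blast
qed

lemma lspan_minimal: "subspc L N \<Longrightarrow> M \<subseteq> N \<Longrightarrow> lspan L M \<subseteq> N"
  by (auto elim!: lspanE intro!: subspc_sum subspc_scale)

lemma subring_lspan: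
  assumes "subring L \<Omega>" "subring M \<Omega>"
  shows "subring (lspan L M) \<Omega>"
proof -
  have sp: "subspc L (lspan L M)" by (rule subspc_lspan[OF assms(1)])
  have "x * y \<in> lspan L M" if "x \<in> lspan L M" "y \<in> lspan L M" for x y
    using that
  proof (elim lspanE)
    fix n n' :: nat and l m l' m'
    assume a: "\<And>i. i < n \<Longrightarrow> l i \<in> L" "\<And>i. i < n \<Longrightarrow> m i \<in> M" "x = (\<Sum>i<n. l i * m i)"
      "\<And>i. i < n' \<Longrightarrow> l' i \<in> L" "\<And>i. i < n' \<Longrightarrow> m' i \<in> M" "y = (\<Sum>i<n'. l' i * m' i)"
    have "x * y = (\<Sum>i<n. \<Sum>j<n'. (l i * m i) * (l' j * m' j))"
      by (simp add: a sum_product)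
    also have "\<dots> = (\<Sum>i<n. \<Sum>j<n'. (l i * l' j) * (m i * m' j))"
      by (intro sum.cong refl) (simp add: mult_ac)
    also have "\<dots> \<in> lspan L M"
      by (intro lspan_sum lspan_mult) (use a assms in \<open>auto intro: sr_intros\<close>)
    finally show ?thesis .
  qed
  then show ?thesis unfolding subring_Omega_iff
    using lspan_mult[of 1 L 1 M] assms subspc_minus[OF sp assms(1)]
    by (auto intro: sr_intros lspan_add)
qed

text \<open>Turns the ring in the definition of \<open>smooth_at\<close> into a span, to which the
  coordinate arguments apply.\<close>

lemma generate_ring_Un:
  assumes "subring L \<Omega>" "subring M \<Omega>"
  shows "generate_ring \<Omega> (M \<union> L) = lspan L M"
proof
  show "generate_ring \<Omega> (M \<union> L) \<subseteq> lspan L M"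
    using subring_lspan[OF assms] lspan_incl[of L M] lspan_incl'[of M L] assms
    by (intro Om.generate_ring_min_subring1) (auto intro: sr_intros)
  have sr: "subring (generate_ring \<Omega> (M \<union> L)) \<Omega>"
    by (rule Om.generate_ring_is_subring) simp
  show "lspan L M \<subseteq> generate_ring \<Omega> (M \<union> L)"
    by (intro lspan_minimal) (use sr in \<open>auto simp: subspc_def intro: generate_ring.incl sr_intros\<close>)
qed

lemma generate_field_props:
  "subfield (generate_field \<Omega> S) \<Omega>" "S \<subseteq> generate_field \<Omega> S"
  "subfield E \<Omega> \<Longrightarrow> S \<subseteq> E \<Longrightarrow> generate_field \<Omega> S \<subseteq> E"
  using field.generate_field_is_subfield[OF Omega_field, of S]
    field.generate_field_min_subfield1[OF Omega_field, of S E]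
  by (auto intro: generate_field.incl)

lemma alg_closure_of_subfield:
  assumes "subfield k \<Omega>"
  shows "subfield (alg_closure_of k) \<Omega>" "k \<subseteq> alg_closure_of k"
proof -
  show "subfield (alg_closure_of k) \<Omega>"
    using field.subfield_of_algebraics[OF Omega_field assms] by (simp add: alg_closure_of_def over_def)
  show "k \<subseteq> alg_closure_of k"
    using Om.algebraic_self[OF sf_sr[OF assms]] by (auto simp: alg_closure_of_def over_def)
qed

lemma alg_closure_of_iff:
  "subfield k \<Omega> \<Longrightarrow> x \<in> alg_closure_of k \<longleftrightarrow> (\<exists>p\<in>poly_over k. p \<noteq> 0 \<and> poly p x = 0)"
  using algebraic_iff by (auto simp: alg_closure_of_def)

lemma alg_closure_of_mono:
  assumes "subfield k \<Omega>" "subfield L \<Omega>" "k \<subseteq> L"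
  shows "alg_closure_of k \<subseteq> alg_closure_of L"
proof
  fix x assume "x \<in> alg_closure_of k"
  then obtain p where "p \<in> poly_over k" "p \<noteq> 0" "poly p x = 0" using alg_closure_of_iff[OF assms(1)] by blast
  then show "x \<in> alg_closure_of L" using alg_closure_of_iff[OF assms(2)] poly_over_mono[OF _ assms(3)] by blast
qed

text \<open>The inverse of an algebraic element is a polynomial in that element.\<close>

lemma subfield_of_algebraic_subring:
  assumes K: "subfield K \<Omega>" and B: "subring B \<Omega>" "K \<subseteq> B" "B \<subseteq> alg_closure_of K"
  shows "subfield B \<Omega>"
  unfolding subfield_Omega_iff
proof (intro conjI ballI B)
  fix z assume z: "z \<in> B"
  then obtain p where p: "p \<in> poly_over K" "p \<noteq> 0" "poly p z = 0"
    using B alg_closure_of_iff[OF K] by blast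
  note se = simple_extension_algebraic[OF K p]
  have "z = poly [:0, 1:] z" "[:0, 1:] \<in> poly_over K" using K by (auto intro: sr_intros poly_over_0)
  then have "z \<in> Om.simple_extension K z" unfolding simple_extension_eq_polys[OF K] by blast
  then have "inverse z \<in> Om.simple_extension K z" by (rule sf_inverse[OF se(1)])
  then obtain q where "q \<in> poly_over K" "inverse z = poly q z"
    unfolding simple_extension_eq_polys[OF K] by blast
  then show "inverse z \<in> B" using poly_in_subring[OF B(1) poly_over_mono[OF _ B(2)] z] by simp
qed

text \<open>As \<open>L\<close> is algebraic over \<open>k\<close>, the ring spanned by
  \<open>L\<close> and \<open>K\<close> is algebraic over \<open>K\<close> and hence already a
  field.\<close>

lemma compositum_eq_lspan:
  assumes k: "subfield k \<Omega>" and K: "subfield K \<Omega>" "k \<subseteq> K" and L: "subfield L \<Omega>" "L \<subseteq> alg_closure_of k"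
  shows "compositum K L = lspan L K"
proof
  have sr: "subring (lspan L K) \<Omega>" using K L by (intro subring_lspan sf_sr)
  have "L \<subseteq> alg_closure_of K" using alg_closure_of_mono[OF k K] L by blast
  then have "lspan L K \<subseteq> alg_closure_of K"
    using alg_closure_of_subfield[OF K(1)] L(1)
    by (intro lspan_minimal subspc_subring) (auto intro: sr_intros)
  then have sf: "subfield (lspan L K) \<Omega>"
    using sr lspan_incl[of L K] sr_1[OF sf_sr[OF L(1)]] by (intro subfield_of_algebraic_subring[OF K(1)]) auto
  show "compositum K L \<subseteq> lspan L K"
    unfolding compositum_def
    using lspan_incl[of L K] lspan_incl'[of K L] sr_1[OF sf_sr[OF L(1)]] sr_1[OF sf_sr[OF K(1)]]
    by (intro generate_field_props(3)[OF sf]) auto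
  have "subring (generate_field \<Omega> (K \<union> L)) \<Omega>" using generate_field_props(1) by (rule sf_sr)
  then show "lspan L K \<subseteq> compositum K L" unfolding compositum_def
    using generate_field_props(2)[of "K \<union> L"]
    by (intro lspan_minimal subspc_subring) auto
qed

lemma lspan_indep_repr:
  assumes k: "subfield k \<Omega>" and L: "subspc k L" and M: "subspc k M" and z: "z \<in> lspan L M"
  obtains I :: "nat set" and l m where "finite I" "\<And>i. i \<in> I \<Longrightarrow> l i \<in> L" "\<And>i. i \<in> I \<Longrightarrow> m i \<in> M"
    "z = (\<Sum>i\<in>I. l i * m i)" "indep_mod k {0} I l"
proof -
  from z obtain n :: nat and l m where a: "\<And>i. i < n \<Longrightarrow> l i \<in> L" "\<And>i. i < n \<Longrightarrow> m i \<in> M"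
    "z = (\<Sum>i<n. l i * m i)" by (rule lspanE) blast
  obtain J c where J: "J \<subseteq> {..<n}" "indep_mod k {0} J l"
    and c: "\<forall>i\<in>{..<n}. (\<forall>j\<in>J. c i j \<in> k) \<and> l i - (\<Sum>j\<in>J. c i j * l j) \<in> {0}"
    using maximal_indep_mod[OF k subspc_zero finite_lessThan, of n l] by blast
  have finJ: "finite J" using J(1) finite_subset by blast
  have "z = (\<Sum>i<n. (\<Sum>j\<in>J. c i j * l j) * m i)" using a(3) c by simp
  also have "\<dots> = (\<Sum>j\<in>J. l j * (\<Sum>i<n. c i j * m i))"
    unfolding sum_distrib_left sum_distrib_right by (subst sum.swap) (simp add: mult_ac)
  finally have "z = (\<Sum>j\<in>J. l j * (\<Sum>i<n. c i j * m i))" .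
  moreover have "(\<Sum>i<n. c i j * m i) \<in> M" if "j \<in> J" for j
    using c a(2) that M by (auto intro!: subspc_sum subspc_scale)
  ultimately show ?thesis using that[of J l "\<lambda>j. \<Sum>i<n. c i j * m i"] J a(1) finJ by blast
qed

locale disjoint_exts =
  fixes k K C :: "'a::alg_closed_field set"
  assumes k: "subfield k \<Omega>" and K: "subfield K \<Omega>" and C: "subfield C \<Omega>"
    and kK: "k \<subseteq> K" and kC: "k \<subseteq> C" and ld: "linearly_disjoint k K C"
begin

lemma indep_over_C:
  assumes "finite I" "\<And>i. i \<in> I \<Longrightarrow> v i \<in> K" "indep_mod k {0} I v"
  shows "indep_mod C {0} I v"
proof -
  obtain h where h: "bij_betw h {..<card I} I"
    using ex_bij_betw_nat_finite[OF assms(1)] by (auto simp: lessThan_atLeast0)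
  define us where "us = map (\<lambda>i. v (h i)) [0..<card I]"
  have [simp]: "length us = card I" by (simp add: us_def)
  have nth: "us ! i = v (h i)" if "i < card I" for i using that by (simp add: us_def)
  have "indep_mod k {0} {..<card I} (\<lambda>i. v (h i))" using indep_mod_reindex[OF h] assms(3) by blast
  then have "indep_mod k {0} {..<card I} (\<lambda>i. us ! i)" unfolding indep_mod_def using nth by simp
  then have "Om.independent k us" by (simp add: independent_iff[OF k])
  moreover have "set us \<subseteq> K" using assms(2) bij_betwE[OF h] by (auto simp: us_def)
  ultimately have "Om.independent C us" using ld by (simp add: linearly_disjoint_def)
  then have "indep_mod C {0} {..<card I} (\<lambda>i. us ! i)" by (simp add: independent_iff[OF C])
  then have "indep_mod C {0} {..<card I} (\<lambda>i. v (h i))" unfolding indep_mod_def using nth by simp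
  then show ?thesis using indep_mod_reindex[OF h] by blast
qed

text \<open>Flatness: tensoring with \<open>C\<close> keeps \<open>K / R\<close> inside its base
  change. A relation modulo \<open>C \<otimes> R\<close> is written with elements \<open>r\<close>
  of \<open>R\<close> independent over \<open>k\<close>; together with the \<open>v\<close> they are
  independent over \<open>k\<close>, hence over \<open>C\<close>.\<close>

lemma indep_mod_lspan:
  assumes fin: "finite I" and v: "\<And>i. i \<in> I \<Longrightarrow> v i \<in> K" and R: "subspc k R" "R \<subseteq> K"
    and ind: "indep_mod k R I v"
  shows "indep_mod C (lspan C R) I v"
  unfolding indep_mod_def
proof (intro allI impI)
  fix c assume c: "\<forall>i\<in>I. c i \<in> C" and s: "(\<Sum>i\<in>I. c i * v i) \<in> lspan C R"
  obtain J :: "nat set" and r l where J: "finite J" "\<And>i. i \<in> J \<Longrightarrow> r i \<in> R" "\<And>i. i \<in> J \<Longrightarrow> l i \<in> C"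
    "(\<Sum>i\<in>I. c i * v i) = (\<Sum>i\<in>J. r i * l i)" "indep_mod k {0} J r"
  proof -
    have "(\<Sum>i\<in>I. c i * v i) \<in> lspan R C" using s lspan_commute by blast
    from lspan_indep_repr[OF k R(1) subspc_subring[OF sf_sr[OF C] kC] this] that show ?thesis by metis
  qed
  define u where "u = case_sum v r"
  have "indep_mod k {0} (I <+> J) u" unfolding indep_mod_def
  proof (intro allI impI)
    fix a assume a: "\<forall>i\<in>I <+> J. a i \<in> k" and s: "(\<Sum>i\<in>I <+> J. a i * u i) \<in> {0}"
    have e: "(\<Sum>i\<in>I. a (Inl i) * v i) + (\<Sum>i\<in>J. a (Inr i) * r i) = 0"
      using s fin J(1) by (simp add: sum.Plus u_def)
    have "(\<Sum>i\<in>I. a (Inl i) * v i) = - (\<Sum>i\<in>J. a (Inr i) * r i)" using e by (simp add: eq_neg_iff_add_eq_0)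
    also have "\<dots> \<in> R"
      using a J(2) by (intro subspc_minus[OF R(1) sf_sr[OF k]] subspc_sum[OF R(1)] subspc_scale[OF R(1)]) auto
    finally have z: "a (Inl i) = 0" if "i \<in> I" for i
      using indep_modD[OF ind, of "\<lambda>i. a (Inl i)" i] a that by auto
    then have "(\<Sum>i\<in>J. a (Inr i) * r i) \<in> {0}" using e by simp
    then have "a (Inr i) = 0" if "i \<in> J" for i
      using indep_modD[OF J(5), of "\<lambda>i. a (Inr i)" i] a that by auto
    with z show "\<forall>i\<in>I <+> J. a i = 0" by auto
  qed
  then have iC: "indep_mod C {0} (I <+> J) u"
    using fin J(1,2) v R(2) by (intro indep_over_C) (auto simp: u_def)
  define d where "d = case_sum c (\<lambda>j. - l j)"
  have "(\<Sum>i\<in>I <+> J. d i * u i) = 0"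
    using fin J(1,4) by (simp add: sum.Plus u_def d_def sum_negf mult.commute)
  moreover have "d i \<in> C" if "i \<in> I <+> J" for i
    using that c J(3) C by (auto simp: d_def intro!: sr_intros)
  ultimately have "d i = 0" if "i \<in> I <+> J" for i
    using indep_modD[OF iC, of d i] that by auto
  then have "d (Inl i) = 0" if "i \<in> I" for i using that by blast
  then show "\<forall>i\<in>I. c i = 0" by (simp add: d_def)
qed

text \<open>Coordinates with respect to independent elements \<open>l\<close> of \<open>C\<close>
  are unique in \<open>C \<otimes> (K / R)\<close>, so an element of \<open>C \<otimes> R\<close>
  has all of them in \<open>R\<close>. The proof expands the \<open>m i\<close> modulo
  \<open>R\<close> in a maximal independent subfamily and compares coefficients.\<close>

lemma coords_in:
  assumes fin: "finite I" and l: "\<And>i. i \<in> I \<Longrightarrow> l i \<in> C" "indep_mod k {0} I l"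
    and m: "\<And>i. i \<in> I \<Longrightarrow> m i \<in> K" and R: "subspc k R" "R \<subseteq> K"
    and z: "(\<Sum>i\<in>I. l i * m i) \<in> lspan C R" and i: "i \<in> I"
  shows "m i \<in> R"
proof -
  obtain J c where J: "J \<subseteq> I" "indep_mod k R J m"
    and c: "\<forall>i\<in>I. (\<forall>j\<in>J. c i j \<in> k) \<and> m i - (\<Sum>j\<in>J. c i j * m j) \<in> R"
    using maximal_indep_mod[OF k R(1) fin, of m] by blast
  have finJ: "finite J" using J(1) fin finite_subset by blast
  have iC: "indep_mod C (lspan C R) J m"
    using finJ m J by (intro indep_mod_lspan R) auto
  have C1: "subring C \<Omega>" using C by (rule sf_sr)
  have sp: "subspc C (lspan C R)" by (rule subspc_lspan[OF C1])
  have "(\<Sum>i\<in>I. l i * (m i - (\<Sum>j\<in>J. c i j * m j))) \<in> lspan C R"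
    by (intro lspan_sum lspan_mult) (use l c in auto)
  then have "(\<Sum>i\<in>I. l i * m i) - (\<Sum>i\<in>I. l i * (m i - (\<Sum>j\<in>J. c i j * m j))) \<in> lspan C R"
    using z by (intro subspc_diff[OF sp C1])
  also have "(\<Sum>i\<in>I. l i * m i) - (\<Sum>i\<in>I. l i * (m i - (\<Sum>j\<in>J. c i j * m j)))
      = (\<Sum>i\<in>I. l i * (\<Sum>j\<in>J. c i j * m j))"
    by (simp add: right_diff_distrib sum_subtractf)
  also have "\<dots> = (\<Sum>j\<in>J. (\<Sum>i\<in>I. c i j * l i) * m j)"
    unfolding sum_distrib_left sum_distrib_right by (subst sum.swap) (simp add: mult_ac)
  finally have s: "(\<Sum>j\<in>J. (\<Sum>i\<in>I. c i j * l i) * m j) \<in> lspan C R" .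
  have z: "(\<Sum>i\<in>I. c i j * l i) = 0" if "j \<in> J" for j
  proof (rule indep_modD[OF iC _ s that])
    fix j assume "j \<in> J"
    then show "(\<Sum>i\<in>I. c i j * l i) \<in> C" using c l kC C1 by (auto intro!: sr_intros)
  qed
  have c0: "c i j = 0" if "i \<in> I" "j \<in> J" for i j
    using indep_modD[OF l(2), of "\<lambda>i. c i j" i] c z that by auto
  then have "m i - (\<Sum>j\<in>J. c i j * m j) = m i" using i by simp
  then show ?thesis using c i by metis
qed

text \<open>One expansion with independent \<open>l\<close> works for every \<open>R\<close> at
  once, since its coordinates must lie in each of them. Hence base change commutes with arbitrary
  intersections, which is how local statements become global ones.\<close>

lemma lspan_Int:
  assumes L: "subspc k L" "L \<subseteq> C" and M: "subspc k M" "M \<subseteq> K" and R: "\<And>R. R \<in> \<R> \<Longrightarrow> subspc k R \<and> R \<subseteq> K"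
    and z: "z \<in> lspan L M" "\<And>R. R \<in> \<R> \<Longrightarrow> z \<in> lspan C R"
  shows "z \<in> lspan L (M \<inter> \<Inter>\<R>)"
proof -
  obtain I :: "nat set" and l m where a: "finite I" "\<And>i. i \<in> I \<Longrightarrow> l i \<in> L" "\<And>i. i \<in> I \<Longrightarrow> m i \<in> M"
    "z = (\<Sum>i\<in>I. l i * m i)" "indep_mod k {0} I l"
    using lspan_indep_repr[OF k L(1) M(1) z(1)] by metis
  have "m i \<in> R" if "R \<in> \<R>" "i \<in> I" for R i
    by (rule coords_in[of I l m]) (use a L M R that z in auto)
  then show ?thesis unfolding a(4) using a by (intro lspanI) auto
qed

lemma lspan_Int1:
  assumes "subspc k L" "L \<subseteq> C" "subspc k M" "M \<subseteq> K" "subspc k R" "R \<subseteq> K"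
    and "z \<in> lspan L M" "z \<in> lspan C R"
  shows "z \<in> lspan L (M \<inter> R)"
  using lspan_Int[of L M "{R}" z] assms by auto

text \<open>Transitivity of linear disjointness. It is proved by coordinates, twice: the
  coefficients in \<open>C\<close> are expanded over \<open>L\<close>, and the vectors of
  \<open>L K\<close> are expanded in elements of \<open>K\<close> independent over
  \<open>k\<close>.\<close>

lemma base_change:
  assumes L: "subfield L \<Omega>" "k \<subseteq> L" "L \<subseteq> C" and KL: "subfield (lspan L K) \<Omega>"
  shows "disjoint_exts L (lspan L K) C"
proof (rule disjoint_exts.intro)
  have kr: "subring k \<Omega>" and Lr: "subring L \<Omega>" and Kr: "subring K \<Omega>" using k L K by (auto intro: sf_sr)
  show "L \<subseteq> lspan L K" by (rule lspan_incl') (rule sr_1[OF Kr])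
  show "linearly_disjoint L (lspan L K) C" unfolding linearly_disjoint_def
  proof (intro allI impI)
    fix us assume a: "set us \<subseteq> lspan L K \<and> Om.independent L us"
    have ind: "indep_mod L {0} {..<length us} (\<lambda>i. us ! i)" using a independent_iff[OF L(1)] by blast
    have "indep_mod C {0} {..<length us} (\<lambda>i. us ! i)" unfolding indep_mod_def
    proof (intro allI impI)
      fix c assume c: "\<forall>i\<in>{..<length us}. c i \<in> C" and s: "(\<Sum>i<length us. c i * us ! i) \<in> {0}"
      \<comment> \<open>The \<open>c j\<close> with \<open>j\<close> in \<open>J\<close> are an
        \<open>L\<close>-basis of the span of all coefficients; it suffices that the coordinates
        \<open>d i j\<close> in \<open>L\<close> vanish.\<close>
      obtain J d where J: "J \<subseteq> {..<length us}" "indep_mod L {0} J c"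
        and d: "\<forall>i\<in>{..<length us}. (\<forall>j\<in>J. d i j \<in> L) \<and> c i - (\<Sum>j\<in>J. d i j * c j) \<in> {0}"
        using maximal_indep_mod[OF L(1) subspc_zero finite_lessThan, of "length us" c] by blast
      have finJ: "finite J" using J(1) finite_subset by blast
      have "\<exists>t :: nat \<times> (nat \<Rightarrow> 'a) \<times> (nat \<Rightarrow> 'a). i < length us \<longrightarrow>
          (\<forall>h<fst t. fst (snd t) h \<in> L \<and> snd (snd t) h \<in> K) \<and>
          us ! i = (\<Sum>h<fst t. fst (snd t) h * snd (snd t) h)" for i
      proof (cases "i < length us")
        case True
        then have "us ! i \<in> lspan L K" using a by auto
        then show ?thesis
        proof (elim lspanE)
          fix n :: nat and l m
          assume "\<And>i. i < n \<Longrightarrow> l i \<in> L" "\<And>i. i < n \<Longrightarrow> m i \<in> K" "us ! i = (\<Sum>i<n. l i * m i)"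
          then show ?thesis by (intro exI[of _ "(n, l, m)"]) simp
        qed
      qed simp
      then have "\<forall>i. \<exists>t :: nat \<times> (nat \<Rightarrow> 'a) \<times> (nat \<Rightarrow> 'a). i < length us \<longrightarrow>
          (\<forall>h<fst t. fst (snd t) h \<in> L \<and> snd (snd t) h \<in> K) \<and>
          us ! i = (\<Sum>h<fst t. fst (snd t) h * snd (snd t) h)" by (intro allI)
      from choice[OF this] obtain t :: "nat \<Rightarrow> nat \<times> (nat \<Rightarrow> 'a) \<times> (nat \<Rightarrow> 'a)" where t: "\<And>i. i < length us \<Longrightarrow>
          (\<forall>h<fst (t i). fst (snd (t i)) h \<in> L \<and> snd (snd (t i)) h \<in> K) \<and>
          us ! i = (\<Sum>h<fst (t i). fst (snd (t i)) h * snd (snd (t i)) h)" by blast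
      define n l m where "n i = fst (t i)" and "l i = fst (snd (t i))" and "m i = snd (snd (t i))" for i
      have lm: "\<And>i h. i < length us \<Longrightarrow> h < n i \<Longrightarrow> l i h \<in> L"
          "\<And>i h. i < length us \<Longrightarrow> h < n i \<Longrightarrow> m i h \<in> K"
          "\<And>i. i < length us \<Longrightarrow> us ! i = (\<Sum>h<n i. l i h * m i h)"
        using t unfolding n_def l_def m_def by blast+
      define H where "H = (SIGMA i:{..<length us}. {..<n i})"
      have finH: "finite H" by (simp add: H_def)
      \<comment> \<open>Finitely many elements of \<open>K\<close>, independent over
        \<open>k\<close> and so over \<open>C\<close>, express all components of the given vectors.
        The matrix \<open>A\<close> below has entries in \<open>L\<close>.\<close>
      obtain B e where B: "B \<subseteq> H" "indep_mod k {0} B (\<lambda>(i,h). m i h)"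
        and e: "\<forall>p\<in>H. (\<forall>b\<in>B. e p b \<in> k) \<and> (case p of (i,h) \<Rightarrow> m i h) - (\<Sum>b\<in>B. e p b * (case b of (i,h) \<Rightarrow> m i h)) \<in> {0}"
        using maximal_indep_mod[OF k subspc_zero finH, of "\<lambda>(i,h). m i h"] by blast
      define w where "w b = (case b of (i,h) \<Rightarrow> m i h)" for b
      have finB: "finite B" using B finH finite_subset by blast
      have wK: "w b \<in> K" if "b \<in> B" for b using B(1) that lm(2) by (auto simp: w_def H_def)
      have iC: "indep_mod C {0} B w"
        using B(2) finB wK by (intro indep_over_C) (auto simp: w_def[abs_def])
      define A where "A i b = (\<Sum>h<n i. l i h * e (i,h) b)" for i b
      have AL: "A i b \<in> L" if "i < length us" "b \<in> B" for i b
        using that lm(1) e L(2) Lr by (auto simp: A_def H_def intro!: sr_intros)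
      have us: "us ! i = (\<Sum>b\<in>B. A i b * w b)" if "i < length us" for i
      proof -
        have "us ! i = (\<Sum>h<n i. l i h * (\<Sum>b\<in>B. e (i,h) b * w b))"
          using lm(3)[OF that] e that by (auto simp: H_def w_def intro!: sum.cong)
        also have "\<dots> = (\<Sum>b\<in>B. A i b * w b)"
          unfolding A_def sum_distrib_left sum_distrib_right by (subst sum.swap) (simp add: mult_ac)
        finally show ?thesis .
      qed
      have "(\<Sum>b\<in>B. (\<Sum>i<length us. c i * A i b) * w b) = (\<Sum>i<length us. c i * us ! i)"
        unfolding sum_distrib_right by (subst sum.swap) (simp add: us sum_distrib_left mult_ac)
      with s have s': "(\<Sum>b\<in>B. (\<Sum>i<length us. c i * A i b) * w b) \<in> {0}" by simp
      have c0: "(\<Sum>i<length us. c i * A i b) = 0" if "b \<in> B" for b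
      proof (rule indep_modD[OF iC _ s' that])
        fix b assume b: "b \<in> B"
        have "A i b \<in> C" if "i < length us" for i using AL[OF that b] L(3) by blast
        then show "(\<Sum>i<length us. c i * A i b) \<in> C"
          using c by (intro sr_sum sr_mult sf_sr[OF C]) auto
      qed
      \<comment> \<open>The relation over \<open>C\<close> splits along the \<open>c j\<close>,
        which are independent over \<open>L\<close>, into one relation over \<open>L\<close> for
        each \<open>j\<close>.\<close>
      have "(\<Sum>i<length us. d i j * A i b) = 0" if b: "b \<in> B" and j: "j \<in> J" for b j
      proof (rule indep_modD[OF J(2), of "\<lambda>j. \<Sum>i<length us. d i j * A i b"])
        show "(\<Sum>i<length us. d i j * A i b) \<in> L" if "j \<in> J" for j
          using d AL[OF _ b] that by (intro sr_sum[OF Lr] sr_mult[OF Lr]) auto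
        have "(\<Sum>j\<in>J. (\<Sum>i<length us. d i j * A i b) * c j) = (\<Sum>i<length us. (\<Sum>j\<in>J. d i j * c j) * A i b)"
          unfolding sum_distrib_right by (subst sum.swap) (simp add: mult_ac)
        also have "\<dots> = (\<Sum>i<length us. c i * A i b)" using d by (intro sum.cong) auto
        finally show "(\<Sum>j\<in>J. (\<Sum>i<length us. d i j * A i b) * c j) \<in> {0}" using c0[OF b] by simp
      qed (rule j)
      note dA = this
      have d0: "d i j = 0" if "i < length us" "j \<in> J" for i j
      proof (rule indep_modD[OF ind, of "\<lambda>i. d i j"])
        have "(\<Sum>i<length us. d i j * us ! i) = (\<Sum>b\<in>B. (\<Sum>i<length us. d i j * A i b) * w b)"
          unfolding sum_distrib_right by (subst sum.swap) (simp add: us sum_distrib_left mult_ac)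
        also have "\<dots> = 0" using dA that(2) by simp
        finally show "(\<Sum>i<length us. d i j * us ! i) \<in> {0}" by simp
      qed (use d that in auto)
      have "c i = 0" if "i < length us" for i
      proof -
        have "c i = (\<Sum>j\<in>J. d i j * c j)" using d that by simp
        also have "\<dots> = 0" using d0[OF that] by simp
        finally show ?thesis .
      qed
      then show "\<forall>i\<in>{..<length us}. c i = 0" by simp
    qed
    then show "Om.independent C us" by (simp add: independent_iff[OF C])
  qed
qed (use L C KL in auto)

end

subsection \<open>Valuation rings and integral closures\<close>

text \<open>The trivial case \<open>V = F\<close> is allowed, because the existence theorem for
  valuation rings produces \<open>V\<close> before it is known to be proper. Places are the proper
  ones that contain the constants.\<close>

definition valring :: "'a::alg_closed_field set \<Rightarrow> 'a set \<Rightarrow> bool"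
  where "valring V F \<longleftrightarrow> subring V \<Omega> \<and> V \<subseteq> F \<and> (\<forall>x\<in>F. x \<in> V \<or> inverse x \<in> V)"

lemma places_iff: "R \<in> places k K \<longleftrightarrow> valring R K \<and> k \<subseteq> R \<and> R \<noteq> K"
  by (auto simp: places_def valring_def)

text \<open>If \<open>x\<close> is not in \<open>V\<close>, its inverse is; dividing the equation of
  degree \<open>n\<close> by \<open>x ^ (n - 1)\<close> then expresses \<open>x\<close> by elements
  of \<open>V\<close>.\<close>

lemma valring_integral:
  assumes V: "valring V F" and x: "x \<in> F" "integral_over V x"
  shows "x \<in> V"
proof (rule ccontr)
  assume n: "x \<notin> V"
  have sr: "subring V \<Omega>" using V by (simp add: valring_def)
  have x0: "x \<noteq> 0" using n sr sr_0 by auto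
  have ix: "inverse x \<in> V" using n V x(1) by (auto simp: valring_def)
  obtain p where p: "p \<in> poly_over V" "Polynomial.lead_coeff p = 1" "poly p x = 0"
    using x(2) by (auto simp: integral_over_def)
  define n where "n = Polynomial.degree p"
  have "n \<noteq> 0"
  proof
    assume "n = 0"
    then obtain a where "p = [:a:]" by (auto simp: n_def elim: degree_eq_zeroE)
    with p show False by auto
  qed
  then obtain n' where n': "n = Suc n'" by (cases n) auto
  have "poly p x = x * x ^ n' + (\<Sum>i\<le>n'. Polynomial.coeff p i * x ^ i)"
    using p(2) by (simp add: poly_altdef n_def[symmetric] n' )
  then have "x * x ^ n' = - (\<Sum>i\<le>n'. Polynomial.coeff p i * x ^ i)"
    using p(3) by (simp add: eq_neg_iff_add_eq_0)
  then have "x = - (\<Sum>i\<le>n'. Polynomial.coeff p i * x ^ i) / x ^ n'" using x0 by (simp add: field_simps)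
  also have "\<dots> = - (\<Sum>i\<le>n'. Polynomial.coeff p i * inverse x ^ (n' - i))"
  proof -
    have "(\<Sum>i\<le>n'. Polynomial.coeff p i * x ^ i) / x ^ n' = (\<Sum>i\<le>n'. Polynomial.coeff p i * (x ^ i / x ^ n'))"
      by (simp add: sum_divide_distrib)
    also have "\<dots> = (\<Sum>i\<le>n'. Polynomial.coeff p i * inverse x ^ (n' - i))"
      by (intro sum.cong refl) (use x0 in \<open>simp add: power_diff power_inverse field_simps\<close>)
    finally show ?thesis by simp
  qed
  also have "\<dots> \<in> V" using p(1) ix by (intro sr_minus[OF sr] sr_sum[OF sr] sr_mult[OF sr] sr_power[OF sr]) (auto simp: poly_over_def)
  finally show False using n by blast
qed

lemma adjoin_ring:
  assumes B: "subring B \<Omega>"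
  shows "subring {poly p u |p. p \<in> poly_over B} \<Omega>" "B \<subseteq> {poly p u |p. p \<in> poly_over B}"
    "u \<in> {poly p u |p. p \<in> poly_over B}"
    "subring F \<Omega> \<Longrightarrow> B \<subseteq> F \<Longrightarrow> u \<in> F \<Longrightarrow> {poly p u |p. p \<in> poly_over B} \<subseteq> F"
proof -
  show "subring {poly p u |p. p \<in> poly_over B} \<Omega>"
    unfolding subring_Omega_iff
  proof (intro conjI ballI)
    show "1 \<in> {poly p u |p. p \<in> poly_over B}"
      using poly_over_1[OF B] by (auto intro!: exI[of _ 1])
  next
    fix x assume "x \<in> {poly p u |p. p \<in> poly_over B}"
    then obtain p where p: "x = poly p u" "p \<in> poly_over B" by blast
    have "0 - p \<in> poly_over B" using p(2) sr_0[OF B] by (intro poly_over_diff[OF B]) auto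
    then show "- x \<in> {poly p u |p. p \<in> poly_over B}" by (auto simp: p(1) intro!: exI[of _ "0 - p"])
  next
    fix x y assume "x \<in> {poly p u |p. p \<in> poly_over B}" "y \<in> {poly p u |p. p \<in> poly_over B}"
    then obtain p q where p: "x = poly p u" "p \<in> poly_over B" "y = poly q u" "q \<in> poly_over B" by blast
    show "x + y \<in> {poly p u |p. p \<in> poly_over B}"
      using p poly_over_add[OF B p(2,4)] by (auto intro!: exI[of _ "p + q"])
    show "x * y \<in> {poly p u |p. p \<in> poly_over B}"
      using p poly_over_mult[OF B p(2,4)] by (auto intro!: exI[of _ "p * q"])
  qed
  show "B \<subseteq> {poly p u |p. p \<in> poly_over B}"
  proof
    fix b assume "b \<in> B"
    then show "b \<in> {poly p u |p. p \<in> poly_over B}" using sr_0[OF B] by (auto intro!: exI[of _ "[:b:]"])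
  qed
  show "u \<in> {poly p u |p. p \<in> poly_over B}"
    using sr_0[OF B] sr_1[OF B] by (auto intro!: exI[of _ "[:0,1:]"])
  show "{poly p u |p. p \<in> poly_over B} \<subseteq> F" if "subring F \<Omega>" "B \<subseteq> F" "u \<in> F"
    using that poly_in_subring[OF that(1) poly_over_mono[OF _ that(2)]] by blast
qed

lemma poly_as_sum:
  assumes "subring B \<Omega>" "p \<in> poly_over B"
  shows "\<exists>n b. (\<forall>i. b i \<in> B) \<and> poly p u = (\<Sum>i\<le>n. b i * u ^ i)"
  using assms(2) by (intro exI[of _ "Polynomial.degree p"] exI[of _ "Polynomial.coeff p"]) (simp add: poly_altdef poly_over_def)

text \<open>If \<open>z\<close> is not integral, it is not in \<open>A[1/z]\<close>. A subring that
  contains \<open>A[1/z]\<close> and is maximal among those without \<open>z\<close> is a valuation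
  ring. In this way the integral closure is an intersection of valuation rings.\<close>

lemma chevalley:
  assumes A: "subring A \<Omega>" "A \<subseteq> F" and F: "subfield F \<Omega>" and z: "z \<in> F" "\<not> integral_over A z"
  shows "\<exists>V. valring V F \<and> A \<subseteq> V \<and> z \<notin> V"
proof -
  have Fr: "subring F \<Omega>" using F by (rule sf_sr)
  have z0: "z \<noteq> 0"
  proof
    assume "z = 0"
    then have "integral_over A z"
      unfolding integral_over_def using A by (intro bexI[of _ "[:0,1:]"]) (auto intro: sr_0 sr_1 poly_over_0)
    with z show False by simp
  qed
  define w where "w = inverse z"
  have zw [simp]: "z * w = 1" and w0: "w \<noteq> 0" using z0 by (auto simp: w_def)
  have wF: "w \<in> F" using F z by (auto simp: w_def intro: sr_intros)
  define B0 where "B0 = {poly p w |p. p \<in> poly_over A}"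
  note B0 = adjoin_ring[OF A(1), where u = w, folded B0_def]
  \<comment> \<open>Multiplying \<open>z = p(1/z)\<close> by \<open>z ^ n\<close> would give a monic
    equation: \<open>r\<close> is \<open>p\<close> with its coefficients reversed.\<close>
  have zB0: "z \<notin> B0"
  proof
    assume "z \<in> B0"
    then obtain p where p: "p \<in> poly_over A" "z = poly p w" by (auto simp: B0_def)
    define n where "n = Polynomial.degree p"
    define r where "r = (\<Sum>i\<le>n. Polynomial.monom (Polynomial.coeff p i) (n - i))"
    define q where "q = Polynomial.monom 1 (Suc n) - r"
    have rA: "r \<in> poly_over A" unfolding r_def using p(1)
      by (intro poly_over_sum[OF A(1)] poly_over_monom[OF A(1)]) (auto simp: poly_over_def)
    have d: "Polynomial.degree r < Suc n"
    proof -
      have "Polynomial.degree r \<le> n" unfolding r_def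
        by (intro degree_sum_le) (auto intro: order_trans[OF degree_monom_le])
      then show ?thesis by simp
    qed
    have "Polynomial.degree q = Suc n" "Polynomial.lead_coeff q = 1"
    proof -
      show dq: "Polynomial.degree q = Suc n" unfolding q_def
        using d degree_add_eq_left[of "- r" "Polynomial.monom 1 (Suc n)"] by (simp add: degree_monom_eq)
      show "Polynomial.lead_coeff q = 1" using d unfolding dq by (simp add: q_def coeff_eq_0)
    qed
    moreover have "q \<in> poly_over A" unfolding q_def
      using rA by (intro poly_over_diff poly_over_monom A(1)) (auto intro: sr_1 A(1))
    moreover have "poly q z = 0"
    proof -
      have "poly r z = (\<Sum>i\<le>n. Polynomial.coeff p i * z ^ (n - i))" by (simp add: r_def poly_sum poly_monom)
      also have "\<dots> = (\<Sum>i\<le>n. z ^ n * (Polynomial.coeff p i * w ^ i))"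
      proof (intro sum.cong refl)
        fix i assume "i \<in> {..n}"
        then have "z ^ n = z ^ (n - i) * z ^ i" by (simp add: power_add[symmetric])
        then have "z ^ n * w ^ i = z ^ (n - i)" using zw by (simp add: mult.assoc power_mult_distrib[symmetric])
        then show "Polynomial.coeff p i * z ^ (n - i) = z ^ n * (Polynomial.coeff p i * w ^ i)" by (simp add: mult_ac)
      qed
      also have "\<dots> = z ^ n * poly p w" by (simp add: poly_altdef n_def sum_distrib_left)
      finally have "poly r z = z ^ n * poly p w" .
      then show ?thesis using p(2) by (simp add: q_def poly_monom mult.commute)
    qed
    ultimately have "integral_over A z" unfolding integral_over_def by blast
    with z show False by simp
  qed
  define S where "S = {B. subring B \<Omega> \<and> B0 \<subseteq> B \<and> B \<subseteq> F \<and> z \<notin> B}"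
  have "\<exists>M\<in>S. \<forall>B\<in>S. M \<subseteq> B \<longrightarrow> B = M"
  proof (rule subset_Zorn_nonempty)
    show "S \<noteq> {}" using B0 zB0 Fr A wF by (auto simp: S_def)
    fix Ch assume ne: "Ch \<noteq> {}" and ch: "subset.chain S Ch"
    have CS: "\<And>B. B \<in> Ch \<Longrightarrow> subring B \<Omega> \<and> B0 \<subseteq> B \<and> B \<subseteq> F \<and> z \<notin> B"
      using ch by (auto simp: subset.chain_def S_def)
    have two: "\<exists>B\<in>Ch. x \<in> B \<and> y \<in> B" if "x \<in> \<Union>Ch" "y \<in> \<Union>Ch" for x y
    proof -
      obtain B B' where B: "B \<in> Ch" "x \<in> B" "B' \<in> Ch" "y \<in> B'" using \<open>x \<in> \<Union>Ch\<close> \<open>y \<in> \<Union>Ch\<close> by blast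
      then have "B \<subseteq> B' \<or> B' \<subseteq> B" using subset_chain_def ch by blast
      with B show ?thesis by blast
    qed
    have "subring (\<Union>Ch) \<Omega>" unfolding subring_Omega_iff
    proof (intro conjI ballI)
      show "1 \<in> \<Union>Ch" using ne CS sr_1 by blast
      show "- x \<in> \<Union>Ch" if "x \<in> \<Union>Ch" for x using that CS sr_minus by blast
      fix x y assume "x \<in> \<Union>Ch" "y \<in> \<Union>Ch"
      then obtain B where "B \<in> Ch" "x \<in> B" "y \<in> B" using two by blast
      then show "x + y \<in> \<Union>Ch" "x * y \<in> \<Union>Ch" using CS sr_add sr_mult by blast+
    qed
    moreover have "B0 \<subseteq> \<Union>Ch" using ne CS by blast
    moreover have "\<Union>Ch \<subseteq> F" "z \<notin> \<Union>Ch" using CS by blast+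
    ultimately show "\<Union>Ch \<in> S" by (simp add: S_def)
  qed
  then obtain M where MS: "M \<in> S" and max: "\<And>B. B \<in> S \<Longrightarrow> M \<subseteq> B \<Longrightarrow> B = M" by blast
  have M: "subring M \<Omega>" "B0 \<subseteq> M" "M \<subseteq> F" "z \<notin> M" using MS by (auto simp: S_def)
  have wM: "w \<in> M" using B0(3) M(2) by blast
  \<comment> \<open>By maximality, adjoining any \<open>u\<close> outside \<open>M\<close> must
    produce \<open>z\<close>.\<close>
  have repr: "\<exists>n b. (\<forall>i. b i \<in> M) \<and> z = (\<Sum>i\<le>n. b i * u ^ i)" if "u \<in> F" "u \<notin> M" for u
  proof -
    note Mu = adjoin_ring[OF M(1), where u = u]
    have "z \<in> {poly p u |p. p \<in> poly_over M}"
    proof (rule ccontr)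
      assume "z \<notin> {poly p u |p. p \<in> poly_over M}"
      then have "{poly p u |p. p \<in> poly_over M} \<in> S"
        unfolding S_def mem_Collect_eq[of _ "\<lambda>B. subring B \<Omega> \<and> B0 \<subseteq> B \<and> B \<subseteq> F \<and> z \<notin> B"]
        using Mu(1,2) Mu(4)[OF Fr M(3) \<open>u \<in> F\<close>] M(2) by blast
      then have "{poly p u |p. p \<in> poly_over M} = M" by (rule max) (rule Mu(2))
      with Mu(3) \<open>u \<notin> M\<close> show False by blast
    qed
    then obtain p where "z = poly p u" "p \<in> poly_over M" by blast
    with poly_as_sum[OF M(1)] show ?thesis by metis
  qed
  \<comment> \<open>\<open>w\<close> behaves like an element of a maximal ideal: if
    \<open>1 - w c\<close> were not invertible in \<open>M\<close>, its inverse could be adjoined to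
    produce \<open>z\<close>, and clearing the denominator would put \<open>z\<close> itself into
    \<open>M\<close>.\<close>
  have unit: "inverse (1 - w * c) \<in> M" "1 - w * c \<noteq> 0" if c: "c \<in> M" for c
  proof -
    show "1 - w * c \<noteq> 0"
    proof
      assume "1 - w * c = 0"
      then have "z * (w * c) = z" by simp
      then have "c = z" by (simp add: mult.assoc[symmetric])
      with c M(4) show False by simp
    qed
    show "inverse (1 - w * c) \<in> M"
    proof (rule ccontr)
      define d where "d = 1 - w * c"
      have d0: "d \<noteq> 0" using \<open>1 - w * c \<noteq> 0\<close> by (simp add: d_def)
      assume "inverse (1 - w * c) \<notin> M"
      moreover have dM: "d \<in> M" using wM c M(1) by (auto simp: d_def intro: sr_intros)
      then have "inverse d \<in> F" using M(3) F by (auto intro: sr_intros)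
      ultimately obtain n b where b: "\<And>i. b i \<in> M" "z = (\<Sum>i\<le>n. b i * inverse d ^ i)"
        using repr[of "inverse d"] by (auto simp: d_def)
      have "z * d ^ n = (\<Sum>i\<le>n. b i * d ^ (n - i))"
        unfolding b(2) sum_distrib_right
      proof (intro sum.cong refl)
        fix i assume "i \<in> {..n}"
        then have "d ^ n = d ^ (n - i) * d ^ i" by (simp add: power_add[symmetric])
        then have "inverse d ^ i * d ^ n = d ^ (n - i)" using d0 by (simp add: field_simps)
        then show "b i * inverse d ^ i * d ^ n = b i * d ^ (n - i)" by (simp add: mult.assoc)
      qed
      also have "\<dots> \<in> M" using b(1) dM by (intro sr_sum sr_mult sr_power M(1)) auto
      finally have 1: "z * d ^ n \<in> M" .
      \<comment> \<open>All powers of \<open>d\<close> stay in \<open>1 + w M\<close>, and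
        \<open>z w = 1\<close>, so \<open>z d ^ n\<close> differs from \<open>z\<close> by an
        element of \<open>M\<close>.\<close>
      have "\<exists>e\<in>M. d ^ m = 1 - w * e" for m
      proof (induction m)
        case 0
        show ?case using sr_0[OF M(1)] by (intro bexI[of _ 0]) auto
      next
        case (Suc m)
        then obtain e where e: "e \<in> M" "d ^ m = 1 - w * e" by blast
        have "d ^ Suc m = d * (1 - w * e)" by (simp add: e(2))
        also have "\<dots> = 1 - w * (e + c - w * c * e)" by (simp add: d_def algebra_simps)
        finally have "d ^ Suc m = 1 - w * (e + c - w * c * e)" .
        moreover have "e + c - w * c * e \<in> M" using e(1) c wM M(1) by (auto intro!: sr_intros)
        ultimately show ?case by blast
      qed
      then obtain e where e: "e \<in> M" "d ^ n = 1 - w * e" by blast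
      have "z * d ^ n + e = z" using e(2) by (simp add: right_diff_distrib mult.assoc[symmetric])
      with 1 e(1) M(1) have "z \<in> M" using sr_add by fastforce
      with M(4) show False by simp
    qed
  qed
  define Q where "Q u n \<longleftrightarrow> (\<exists>b. (\<forall>i. b i \<in> M) \<and> z = (\<Sum>i\<le>n. b i * u ^ i))" for u and n :: nat
  have Q0: "\<not> Q u 0" for u using M(4) by (auto simp: Q_def)
  \<comment> \<open>The relation for \<open>inverse u\<close>, with its constant term absorbed by
    the unit \<open>1 - w c 0\<close>, writes \<open>u ^ n\<close> in lower powers of
    \<open>u\<close>. Substitution shortens the relation for \<open>u\<close>, so shortest relations
    for \<open>x\<close> and \<open>inverse x\<close> cannot both exist.\<close>
  have red: "\<exists>n'<n. Q u n'" if Q: "Q u n" "Q (inverse u) m" and mn: "m \<le> n" and u0: "u \<noteq> 0" for u n m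
  proof -
    obtain b where b: "\<And>i. b i \<in> M" "z = (\<Sum>i\<le>n. b i * u ^ i)" using Q by (auto simp: Q_def)
    obtain c where c: "\<And>i. c i \<in> M" "z = (\<Sum>i\<le>m. c i * inverse u ^ i)" using Q by (auto simp: Q_def)
    have "n \<noteq> 0" "m \<noteq> 0" using Q Q0 by metis+
    then obtain n' m' where n': "n = Suc n'" "m = Suc m'" by (metis not0_implies_Suc)
    define e where "e = inverse (1 - w * c 0)"
    have e: "e \<in> M" "e * (1 - w * c 0) = 1" using unit[OF c(1)[of 0]] by (auto simp: e_def)
    have "z - c 0 = (\<Sum>j\<le>m'. c (Suc j) * inverse u ^ Suc j)"
      using c(2) by (simp add: n' sum.atMost_Suc_shift del: sum.atMost_Suc)
    moreover have "z - c 0 = z * (1 - w * c 0)" by (simp add: right_diff_distrib mult.assoc[symmetric])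
    ultimately have "w * e * (z * (1 - w * c 0)) = w * e * (\<Sum>j\<le>m'. c (Suc j) * inverse u ^ Suc j)" by simp
    moreover have "w * e * (z * (1 - w * c 0)) = (z * w) * (e * (1 - w * c 0))" by (simp only: mult_ac)
    ultimately have 1: "1 = w * e * (\<Sum>j\<le>m'. c (Suc j) * inverse u ^ Suc j)" using e(2) by simp
    have un: "u ^ n = (\<Sum>j\<le>m'. w * e * c (Suc j) * u ^ (n' - j))"
    proof -
      have "u ^ n = (\<Sum>j\<le>m'. w * e * c (Suc j) * (inverse u ^ Suc j * u ^ n))"
        using arg_cong[OF 1, of "\<lambda>x. x * u ^ n"] by (simp add: sum_distrib_left sum_distrib_right mult_ac)
      also have "\<dots> = (\<Sum>j\<le>m'. w * e * c (Suc j) * u ^ (n' - j))"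
      proof (intro sum.cong refl)
        fix j assume "j \<in> {..m'}"
        then have "n = (n' - j) + Suc j" using mn n' by simp
        then have "u ^ n = u ^ (n' - j) * u ^ Suc j" using power_add by metis
        then show "w * e * c (Suc j) * (inverse u ^ Suc j * u ^ n) = w * e * c (Suc j) * u ^ (n' - j)"
          using u0 by (simp add: field_simps)
      qed
      finally show ?thesis .
    qed
    define d where "d i = b i + (if n' - i \<le> m' then b n * (w * e * c (Suc (n' - i))) else 0)" for i
    have m'n': "m' \<le> n'" using mn n' by simp
    have "z = (\<Sum>i\<le>n'. b i * u ^ i) + b n * u ^ n" using b(2) n' by simp
    also have "b n * u ^ n = (\<Sum>j\<le>m'. b n * (w * e * c (Suc j)) * u ^ (n' - j))"
      by (simp add: un sum_distrib_left mult.assoc)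
    also have "\<dots> = (\<Sum>j\<le>n'. (if j \<le> m' then b n * (w * e * c (Suc j)) else 0) * u ^ (n' - j))"
      by (rule sum.mono_neutral_cong_left) (use m'n' in auto)
    also have "\<dots> = (\<Sum>i\<le>n'. (if n' - i \<le> m' then b n * (w * e * c (Suc (n' - i))) else 0) * u ^ (n' - (n' - i)))"
      by (rule sum.reindex_bij_witness[of _ "\<lambda>i. n' - i" "\<lambda>i. n' - i"]) auto
    also have "\<dots> = (\<Sum>i\<le>n'. (if n' - i \<le> m' then b n * (w * e * c (Suc (n' - i))) else 0) * u ^ i)"
      by (intro sum.cong refl) auto
    finally have "z = (\<Sum>i\<le>n'. d i * u ^ i)" by (simp add: d_def distrib_right sum.distrib)
    moreover have "d i \<in> M" for i
      using b(1) c(1) e(1) wM M(1) by (auto simp: d_def intro!: sr_intros)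
    ultimately show ?thesis using n' by (auto simp: Q_def intro!: exI[of _ n'])
  qed
  have "x \<in> M \<or> inverse x \<in> M" if x: "x \<in> F" for x
  proof (rule ccontr)
    assume nM: "\<not> (x \<in> M \<or> inverse x \<in> M)"
    then have x0: "x \<noteq> 0" using sr_0[OF M(1)] by auto
    have "inverse x \<in> F" using x F by (rule sf_inverse[rotated])
    with x nM have ex: "\<exists>n. Q x n" "\<exists>n. Q (inverse x) n" using repr by (auto simp: Q_def)
    define n m where "n = (LEAST n. Q x n)" and "m = (LEAST n. Q (inverse x) n)"
    have Qn: "Q x n" "Q (inverse x) m" unfolding n_def m_def using ex by (auto intro: LeastI_ex)
    show False
    proof (cases "m \<le> n")
      case True
      then obtain n' where "n' < n" "Q x n'" using red[OF Qn] x0 by blast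
      then show False using not_less_Least unfolding n_def by blast
    next
      case False
      then obtain n' where "n' < m" "Q (inverse x) n'" using red[of "inverse x" m n] Qn x0 by auto
      then show False using not_less_Least unfolding m_def by blast
    qed
  qed
  then have "valring M F" using M by (simp add: valring_def)
  moreover have "A \<subseteq> M" using B0(2) M(2) by blast
  ultimately show ?thesis using M(4) by blast
qed

subsection \<open>Places of function fields\<close>

lemma inverse_algebraic:
  assumes k: "subfield k \<Omega>" and x: "x \<in> alg_closure_of k"
  shows "\<exists>q\<in>poly_over k. inverse x = poly q x"
proof -
  obtain p where p: "p \<in> poly_over k" "p \<noteq> 0" "poly p x = 0"
    using x alg_closure_of_iff[OF k] by blast
  note se = simple_extension_algebraic[OF k p]
  have "x \<in> Om.simple_extension k x"
    using adjoin_ring(3)[OF sf_sr[OF k], of x] unfolding simple_extension_eq_polys[OF k] .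
  then have "inverse x \<in> Om.simple_extension k x" by (rule sf_inverse[OF se(1)])
  then show ?thesis unfolding simple_extension_eq_polys[OF k] by blast
qed

lemma max_ideal_iff: "x \<in> max_ideal R \<longleftrightarrow> x \<in> R \<and> (x = 0 \<or> inverse x \<notin> R)"
  by (auto simp: max_ideal_def)

lemma max_ideal_0: "subring R \<Omega> \<Longrightarrow> 0 \<in> max_ideal R"
  by (simp add: max_ideal_iff sr_0)

lemma max_ideal_mult:
  assumes "subring R \<Omega>" "a \<in> R" "x \<in> max_ideal R"
  shows "a * x \<in> max_ideal R"
proof -
  have "inverse x \<in> R" if "inverse (a * x) \<in> R" "a * x \<noteq> 0"
  proof -
    have "inverse x = a * inverse (a * x)" using that by (simp add: field_simps)
    then show ?thesis using that assms by (metis sr_mult)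
  qed
  then show ?thesis using assms by (auto simp: max_ideal_iff intro: sr_mult)
qed

lemma max_ideal_add:
  assumes V: "valring V F" "subfield F \<Omega>" and x: "x \<in> max_ideal V" and y: "y \<in> max_ideal V"
  shows "x + y \<in> max_ideal V"
proof -
  have sr: "subring V \<Omega>" "V \<subseteq> F" using V by (auto simp: valring_def)
  have main: "x + y \<in> max_ideal V" if xy: "x \<in> max_ideal V" "y \<in> max_ideal V" "y \<noteq> 0" "x / y \<in> V" for x y
  proof -
    have "1 + x / y \<in> V" using xy sr by (auto intro: sr_intros)
    then have "(1 + x / y) * y \<in> max_ideal V" using xy by (intro max_ideal_mult sr)
    moreover have "(1 + x / y) * y = x + y" using xy(3) by (simp add: distrib_right add.commute)
    ultimately show ?thesis by simp
  qed
  show ?thesis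
  proof (cases "x = 0 \<or> y = 0")
    case False
    have "x / y \<in> F" using x y sr V(2) by (auto simp: max_ideal_iff intro: sr_intros)
    then have "x / y \<in> V \<or> y / x \<in> V" using V(1) by (auto simp: valring_def)
    then show ?thesis using main[of x y] main[of y x] x y False by (auto simp: add.commute)
  qed (use x y in auto)
qed

lemma max_ideal_sum:
  assumes V: "valring V F" "subfield F \<Omega>" and f: "\<And>i. i \<in> I \<Longrightarrow> f i \<in> max_ideal V"
  shows "sum f I \<in> max_ideal V"
  using f
proof (induction I rule: infinite_finite_induct)
  case (insert x I)
  then show ?case using max_ideal_add[OF V] by simp
qed (use V max_ideal_0 in \<open>auto simp: valring_def\<close>)

lemma one_notin_max_ideal [simp]: "1 \<notin> max_ideal R"
  by (simp add: max_ideal_iff)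

lemma max_ideal_minus: "subring R \<Omega> \<Longrightarrow> x \<in> max_ideal R \<Longrightarrow> - x \<in> max_ideal R"
  using max_ideal_mult[of R "-1" x] sr_minus[of R 1] sr_1[of R] by auto

lemma algebraic_unit:
  assumes "subfield k \<Omega>" "subring R \<Omega>" "k \<subseteq> R" "x \<in> alg_closure_of k" "x \<in> R"
  shows "inverse x \<in> R"
  using inverse_algebraic[OF assms(1,4)] poly_in_subring[OF assms(2) poly_over_mono[OF _ assms(3)] assms(5)]
  by auto

lemma max_ideal_transcendental:
  assumes "subfield k \<Omega>" "subring R \<Omega>" "k \<subseteq> R" "x \<in> max_ideal R" "x \<noteq> 0"
  shows "x \<notin> alg_closure_of k"
  using algebraic_unit[OF assms(1-3)] assms(4,5) by (auto simp: max_ideal_iff)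

text \<open>The condition \<open>[K : k(x)] \<le> N\<close>, with denominators in \<open>k[x]\<close> cleared.\<close>

definition polydep :: "'a::alg_closed_field set \<Rightarrow> 'a set \<Rightarrow> 'a \<Rightarrow> nat \<Rightarrow> bool"
  where "polydep k K x N \<longleftrightarrow> (\<forall>v::nat \<Rightarrow> 'a. (\<forall>i\<le>N. v i \<in> K) \<longrightarrow>
     (\<exists>p. (\<forall>i\<le>N. p i \<in> poly_over k) \<and> (\<exists>i\<le>N. p i \<noteq> 0) \<and> (\<Sum>i\<le>N. poly (p i) x * v i) = 0))"

text \<open>A factor \<open>x\<close> common to all coefficients can be cancelled, which lowers the
  degree of a fixed nonzero \<open>p j\<close>. The result stays a nontrivial relation over
  \<open>k\<close> when reduced modulo \<open>x\<close>.\<close>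

lemma polydep_normal:
  assumes dep: "polydep k K x N" and x0: "x \<noteq> 0" and v: "\<And>i. i \<le> N \<Longrightarrow> v i \<in> K"
  shows "\<exists>p. (\<forall>i\<le>N. p i \<in> poly_over k) \<and> (\<exists>i\<le>N. Polynomial.coeff (p i) 0 \<noteq> 0) \<and>
    (\<Sum>i\<le>N. poly (p i) x * v i) = 0"
proof -
  obtain p where p: "\<forall>i\<le>N. p i \<in> poly_over k" "\<exists>i\<le>N. p i \<noteq> 0" "(\<Sum>i\<le>N. poly (p i) x * v i) = 0"
    using dep v unfolding polydep_def by blast
  then obtain j where j: "j \<le> N" "p j \<noteq> 0" by blast
  define n where "n = Polynomial.degree (p j)"
  have "\<exists>p. (\<forall>i\<le>N. p i \<in> poly_over k) \<and> (\<exists>i\<le>N. Polynomial.coeff (p i) 0 \<noteq> 0) \<and>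
    (\<Sum>i\<le>N. poly (p i) x * v i) = 0"
    if "\<forall>i\<le>N. p i \<in> poly_over k" "p j \<noteq> 0" "Polynomial.degree (p j) = n" "(\<Sum>i\<le>N. poly (p i) x * v i) = 0" for n p
    using that
  proof (induction n arbitrary: p rule: less_induct)
    case (less n)
    show ?case
    proof (cases "\<exists>i\<le>N. Polynomial.coeff (p i) 0 \<noteq> 0")
      case True
      with less.prems show ?thesis by blast
    next
      case False
      define q where "q i = poly_shift 1 (p i)" for i
      have pq: "p i = pCons 0 (q i)" if "i \<le> N" for i
        using False that by (intro poly_eqI) (auto simp: q_def coeff_pCons coeff_poly_shift split: nat.splits)
      have qk: "\<forall>i\<le>N. q i \<in> poly_over k"
        using less.prems(1) by (auto simp: q_def poly_over_def coeff_poly_shift)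
      have q0: "q j \<noteq> 0" using pq[OF j(1)] less.prems(2) by auto
      have "x * (\<Sum>i\<le>N. poly (q i) x * v i) = (\<Sum>i\<le>N. poly (p i) x * v i)"
        by (simp add: sum_distrib_left pq mult.assoc)
      with less.prems(4) x0 have s: "(\<Sum>i\<le>N. poly (q i) x * v i) = 0" by simp
      have "Polynomial.degree (q j) < n" using pq[OF j(1)] q0 less.prems(3) by (simp add: degree_pCons_eq)
      from less.IH[OF this qk q0 refl s] show ?thesis .
    qed
  qed
  from this[OF p(1) j(2) refl p(3)] show ?thesis .
qed

text \<open>The source of all upper bounds: \<open>M / x M\<close> has dimension at most
  \<open>[K : k(x)]\<close>, since a relation over \<open>k[x]\<close> reduces to one over
  \<open>k\<close> between constant terms. The hypothesis \<open>closed\<close> concerns only sums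
  that are known in both forms, as \<open>M\<close> need not be closed under multiplication by
  \<open>x\<close>.\<close>

lemma not_dim_ge_step:
  assumes dep: "polydep k K x N" and x0: "x \<noteq> 0" and k: "subfield k \<Omega>" and MK: "M \<subseteq> K"
    and closed: "\<And>c q v. (\<And>i. i \<le> N \<Longrightarrow> c i \<in> k) \<Longrightarrow> (\<And>i. i \<le> N \<Longrightarrow> q i \<in> poly_over k) \<Longrightarrow>
       (\<And>i. i \<le> N \<Longrightarrow> v i \<in> M) \<Longrightarrow> (\<Sum>i\<le>N. c i * v i) = x * (\<Sum>i\<le>N. poly (q i) x * v i) \<Longrightarrow>
       (\<Sum>i\<le>N. c i * v i) \<in> M'"
  shows "\<not> dim_ge k M M' (Suc N)"
proof
  assume "dim_ge k M M' (Suc N)"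
  then obtain v where v: "\<And>i. i < Suc N \<Longrightarrow> v i \<in> M" "indep_mod k M' {..<Suc N} v"
    unfolding dim_ge_def by blast
  obtain p where p: "\<forall>i\<le>N. p i \<in> poly_over k" "\<exists>i\<le>N. Polynomial.coeff (p i) 0 \<noteq> 0" "(\<Sum>i\<le>N. poly (p i) x * v i) = 0"
    using polydep_normal[OF dep x0, of v] v(1) MK by (auto simp: less_Suc_eq_le)
  define c where "c i = Polynomial.coeff (p i) 0" for i
  define q where "q i = 0 - poly_shift 1 (p i)" for i
  have sr: "subring k \<Omega>" using k by (rule sf_sr)
  have pp: "p i = pCons (c i) (poly_shift 1 (p i))" for i
    by (intro poly_eqI) (auto simp: c_def coeff_pCons coeff_poly_shift split: nat.splits)
  have "poly (p i) x = c i - x * poly (q i) x" for i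
    using arg_cong[OF pp[of i], of "\<lambda>p. poly p x"] by (simp add: q_def)
  then have "(\<Sum>i\<le>N. poly (p i) x * v i) = (\<Sum>i\<le>N. c i * v i) - x * (\<Sum>i\<le>N. poly (q i) x * v i)"
    by (simp add: left_diff_distrib sum_subtractf sum_distrib_left mult.assoc)
  then have e: "(\<Sum>i\<le>N. c i * v i) = x * (\<Sum>i\<le>N. poly (q i) x * v i)" using p(3) by simp
  have ck: "c i \<in> k" if "i \<le> N" for i using p(1) that by (auto simp: c_def poly_over_def)
  have "q i \<in> poly_over k" if "i \<le> N" for i
    unfolding q_def using p(1) that sr by (intro poly_over_diff) (auto simp: poly_over_def coeff_poly_shift sr_0)
  then have "(\<Sum>i\<le>N. c i * v i) \<in> M'" using closed[OF ck _ _ e] v(1) by (simp add: less_Suc_eq_le)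
  then have "(\<Sum>i<Suc N. c i * v i) \<in> M'" by (simp add: lessThan_Suc_atMost)
  then have "c i = 0" if "i \<le> N" for i
    using indep_modD[OF v(2), of c i] ck that by (auto simp: less_Suc_eq_le)
  with p(2) show False by (auto simp: c_def)
qed

text \<open>The bound \<open>fin\<close> is available for every transcendental \<open>x\<close>, not
  just for one. Constants algebraic over \<open>k\<close> are not excluded; where they matter, this
  is assumed separately.\<close>

locale ffield =
  fixes k K :: "'a::alg_closed_field set"
  assumes k: "subfield k \<Omega>" and K: "subfield K \<Omega>" and kK: "k \<subseteq> K"
    and fin: "\<And>x. x \<in> K \<Longrightarrow> x \<notin> alg_closure_of k \<Longrightarrow> \<exists>N. polydep k K x N"

text \<open>A discrete valuation ring of \<open>K\<close>, without reference to a field of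
  constants, so that the calculus of orders serves all function fields involved.\<close>

locale dplace =
  fixes R K :: "'a::alg_closed_field set"
  assumes K: "subfield K \<Omega>" and R: "valring R K"
    and uniformizer: "\<exists>t\<in>K. t \<noteq> 0 \<and> max_ideal R = (\<lambda>a. t * a) ` R \<and>
      (\<forall>z\<in>K. z \<noteq> 0 \<longrightarrow> (\<exists>n u. u \<in> R - max_ideal R \<and> z = t powi n * u))"
begin

lemma Rr: "subring R \<Omega>" and RK: "R \<subseteq> K"
  using R by (auto simp: valring_def)

lemma unit_iff: "u \<in> R - max_ideal R \<longleftrightarrow> u \<noteq> 0 \<and> u \<in> R \<and> inverse u \<in> R"
  by (auto simp: max_ideal_iff)

lemma unit_powi: "u \<in> R - max_ideal R \<Longrightarrow> u powi n \<in> R - max_ideal R"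
  unfolding unit_iff by (auto simp: power_int_def power_inverse[symmetric] intro: sr_power[OF Rr])

lemma unit_mult: "u \<in> R - max_ideal R \<Longrightarrow> v \<in> R - max_ideal R \<Longrightarrow> u * v \<in> R - max_ideal R"
  unfolding unit_iff by (auto intro: sr_mult[OF Rr])

lemma unit_inverse: "u \<in> R - max_ideal R \<Longrightarrow> inverse u \<in> R - max_ideal R"
  unfolding unit_iff by auto

lemma max_ideal_power_Suc: "t \<in> max_ideal R \<Longrightarrow> t ^ Suc n \<in> max_ideal R"
  using max_ideal_mult[OF Rr, of "t ^ n" t] sr_power[OF Rr, of t n] by (simp add: max_ideal_iff mult.commute)

lemma powi_unit:
  assumes t: "t \<in> max_ideal R" and e: "t powi n \<in> R - max_ideal R"
  shows "n = 0"
proof (rule ccontr)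
  assume n: "n \<noteq> 0"
  have "t powi \<bar>n\<bar> \<in> R - max_ideal R"
    using e unit_inverse[OF e] by (cases "n \<ge> 0") (auto simp: power_int_minus)
  moreover obtain m where "\<bar>n\<bar> = int (Suc m)" using n by (metis abs_ge_zero not0_implies_Suc of_nat_0 nonneg_int_cases abs_eq_0)
  then have "t powi \<bar>n\<bar> = t ^ Suc m" by (metis power_int_of_nat)
  ultimately show False using max_ideal_power_Suc[OF t, of m] by auto
qed

text \<open>The definite description ranges over all uniformizers; two of them differ by a unit, so
  the exponent is the same.\<close>

lemma ord_at_eq:
  assumes t: "t \<noteq> 0" "max_ideal R = (\<lambda>a. t * a) ` R" and u: "u \<in> R - max_ideal R"
  shows "ord_at R (t powi n * u) = n"
  unfolding ord_at_def
proof (rule the_equality)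
  show "\<exists>t' u'. max_ideal R = (\<lambda>a. t' * a) ` R \<and> u' \<in> R - max_ideal R \<and> t powi n * u = t' powi n * u'"
    using t u by blast
  fix n' assume "\<exists>t' u'. max_ideal R = (\<lambda>a. t' * a) ` R \<and> u' \<in> R - max_ideal R \<and> t powi n * u = t' powi n' * u'"
  then obtain t' u' where t': "max_ideal R = (\<lambda>a. t' * a) ` R" "u' \<in> R - max_ideal R" "t powi n * u = t' powi n' * u'"
    by blast
  have tm: "t \<in> max_ideal R" "t' \<in> max_ideal R" using t(2) t'(1) sr_1[OF Rr] by force+
  obtain a b where ab: "a \<in> R" "b \<in> R" "t' = t * a" "t = t' * b"
    using tm t(2) t'(1) by blast
  then have "t = t * (a * b)" by (metis mult.assoc)
  then have "a * b = 1" using t(1) by simp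
  then have "a \<noteq> 0" "inverse a = b" using inverse_unique by auto
  then have a: "a \<in> R - max_ideal R" unfolding unit_iff using ab by auto
  have "t powi n * u = t powi n' * (a powi n' * u')"
    using t'(3) ab(3) by (simp add: power_int_mult_distrib mult.assoc)
  then have "t powi (n - n') = (a powi n' * u') * inverse u"
    using t(1) u[unfolded unit_iff] by (simp add: power_int_diff field_simps)
  also have "\<dots> \<in> R - max_ideal R" by (intro unit_mult unit_powi unit_inverse a u t'(2))
  finally have "n - n' = 0" using powi_unit[OF tm(1)] by blast
  then show "n' = n" by simp
qed

lemma obtain_uniformizer:
  obtains t where "t \<in> K" "t \<noteq> 0" "t \<in> max_ideal R" "max_ideal R = (\<lambda>a. t * a) ` R" "ord_at R t = 1"
    "\<And>z. z \<in> K \<Longrightarrow> z \<noteq> 0 \<Longrightarrow> \<exists>u. u \<in> R - max_ideal R \<and> z = t powi (ord_at R z) * u"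
proof -
  obtain t where t: "t \<in> K" "t \<noteq> 0" "max_ideal R = (\<lambda>a. t * a) ` R"
    "\<And>z. z\<in>K \<Longrightarrow> z \<noteq> 0 \<Longrightarrow> \<exists>n u. u \<in> R - max_ideal R \<and> z = t powi n * u"
    using uniformizer by blast
  have "1 \<in> R - max_ideal R" by (simp add: sr_1[OF Rr])
  then have "ord_at R (t powi 1 * 1) = 1" using t by (intro ord_at_eq)
  moreover have "\<exists>u. u \<in> R - max_ideal R \<and> z = t powi (ord_at R z) * u" if "z \<in> K" "z \<noteq> 0" for z
    using t(4)[OF that] ord_at_eq[OF t(2,3)] by metis
  moreover have "t \<in> max_ideal R" using t(3) sr_1[OF Rr] by force
  ultimately show ?thesis using that[of t] t by simp
qed

lemma ord_mult:
  assumes "x \<in> K" "y \<in> K" "x \<noteq> 0" "y \<noteq> 0"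
  shows "ord_at R (x * y) = ord_at R x + ord_at R y"
proof (rule obtain_uniformizer)
  fix t assume t: "t \<in> K" "t \<noteq> 0" "max_ideal R = (\<lambda>a. t * a) ` R"
    "\<And>z. z \<in> K \<Longrightarrow> z \<noteq> 0 \<Longrightarrow> \<exists>u. u \<in> R - max_ideal R \<and> z = t powi (ord_at R z) * u"
  obtain u v where u: "u \<in> R - max_ideal R" "x = t powi (ord_at R x) * u"
    and v: "v \<in> R - max_ideal R" "y = t powi (ord_at R y) * v" using t(4) assms by metis
  have "x * y = t powi (ord_at R x + ord_at R y) * (u * v)"
    using t(2) by (subst u(2), subst v(2)) (simp add: power_int_add mult_ac)
  then show ?thesis using ord_at_eq[OF t(2,3) unit_mult[OF u(1) v(1)]] by simp
qed

lemma ord_1 [simp]: "ord_at R 1 = 0"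
  using ord_mult[of 1 1] K by (auto simp: sr_intros)

lemma ord_inverse: "x \<in> K \<Longrightarrow> x \<noteq> 0 \<Longrightarrow> ord_at R (inverse x) = - ord_at R x"
  using ord_mult[of x "inverse x"] K by (auto simp: sf_inverse)

lemma ord_divide: "x \<in> K \<Longrightarrow> y \<in> K \<Longrightarrow> x \<noteq> 0 \<Longrightarrow> y \<noteq> 0 \<Longrightarrow> ord_at R (x / y) = ord_at R x - ord_at R y"
  using ord_mult[of x "inverse y"] ord_inverse[of y] K by (auto simp: sf_inverse divide_inverse)

lemma ord_power: "x \<in> K \<Longrightarrow> x \<noteq> 0 \<Longrightarrow> ord_at R (x ^ n) = int n * ord_at R x"
  by (induction n) (auto simp: ord_mult sr_power sf_sr[OF K] algebra_simps)

lemma ord_powi: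
  assumes "x \<in> K" "x \<noteq> 0" shows "ord_at R (x powi n) = n * ord_at R x"
  using assms sr_power[OF sf_sr[OF K], of x]
  by (auto simp: power_int_def ord_power ord_inverse sf_inverse[OF K] power_inverse)

lemma powi_K: "x \<in> K \<Longrightarrow> x powi n \<in> K"
  using K by (auto simp: power_int_def intro: sr_intros)

lemma R_iff: assumes "x \<in> K" "x \<noteq> 0" shows "x \<in> R \<longleftrightarrow> ord_at R x \<ge> 0"
  and max_ideal_ord: "x \<in> max_ideal R \<longleftrightarrow> ord_at R x \<ge> 1"
proof -
  obtain t where t: "t \<in> K" "t \<noteq> 0" "t \<in> max_ideal R" "max_ideal R = (\<lambda>a. t * a) ` R" "ord_at R t = 1"
    "\<And>z. z \<in> K \<Longrightarrow> z \<noteq> 0 \<Longrightarrow> \<exists>u. u \<in> R - max_ideal R \<and> z = t powi (ord_at R z) * u"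
    by (rule obtain_uniformizer) blast
  have nonneg: "x \<in> R" if "x \<in> K" "x \<noteq> 0" "ord_at R x \<ge> 0" for x
  proof -
    obtain u where u: "u \<in> R - max_ideal R" "x = t powi (ord_at R x) * u" using t(6) \<open>x \<in> K\<close> \<open>x \<noteq> 0\<close> by blast
    moreover have "t \<in> R" using t(3) by (simp add: max_ideal_iff)
    then have "t powi (ord_at R x) \<in> R" using that(3) by (auto simp: power_int_def intro: sr_power[OF Rr])
    ultimately show ?thesis using sr_mult[OF Rr] by (metis DiffD1)
  qed
  have pos: "x \<in> max_ideal R" if x: "x \<in> K" "x \<noteq> 0" "ord_at R x \<ge> 1" for x
  proof -
    have "x / t \<in> R" using x t(1,2,5) K by (intro nonneg) (auto simp: ord_divide intro: sr_intros)
    then have "t * (x / t) \<in> max_ideal R" using t(4) by blast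
    then show ?thesis using t(2) by simp
  qed
  show 1: "x \<in> R \<longleftrightarrow> ord_at R x \<ge> 0"
  proof
    assume x: "x \<in> R"
    show "ord_at R x \<ge> 0"
    proof (rule ccontr)
      assume "\<not> ?thesis"
      then have "inverse x \<in> max_ideal R" using assms ord_inverse K by (intro pos) (auto intro: sr_intros)
      then have "x * inverse x \<in> max_ideal R" using x by (intro max_ideal_mult Rr)
      then show False using assms one_notin_max_ideal by simp
    qed
  qed (use assms nonneg in blast)
  show "x \<in> max_ideal R \<longleftrightarrow> ord_at R x \<ge> 1"
  proof
    assume x: "x \<in> max_ideal R"
    then have "ord_at R x \<ge> 0" using 1 by (simp add: max_ideal_iff)
    moreover have "ord_at R x \<noteq> 0"
    proof
      assume "ord_at R x = 0"
      then have "inverse x \<in> R" using assms ord_inverse K by (intro nonneg) (auto intro: sr_intros)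
      then show False using x assms by (simp add: max_ideal_iff)
    qed
    ultimately show "ord_at R x \<ge> 1" by simp
  qed (use assms pos in blast)
qed

lemma ord_add_ge:
  assumes x: "x \<in> K" "x = 0 \<or> ord_at R x \<ge> n" and y: "y \<in> K" "y = 0 \<or> ord_at R y \<ge> n" and "x + y \<noteq> 0"
  shows "ord_at R (x + y) \<ge> n"
proof -
  obtain t where t: "t \<in> K" "t \<noteq> 0" "ord_at R t = 1" by (rule obtain_uniformizer) blast
  have R_iff': "z \<in> K \<Longrightarrow> z \<noteq> 0 \<Longrightarrow> z / t powi n \<in> R \<longleftrightarrow> ord_at R z \<ge> n" for z
    using R_iff[of "z / t powi n"] t powi_K[OF t(1), of n] K by (auto simp: ord_divide ord_powi sf_divide)
  have div: "z / t powi n \<in> R" if "z \<in> K" "z = 0 \<or> ord_at R z \<ge> n" for z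
    using that R_iff'[of z] sr_0[OF Rr] by (cases "z = 0") simp_all
  have "x / t powi n \<in> R" "y / t powi n \<in> R" using div x y by blast+
  then have "(x + y) / t powi n \<in> R" by (simp add: add_divide_distrib sr_add[OF Rr])
  moreover have "x + y \<in> K" using x y K by (auto intro: sr_intros)
  ultimately show ?thesis using R_iff' assms(5) by blast
qed

lemma ord_minus: "x \<in> K \<Longrightarrow> x \<noteq> 0 \<Longrightarrow> ord_at R (- x) = ord_at R x"
proof -
  assume x: "x \<in> K" "x \<noteq> 0"
  have m1: "- 1 \<in> K" using K by (auto intro: sr_intros)
  have "ord_at R (- 1 * - 1) = ord_at R (-1) + ord_at R (-1)" by (rule ord_mult) (use m1 in auto)
  then have "ord_at R (-1) = 0" by simp
  then show ?thesis using ord_mult[of "-1" x] m1 x by simp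
qed

lemma ord_add_eq:
  assumes x: "x \<in> K" "x \<noteq> 0" and y: "y \<in> K" "y = 0 \<or> ord_at R y > ord_at R x"
  shows "x + y \<noteq> 0" "ord_at R (x + y) = ord_at R x"
proof -
  show ne: "x + y \<noteq> 0"
  proof
    assume "x + y = 0"
    then have "y = - x" by (simp add: eq_neg_iff_add_eq_0 add.commute)
    then show False using y x ord_minus by auto
  qed
  have ge: "ord_at R (x + y) \<ge> ord_at R x" using x y ne by (intro ord_add_ge) auto
  show "ord_at R (x + y) = ord_at R x"
  proof (rule ccontr)
    assume "\<not> ?thesis"
    then have gt: "ord_at R (x + y) \<ge> ord_at R x + 1" using ge by simp
    have y0: "y \<noteq> 0" using gt by auto
    have xyK: "x + y \<in> K" "- y \<in> K" using x y K by (auto intro: sr_intros)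
    have "ord_at R (- y) \<ge> ord_at R x + 1" using y y0 ord_minus[of y] by simp
    then have "ord_at R ((x + y) + - y) \<ge> ord_at R x + 1"
      using gt x(2) by (intro ord_add_ge xyK) auto
    then show False by simp
  qed
qed

text \<open>A high power of an element of negative order absorbs every pole, so a larger ring
  contains all of \<open>K\<close>.\<close>

lemma maximal:
  assumes B: "subring B \<Omega>" "R \<subseteq> B" "B \<subseteq> K" "B \<noteq> R"
  shows "B = K"
proof -
  obtain a where a: "a \<in> B" "a \<notin> R" using B by blast
  then have aK: "a \<in> K" "a \<noteq> 0" using B sr_0[OF Rr] by auto
  then have neg: "ord_at R a < 0" using a R_iff by force
  have "z \<in> B" if z: "z \<in> K" for z
  proof (cases "z = 0")
    case False
    define n where "n = nat \<bar>ord_at R z\<bar>"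
    have "ord_at R (z / a ^ n) \<ge> 0"
    proof -
      have "ord_at R (z / a ^ n) = ord_at R z - int n * ord_at R a"
        using z False aK K by (simp add: ord_divide ord_power sr_power sf_sr)
      moreover have "int n * ord_at R a \<le> int n * (-1)" using neg by (intro mult_left_mono) auto
      ultimately show ?thesis by (simp add: n_def)
    qed
    moreover have "z / a ^ n \<in> K" using z aK K by (auto intro: sr_intros)
    ultimately have "z / a ^ n \<in> B" using R_iff[of "z / a ^ n"] False aK B(2) by auto
    then have "(z / a ^ n) * a ^ n \<in> B" using a B(1) by (intro sr_mult sr_power)
    then show ?thesis using aK by simp
  qed (use B sr_0 in auto)
  then show ?thesis using B(3) by blast
qed

end

context ffield
begin

lemma placeD:
  assumes "R \<in> places k K"
  shows "subring R \<Omega>" "k \<subseteq> R" "R \<subseteq> K" "R \<noteq> K" "valring R K"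
  using assms by (auto simp: places_def valring_def)

lemma place_not_field:
  assumes R: "R \<in> places k K"
  shows "\<exists>x\<in>max_ideal R. x \<noteq> 0"
proof -
  obtain y where y: "y \<in> K" "y \<notin> R" using placeD[OF R] by blast
  then have "inverse y \<in> R" "y \<noteq> 0" using placeD[OF R] sr_0[OF placeD(1)[OF R]] by (auto simp: valring_def)
  then show ?thesis using y by (intro bexI[of _ "inverse y"]) (auto simp: max_ideal_iff)
qed

text \<open>Discreteness of the valuation. The ring modulo \<open>y 0\<close> has finite dimension
  over \<open>k\<close>, bounded through the degree over \<open>k(y 0)\<close>, whereas the members
  of a chain of strictly decreasing orders are independent modulo \<open>y 0\<close>.\<close>

lemma no_long_chain:
  assumes R: "R \<in> places k K" and y: "\<And>i::nat. y i \<in> R" "\<And>i. y i \<noteq> 0" "\<And>i. y i / y (Suc i) \<in> max_ideal R"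
    and y0: "y 0 \<in> max_ideal R"
  shows False
proof -
  note pl = placeD[OF R]
  obtain N where N: "polydep k K (y 0) N"
    using fin[of "y 0"] max_ideal_transcendental[OF k pl(1,2) y0 y(2)] y(1) pl(3) by blast
  have chain: "y i / y (i + Suc j) \<in> max_ideal R" for i j
  proof (induction j)
    case 0
    then show ?case using y(3)[of i] by simp
  next
    case (Suc j)
    have "y (i + Suc j) / y (Suc (i + Suc j)) \<in> R" using y(3)[of "i + Suc j"] by (simp add: max_ideal_iff)
    then have "y (i + Suc j) / y (Suc (i + Suc j)) * (y i / y (i + Suc j)) \<in> max_ideal R"
      using Suc by (intro max_ideal_mult pl(1))
    then show ?case using y(2) by (simp add: field_simps)
  qed
  define M' where "M' = (\<lambda>a. y 0 * a) ` R"
  have "\<not> dim_ge k R M' (Suc N)"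
  proof (rule not_dim_ge_step[OF N y(2) k pl(3)])
    fix c q v assume a: "\<And>i. i \<le> N \<Longrightarrow> c i \<in> k" "\<And>i. i \<le> N \<Longrightarrow> q i \<in> poly_over k"
       "\<And>i. i \<le> N \<Longrightarrow> v i \<in> R" "(\<Sum>i\<le>N. c i * v i) = y 0 * (\<Sum>i\<le>N. poly (q i) (y 0) * v i)"
    have "(\<Sum>i\<le>N. poly (q i) (y 0) * v i) \<in> R"
      using a y(1) by (intro sr_sum sr_mult pl(1) poly_in_subring poly_over_mono[OF _ pl(2)]) auto
    then show "(\<Sum>i\<le>N. c i * v i) \<in> M'" unfolding a(4) M'_def by blast
  qed
  moreover have "dim_ge k R M' (Suc N)"
  proof -
    have "indep_mod k M' {..<Suc N} (\<lambda>i. y (Suc i))" unfolding indep_mod_def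
    proof (intro allI impI)
      fix c assume c: "\<forall>i\<in>{..<Suc N}. c i \<in> k" and s: "(\<Sum>i<Suc N. c i * y (Suc i)) \<in> M'"
      show "\<forall>i\<in>{..<Suc N}. c i = 0"
      proof (rule ccontr)
        assume "\<not> ?thesis"
        then have ne: "{i \<in> {..<Suc N}. c i \<noteq> 0} \<noteq> {}" by auto
        \<comment> \<open>Larger indices have smaller order, so the last nonzero term dominates.
          Dividing by \<open>y (Suc m)\<close> would put the nonzero constant \<open>c m\<close>
          into the maximal ideal.\<close>
        define m where "m = Max {i \<in> {..<Suc N}. c i \<noteq> 0}"
        have m: "m < Suc N" "c m \<noteq> 0" using Max_in[OF _ ne] by (auto simp: m_def)
        have above: "c i = 0" if "i < Suc N" "m < i" for i
        proof (rule ccontr)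
          assume "c i \<noteq> 0"
          then have "i \<le> m" unfolding m_def using that by (intro Max_ge) auto
          with that show False by simp
        qed
        have "(\<Sum>i<Suc N. c i * y (Suc i)) = (\<Sum>i<Suc m. c i * y (Suc i))"
          by (rule sum.mono_neutral_right) (use m above in auto)
        then have s': "c m * y (Suc m) + (\<Sum>i<m. c i * y (Suc i)) \<in> M'" using s by (simp add: add.commute)
        then obtain a where a: "a \<in> R" "c m * y (Suc m) + (\<Sum>i<m. c i * y (Suc i)) = y 0 * a"
          by (auto simp: M'_def)
        have "c m = y 0 / y (Suc m) * a + (\<Sum>i<m. - c i * (y (Suc i) / y (Suc m)))"
          using a(2) y(2)[of "Suc m"]
          by (simp add: field_simps sum_divide_distrib[symmetric] sum_negf)
        also have "\<dots> \<in> max_ideal R"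
        proof (intro max_ideal_add[OF pl(5) K] max_ideal_sum[OF pl(5) K])
          show "y 0 / y (Suc m) * a \<in> max_ideal R"
            using max_ideal_mult[OF pl(1) a(1), of "y 0 / y (Suc m)"] chain[of 0 m] by (simp add: mult.commute)
          fix i assume i: "i \<in> {..<m}"
          then obtain j where j: "m = Suc (i + j)" by (metis less_imp_Suc_add lessThan_iff)
          have "- c i \<in> R" using c i m pl(1,2) by (auto intro!: sr_minus)
          then show "- c i * (y (Suc i) / y (Suc m)) \<in> max_ideal R"
            using chain[of "Suc i" j] by (intro max_ideal_mult[OF pl(1)]) (simp_all add: j)
        qed
        finally have "c m \<in> max_ideal R" .
        moreover have "inverse (c m) \<in> R" using c m pl(2) sf_inverse[OF k] by auto
        ultimately show False using m(2) by (simp add: max_ideal_iff)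
      qed
    qed
    then show ?thesis unfolding dim_ge_def using y(1) by (intro exI[of _ "\<lambda>i. y (Suc i)"]) simp
  qed
  ultimately show False by blast
qed

text \<open>The chain argument is used twice. If no element generated the maximal ideal, elements of
  ever smaller positive order could be chosen; and for a generator \<open>t\<close>, an element
  divisible by all powers of \<open>t\<close> would start a chain as well.\<close>

lemma place_dplace:
  assumes R: "R \<in> places k K"
  shows "dplace R K"
proof (rule dplace.intro)
  note pl = placeD[OF R]
  show "subfield K \<Omega>" "valring R K" using K pl by auto
  have "\<exists>t\<in>max_ideal R. t \<noteq> 0 \<and> max_ideal R \<subseteq> (\<lambda>a. t * a) ` R"
  proof (rule ccontr)
    assume neg: "\<not> ?thesis"
    have "\<exists>s\<in>max_ideal R. s \<noteq> 0 \<and> t / s \<in> max_ideal R" if t: "t \<in> max_ideal R" "t \<noteq> 0" for t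
    proof -
      obtain s where s: "s \<in> max_ideal R" "s \<notin> (\<lambda>a. t * a) ` R" using neg t by blast
      have s0: "s \<noteq> 0" using s(2) sr_0[OF pl(1)] by force
      have nR: "s / t \<notin> R" using s(2) t(2) by (auto simp: image_iff dest: bspec[of _ _ "s / t"])
      moreover have "s / t \<in> K" using s t pl(3) K by (auto simp: max_ideal_iff intro!: sr_intros)
      ultimately have "t / s \<in> R" using pl(5) by (auto simp: valring_def)
      then show ?thesis using nR s s0 t by (intro bexI[of _ s]) (auto simp: max_ideal_iff)
    qed
    then obtain f where f: "\<And>t. t \<in> max_ideal R \<Longrightarrow> t \<noteq> 0 \<Longrightarrow> f t \<in> max_ideal R \<and> f t \<noteq> 0 \<and> t / f t \<in> max_ideal R"
      by metis
    obtain x where x: "x \<in> max_ideal R" "x \<noteq> 0" using place_not_field[OF R] by blast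
    define y where "y i = (f ^^ i) x" for i
    have y: "y i \<in> max_ideal R \<and> y i \<noteq> 0" for i
      by (induction i) (use f x in \<open>auto simp: y_def\<close>)
    show False
    proof (rule no_long_chain[OF R, of y])
      show "y i \<in> R" "y i \<noteq> 0" "y i / y (Suc i) \<in> max_ideal R" for i
        using y[of i] f[of "y i"] by (auto simp: y_def max_ideal_iff)
      show "y 0 \<in> max_ideal R" using y by blast
    qed
  qed
  then obtain t where t: "t \<in> max_ideal R" "t \<noteq> 0" "max_ideal R \<subseteq> (\<lambda>a. t * a) ` R" by blast
  have tR: "t \<in> R" using t by (simp add: max_ideal_iff)
  have eq: "max_ideal R = (\<lambda>a. t * a) ` R"
    using t(3) max_ideal_mult[OF pl(1) _ t(1)] by (auto simp: mult.commute)
  have repr: "\<exists>n::nat. \<exists>u. u \<in> R - max_ideal R \<and> z = t ^ n * u" if z: "z \<in> R" "z \<noteq> 0" for z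
  proof -
    \<comment> \<open>Otherwise the elements \<open>z / t ^ n\<close> form a chain whose neighbours
      have quotient \<open>t\<close>.\<close>
    have "\<exists>n. z / t ^ n \<notin> R"
    proof (rule ccontr)
      assume "\<not> ?thesis"
      then have all: "z / t ^ n \<in> R" for n by blast
      show False
      proof (rule no_long_chain[OF R, of "\<lambda>n. z / t ^ n"])
        show "z / t ^ 0 \<in> max_ideal R"
        proof -
          have "t * (z / t ^ 1) \<in> (\<lambda>a. t * a) ` R" using all by blast
          then show ?thesis using t(2) eq by simp
        qed
      qed (use all z t in auto)
    qed
    then obtain n where n: "z / t ^ n \<notin> R" "\<And>m. m < n \<Longrightarrow> z / t ^ m \<in> R"
      using exists_least_iff[of "\<lambda>n. z / t ^ n \<notin> R"] by auto
    then obtain m where m: "n = Suc m" using z by (cases n) auto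
    have "z / t ^ m \<in> R" using n m by simp
    moreover have "z / t ^ m \<notin> max_ideal R"
    proof
      assume "z / t ^ m \<in> max_ideal R"
      then obtain a where "a \<in> R" "z / t ^ m = t * a" using eq by blast
      then have "z / t ^ n \<in> R" using t(2) by (simp add: m field_simps)
      with n(1) show False by simp
    qed
    ultimately show ?thesis using t(2) by (intro exI[of _ m] exI[of _ "z / t ^ m"]) simp
  qed
  show "\<exists>t\<in>K. t \<noteq> 0 \<and> max_ideal R = (\<lambda>a. t * a) ` R \<and>
      (\<forall>z\<in>K. z \<noteq> 0 \<longrightarrow> (\<exists>n u. u \<in> R - max_ideal R \<and> z = t powi n * u))"
  proof (intro bexI[of _ t] conjI ballI impI t(2) eq)
    show "t \<in> K" using tR pl(3) by blast
    fix z assume z: "z \<in> K" "z \<noteq> 0"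
    show "\<exists>n u. u \<in> R - max_ideal R \<and> z = t powi n * u"
    proof (cases "z \<in> R")
      case True
      then obtain n u where "u \<in> R - max_ideal R" "z = t ^ n * u" using repr z by blast
      then show ?thesis by (intro exI[of _ "int n"] exI[of _ u]) simp
    next
      case False
      then have "inverse z \<in> R" using z pl(5) by (auto simp: valring_def)
      then obtain n u where u: "u \<in> R - max_ideal R" "inverse z = t ^ n * u" using repr[of "inverse z"] z by auto
      then have "z = t powi (- int n) * inverse u"
        by (metis inverse_inverse_eq inverse_mult_distrib power_int_minus power_int_of_nat)
      moreover have "inverse u \<in> R - max_ideal R" using u(1) by (auto simp: max_ideal_iff)
      ultimately show ?thesis by blast
    qed
  qed
qed

end

subsection \<open>Degrees of function fields over rational subfields\<close>

lemma adjoin_props: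
  "subfield (adjoin k x) \<Omega>" "k \<subseteq> adjoin k x" "x \<in> adjoin k x"
  "subfield E \<Omega> \<Longrightarrow> k \<subseteq> E \<Longrightarrow> x \<in> E \<Longrightarrow> adjoin k x \<subseteq> E"
  using generate_field_props(1)[of "insert x k"] generate_field_props(2)[of "insert x k"]
    generate_field_props(3)[of E "insert x k"]
  by (auto simp: adjoin_def)

lemma adjoin_subset_fractions:
  assumes k: "subfield k \<Omega>"
  shows "adjoin k x \<subseteq> {poly p x / poly q x |p q. p \<in> poly_over k \<and> q \<in> poly_over k \<and> poly q x \<noteq> 0}" (is "_ \<subseteq> ?F")
proof (rule adjoin_props(4))
  have sr: "subring k \<Omega>" using k by (rule sf_sr)
  have I: "poly p x / poly q x \<in> ?F" if "p \<in> poly_over k" "q \<in> poly_over k" "poly q x \<noteq> 0" for p q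
    using that by blast
  have poly_in: "poly p x \<in> ?F" if "p \<in> poly_over k" for p
    using I[OF that poly_over_1[OF sr]] by simp
  show "k \<subseteq> ?F"
  proof
    fix c assume "c \<in> k"
    then show "c \<in> ?F" using poly_in[of "[:c:]"] sr_0[OF sr] by simp
  qed
  show "x \<in> ?F" using poly_in[of "[:0,1:]"] sr_0[OF sr] sr_1[OF sr] by simp
  show "subfield ?F \<Omega>" unfolding subfield_Omega_iff subring_Omega_iff
  proof (intro conjI ballI)
    show "1 \<in> ?F" using poly_in[OF poly_over_1[OF sr]] by simp
  next
    fix y assume "y \<in> ?F"
    then obtain p q where p: "p \<in> poly_over k" "q \<in> poly_over k" "poly q x \<noteq> 0" "y = poly p x / poly q x" by blast
    have "0 - p \<in> poly_over k" using p sr by (intro poly_over_diff) (auto intro: sr_0 poly_over_0)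
    from I[OF this p(2,3)] show "- y \<in> ?F" using p by simp
    show "inverse y \<in> ?F"
    proof (cases "poly p x = 0")
      case True
      then show ?thesis using p poly_in[of 0] sr_0[OF sr] by simp
    next
      case False
      then show ?thesis using I[OF p(2,1)] p(4) by simp
    qed
  next
    fix y z assume "y \<in> ?F" "z \<in> ?F"
    then obtain p q r s where p: "p \<in> poly_over k" "q \<in> poly_over k" "poly q x \<noteq> 0" "y = poly p x / poly q x"
      "r \<in> poly_over k" "s \<in> poly_over k" "poly s x \<noteq> 0" "z = poly r x / poly s x" by blast
    have "poly (p * s + r * q) x / poly (q * s) x \<in> ?F"
      using p sr by (intro I poly_over_add poly_over_mult) auto
    then show "y + z \<in> ?F" using p by (simp add: add_frac_eq)
    have "poly (p * r) x / poly (q * s) x \<in> ?F"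
      using p sr by (intro I poly_over_mult) auto
    then show "y * z \<in> ?F" using p by simp
  qed
qed

lemma polydep_mono:
  assumes "polydep k K x N" "N \<le> N'" "0 \<in> k"
  shows "polydep k K x N'"
  unfolding polydep_def
proof (intro allI impI)
  fix v :: "nat \<Rightarrow> 'a" assume "\<forall>i\<le>N'. v i \<in> K"
  then have "\<forall>i\<le>N. v i \<in> K" using assms(2) by simp
  then obtain p where p: "\<forall>i\<le>N. p i \<in> poly_over k" "\<exists>i\<le>N. p i \<noteq> 0" "(\<Sum>i\<le>N. poly (p i) x * v i) = 0"
    using assms(1) unfolding polydep_def by blast
  define q where "q i = (if i \<le> N then p i else 0)" for i
  have "(\<Sum>i\<le>N'. poly (q i) x * v i) = (\<Sum>i\<le>N. poly (p i) x * v i)"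
    by (rule sum.mono_neutral_cong_right) (use assms(2) in \<open>auto simp: q_def\<close>)
  with p assms show "\<exists>p. (\<forall>i\<le>N'. p i \<in> poly_over k) \<and> (\<exists>i\<le>N'. p i \<noteq> 0) \<and> (\<Sum>i\<le>N'. poly (p i) x * v i) = 0"
    by (intro exI[of _ q]) (auto simp: q_def intro: order_trans)
qed

lemma dimension_imp_polydep:
  assumes k: "subfield k \<Omega>" and d: "Om.dimension N (adjoin k x) K"
  shows "polydep k K x N"
  unfolding polydep_def
proof (intro allI impI)
  fix v :: "nat \<Rightarrow> 'a" assume v: "\<forall>i\<le>N. v i \<in> K"
  have sr: "subring k \<Omega>" using k by (rule sf_sr)
  have "\<not> dim_ge (adjoin k x) K {0} (Suc N)" using dimension_imp(2)[OF adjoin_props(1) d, of "Suc N"] by simp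
  then have "\<not> indep_mod (adjoin k x) {0} {..<Suc N} v" using v unfolding dim_ge_def by (auto simp: less_Suc_eq_le)
  then obtain a j where a: "\<And>i. i \<le> N \<Longrightarrow> a i \<in> adjoin k x" "(\<Sum>i\<le>N. a i * v i) = 0" "j \<le> N" "a j \<noteq> 0"
    unfolding indep_mod_def by (auto simp: less_Suc_eq_le lessThan_Suc_atMost)
  have "\<forall>i\<in>{..N}. \<exists>pq. fst pq \<in> poly_over k \<and> snd pq \<in> poly_over k \<and> poly (snd pq) x \<noteq> 0 \<and> a i = poly (fst pq) x / poly (snd pq) x"
    using a(1) adjoin_subset_fractions[OF k, of x] by fastforce
  from bchoice[OF this] obtain pq where pq: "\<And>i. i \<le> N \<Longrightarrow> fst (pq i) \<in> poly_over k \<and> snd (pq i) \<in> poly_over k \<and>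
     poly (snd (pq i)) x \<noteq> 0 \<and> a i = poly (fst (pq i)) x / poly (snd (pq i)) x" by auto
  define D where "D = (\<Prod>i\<le>N. poly (snd (pq i)) x)"
  define p where "p i = fst (pq i) * (\<Prod>h\<in>{..N}-{i}. snd (pq h))" for i
  have D0: "D \<noteq> 0" using pq by (auto simp: D_def)
  have pa: "poly (p i) x = D * a i" if "i \<le> N" for i
  proof -
    have "D = poly (snd (pq i)) x * (\<Prod>h\<in>{..N}-{i}. poly (snd (pq h)) x)"
      unfolding D_def using that by (intro prod.remove) auto
    then show ?thesis using pq[OF that] by (simp add: p_def poly_prod)
  qed
  have "(\<Sum>i\<le>N. poly (p i) x * v i) = D * (\<Sum>i\<le>N. a i * v i)"
    by (simp add: pa sum_distrib_left mult.assoc)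
  moreover have "p i \<in> poly_over k" if "i \<le> N" for i
    unfolding p_def using pq that by (intro poly_over_mult[OF sr] poly_over_prod[OF sr]) auto
  moreover have "p j \<noteq> 0"
  proof
    assume "p j = 0"
    then have "D * a j = 0" using pa[OF a(3)] by simp
    then show False using D0 a(4) by simp
  qed
  ultimately show "\<exists>p. (\<forall>i\<le>N. p i \<in> poly_over k) \<and> (\<exists>i\<le>N. p i \<noteq> 0) \<and> (\<Sum>i\<le>N. poly (p i) x * v i) = 0"
    using a(2,3) by (intro exI[of _ p]) auto
qed

lemma finite_dimension_iff:
  assumes "subfield k \<Omega>"
  shows "Om.finite_dimension k E \<longleftrightarrow> subspc k E \<and> (\<exists>N. \<not> dim_ge k E {0} (Suc N))"
proof
  assume "Om.finite_dimension k E"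
  then obtain n where "Om.dimension n k E" by (auto simp: Om.finite_dimension_def)
  from dimension_imp(1)[OF assms this] dimension_imp(2)[OF assms this, of "Suc n"]
  show "subspc k E \<and> (\<exists>N. \<not> dim_ge k E {0} (Suc N))" by auto
next
  assume "subspc k E \<and> (\<exists>N. \<not> dim_ge k E {0} (Suc N))"
  then show "Om.finite_dimension k E" using dimension_ex[OF assms] Om.finite_dimensionI by blast
qed

lemma dim_ge_larger_field:
  assumes "dim_ge k' E N n" "k \<subseteq> k'"
  shows "dim_ge k E N n"
proof -
  obtain v where "\<forall>i<n. v i \<in> E" "indep_mod k' N {..<n} v" using assms(1) unfolding dim_ge_def by blast
  with indep_mod_antimono[OF _ order_refl assms(2)] show ?thesis unfolding dim_ge_def by meson
qed

lemma finite_dimension_larger_field: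
  assumes "subfield k \<Omega>" "subfield k' \<Omega>" "k \<subseteq> k'" "Om.finite_dimension k E" "subspc k' E"
  shows "Om.finite_dimension k' E"
  using assms(4,5) dim_ge_larger_field[OF _ assms(3)]
  unfolding finite_dimension_iff[OF assms(1)] finite_dimension_iff[OF assms(2)] by blast

lemma finite_dimension_subspc:
  assumes "subfield k \<Omega>" "Om.finite_dimension k E" "subspc k E'" "E' \<subseteq> E"
  shows "Om.finite_dimension k E'"
  using assms(2-) dim_ge_mono[of k E' "{0}" _ E "{0}"] sr_0[OF sf_sr[OF assms(1)]]
  unfolding finite_dimension_iff[OF assms(1)] by blast

lemma tower:
  assumes "subfield k \<Omega>" "subfield F \<Omega>" "Om.dimension a k F" "Om.dimension b F E"
  shows "Om.dimension (a * b) k E"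
  using Om.telescopic_base[OF assms] .

lemma finite_dimension_tower:
  assumes "subfield k \<Omega>" "subfield F \<Omega>" "Om.finite_dimension k F" "Om.finite_dimension F E"
  shows "Om.finite_dimension k E"
  using tower[OF assms(1,2)] assms(3,4) unfolding Om.finite_dimension_def by blast

lemma finite_dimension_algebraic:
  assumes "subfield k \<Omega>" "subring F \<Omega>" "Om.finite_dimension k F" "x \<in> F"
  shows "x \<in> alg_closure_of k"
  using Om.finite_dimension_imp_algebraic[OF assms] by (simp add: alg_closure_of_def over_def)

lemma finite_ext:
  assumes k: "subfield k \<Omega>" and S: "finite S" "S \<subseteq> alg_closure_of k"
  shows "\<exists>E. subfield E \<Omega> \<and> Om.finite_dimension k E \<and> k \<subseteq> E \<and> S \<subseteq> E"
proof -
  obtain xs where xs: "set xs = S" using S(1) finite_list by blast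
  have alg: "\<And>x. x \<in> set xs \<Longrightarrow> (Om.algebraic over k) x" using S(2) xs by (auto simp: alg_closure_of_def over_def)
  have "subfield (Om.finite_extension k xs) \<Omega>" by (rule Om.finite_extension_is_subfield[OF k _ alg]) auto
  moreover have "Om.finite_dimension k (Om.finite_extension k xs)"
    by (rule Om.finite_extension_finite_dimension(1)[OF k _ alg]) auto
  moreover have "k \<subseteq> Om.finite_extension k xs" using Om.finite_extension_incl[of k xs] by auto
  moreover have "S \<subseteq> Om.finite_extension k xs" using Om.finite_extension_mem[OF sf_sr[OF k], of xs] xs by auto
  ultimately show ?thesis by blast
qed

text \<open>The coefficients of an equation over \<open>L\<close> lie in a finite extension of
  \<open>k\<close>, so degrees multiply in a finite tower.\<close>

lemma alg_closure_of_trans: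
  assumes k: "subfield k \<Omega>" and L: "subfield L \<Omega>" "k \<subseteq> L" "L \<subseteq> alg_closure_of k"
  shows "alg_closure_of L = alg_closure_of k"
proof
  show "alg_closure_of k \<subseteq> alg_closure_of L" by (rule alg_closure_of_mono[OF k L(1,2)])
  show "alg_closure_of L \<subseteq> alg_closure_of k"
  proof
    fix x assume "x \<in> alg_closure_of L"
    then obtain p where p: "p \<in> poly_over L" "p \<noteq> 0" "poly p x = 0" using alg_closure_of_iff[OF L(1)] by blast
    define S where "S = Polynomial.coeff p ` {..Polynomial.degree p}"
    have "S \<subseteq> alg_closure_of k" using p(1) L(3) by (auto simp: S_def poly_over_def)
    then obtain E where E: "subfield E \<Omega>" "Om.finite_dimension k E" "k \<subseteq> E" "S \<subseteq> E"
      using finite_ext[OF k, of S] by (auto simp: S_def)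
    have "Polynomial.coeff p i \<in> E" for i
    proof (cases "Polynomial.coeff p i = 0")
      case True
      then show ?thesis using E(1) by (auto intro: sr_intros)
    next
      case False
      then have "Polynomial.coeff p i \<in> S" using le_degree by (auto simp: S_def)
      then show ?thesis using E(4) by blast
    qed
    then have pE: "p \<in> poly_over E" by (simp add: poly_over_def)
    note se = simple_extension_algebraic[OF E(1) pE p(2,3)]
    have "Om.finite_dimension E (Om.simple_extension E x)" using se(2) Om.finite_dimensionI by blast
    then have fd: "Om.finite_dimension k (Om.simple_extension E x)"
      by (rule finite_dimension_tower[OF k E(1,2)])
    have "x \<in> Om.simple_extension E x"
      using adjoin_ring(3)[OF sf_sr[OF E(1)], of x] unfolding simple_extension_eq_polys[OF E(1)] .
    then show "x \<in> alg_closure_of k" by (rule finite_dimension_algebraic[OF k sf_sr[OF se(1)] fd])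
  qed
qed

section \<open>Function fields, their subfields and base changes\<close>

lemma function_fieldD:
  assumes "function_field k K"
  shows "subfield k \<Omega>" "subfield K \<Omega>" "k \<subseteq> K"
  using assms by (auto simp: function_field_def)

text \<open>Exchange: the powers of \<open>x\<close> satisfy a relation with coefficients in
  \<open>k[x0]\<close>. Read as an equation for \<open>x0\<close> over \<open>k(x)\<close> it makes
  \<open>x0\<close> algebraic over \<open>k(x)\<close>, and degrees multiply in the tower through
  \<open>k(x, x0)\<close>.\<close>

lemma finite_over_adjoin:
  assumes ff: "function_field k K" and x: "x \<in> K" "x \<notin> alg_closure_of k"
  shows "Om.finite_dimension (adjoin k x) K"
proof -
  note kK = function_fieldD[OF ff]
  have sr: "subring k \<Omega>" using kK(1) by (rule sf_sr)
  obtain x0 where x0: "x0 \<in> K" "Om.finite_dimension (adjoin k x0) K"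
    using ff by (auto simp: function_field_def)
  then obtain N where "Om.dimension N (adjoin k x0) K" by (auto simp: Om.finite_dimension_def)
  then have dep: "polydep k K x0 N" by (rule dimension_imp_polydep[OF kK(1)])
  have "\<forall>i\<le>N. x ^ i \<in> K" using x(1) kK(2) by (auto intro: sr_intros)
  then obtain p where p: "\<forall>i\<le>N. p i \<in> poly_over k" "\<exists>i\<le>N. p i \<noteq> 0" "(\<Sum>i\<le>N. poly (p i) x0 * x ^ i) = 0"
    using dep[unfolded polydep_def, rule_format, of "\<lambda>i. x ^ i"] by blast
  \<comment> \<open>The relation is regrouped by powers of \<open>x0\<close>: \<open>q j\<close> is
    the coefficient of \<open>x0 ^ j\<close>, a polynomial in \<open>x\<close>. It does not vanish
    at \<open>x\<close> unless it is zero, as \<open>x\<close> is transcendental.\<close>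
  define q where "q j = (\<Sum>i\<le>N. Polynomial.monom (Polynomial.coeff (p i) j) i)" for j
  have qk: "q j \<in> poly_over k" for j
    unfolding q_def using p(1) by (intro poly_over_sum[OF sr] poly_over_monom[OF sr]) (auto simp: poly_over_def)
  have coeff_q: "Polynomial.coeff (q j) i = (if i \<le> N then Polynomial.coeff (p i) j else 0)" for i j
    by (simp add: q_def coeff_sum)
  define d where "d = Max ((\<lambda>i. Polynomial.degree (p i)) ` {..N})"
  have d: "Polynomial.degree (p i) \<le> d" if "i \<le> N" for i unfolding d_def using that by (intro Max_ge) auto
  define r where "r = (\<Sum>j\<le>d. Polynomial.monom (poly (q j) x) j)"
  have kx: "k \<subseteq> adjoin k x" "x \<in> adjoin k x" by (rule adjoin_props)+
  have sr1: "subring (adjoin k x) \<Omega>" by (rule sf_sr[OF adjoin_props(1)])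
  have "r \<in> poly_over (adjoin k x)" unfolding r_def
    by (intro poly_over_sum[OF sr1] poly_over_monom[OF sr1] poly_in_subring[OF sr1] poly_over_mono[OF qk kx(1)] kx(2))
  moreover have "r \<noteq> 0"
  proof -
    obtain i where i: "i \<le> N" "p i \<noteq> 0" using p(2) by blast
    define j where "j = Polynomial.degree (p i)"
    have "Polynomial.coeff (q j) i \<noteq> 0" using i by (simp add: coeff_q j_def)
    then have "q j \<noteq> 0" by auto
    then have "poly (q j) x \<noteq> 0" using x(2) qk alg_closure_of_iff[OF kK(1)] by blast
    moreover have "Polynomial.coeff r j = poly (q j) x" using d[OF i(1)] by (simp add: r_def coeff_sum j_def)
    ultimately show ?thesis by auto
  qed
  moreover have "poly r x0 = 0"
  proof -
    have "poly r x0 = (\<Sum>j\<le>d. \<Sum>i\<le>N. Polynomial.coeff (p i) j * x ^ i * x0 ^ j)"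
      by (simp add: r_def poly_sum poly_monom q_def sum_distrib_right)
    also have "\<dots> = (\<Sum>i\<le>N. (\<Sum>j\<le>d. Polynomial.coeff (p i) j * x0 ^ j) * x ^ i)"
      by (subst sum.swap) (simp add: sum_distrib_right sum_distrib_left mult_ac)
    also have "\<dots> = (\<Sum>i\<le>N. poly (p i) x0 * x ^ i)"
    proof (intro sum.cong refl)
      fix i assume "i \<in> {..N}"
      then have "Polynomial.degree (p i) \<le> d" using d by simp
      then have "(\<Sum>j\<le>d. Polynomial.coeff (p i) j * x0 ^ j) = poly (p i) x0"
        unfolding poly_altdef by (intro sum.mono_neutral_right) (auto simp: coeff_eq_0)
      then show "(\<Sum>j\<le>d. Polynomial.coeff (p i) j * x0 ^ j) * x ^ i = poly (p i) x0 * x ^ i" by simp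
    qed
    finally show ?thesis using p(3) by simp
  qed
  ultimately have alg: "r \<in> poly_over (adjoin k x)" "r \<noteq> 0" "poly r x0 = 0" by blast+
  note se = simple_extension_algebraic[OF adjoin_props(1) alg]
  define S where "S = Om.simple_extension (adjoin k x) x0"
  note ar = adjoin_ring[OF sr1, where u = x0, folded simple_extension_eq_polys[OF adjoin_props(1)], folded S_def]
  have Sf: "subfield S \<Omega>" using se(1) by (simp only: S_def)
  have x0S: "adjoin k x0 \<subseteq> S"
    by (rule adjoin_props(4)[OF Sf order_trans[OF kx(1) ar(2)] ar(3)])
  have kxK: "adjoin k x \<subseteq> K" by (rule adjoin_props(4)[OF kK(2,3) x(1)])
  have SK: "S \<subseteq> K"
  proof
    fix y assume "y \<in> S"
    then obtain p where p: "y = poly p x0" "p \<in> poly_over (adjoin k x)"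
      using simple_extension_eq_polys[OF adjoin_props(1), of k x x0] unfolding S_def by blast
    show "y \<in> K"
      unfolding p(1) by (rule poly_in_subring[OF sf_sr[OF kK(2)] poly_over_mono[OF p(2) kxK] x0(1)])
  qed
  have "subspc S K" by (rule subspc_subring[OF sf_sr[OF kK(2)] SK])
  then have 1: "Om.finite_dimension S K"
    by (rule finite_dimension_larger_field[OF adjoin_props(1) Sf x0S x0(2)])
  have 2: "Om.finite_dimension (adjoin k x) S" using se(2) Om.finite_dimensionI unfolding S_def by blast
  show ?thesis by (rule finite_dimension_tower[OF adjoin_props(1) Sf 2 1])
qed

lemma function_field_ffield:
  assumes "function_field k K"
  shows "ffield k K"
proof (rule ffield.intro)
  show "\<exists>N. polydep k K x N" if "x \<in> K" "x \<notin> alg_closure_of k" for x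
    using finite_over_adjoin[OF assms that] dimension_imp_polydep[OF function_fieldD(1)[OF assms]]
    by (auto simp: Om.finite_dimension_def)
qed (use function_fieldD[OF assms] in auto)

lemma transcendental_iff: "Om.transcendental k x \<longleftrightarrow> x \<notin> alg_closure_of k"
  by (simp add: alg_closure_of_def)

lemma function_field_subfield:
  assumes ff: "function_field k K" and M: "subfield M \<Omega>" "k \<subseteq> M" "M \<subseteq> K" "x \<in> M" "x \<notin> alg_closure_of k"
  shows "function_field k M"
proof -
  have "adjoin k x \<subseteq> M" using M by (intro adjoin_props(4))
  then have sp: "subspc (adjoin k x) M" using M by (intro subspc_subring sf_sr)
  have fd: "Om.finite_dimension (adjoin k x) K" by (rule finite_over_adjoin[OF ff subsetD[OF M(3,4)] M(5)])
  have "Om.finite_dimension (adjoin k x) M"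
    by (rule finite_dimension_subspc[OF adjoin_props(1) fd sp M(3)])
  then show ?thesis unfolding function_field_def transcendental_iff
    by (intro conjI bexI[of _ x] function_fieldD(1)[OF ff] M)
qed

text \<open>A basis of \<open>K\<close> over \<open>k(x)\<close> is algebraic over
  \<open>L(x)\<close>, so it lies in a finite extension of \<open>L(x)\<close>, which then contains
  all of \<open>L K\<close>.\<close>

lemma function_field_base_change:
  assumes ff: "function_field k K" and L: "subfield L \<Omega>" "k \<subseteq> L" "L \<subseteq> alg_closure_of k"
    and KL: "subfield (lspan L K) \<Omega>"
  shows "function_field L (lspan L K)"
proof -
  note kK = function_fieldD[OF ff]
  obtain x where x: "x \<in> K" "x \<notin> alg_closure_of k" "Om.finite_dimension (adjoin k x) K"
    using ff by (auto simp: function_field_def transcendental_iff)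
  have one: "1 \<in> K" "1 \<in> L" using kK L by (auto intro: sr_intros)
  have incl: "K \<subseteq> lspan L K" "L \<subseteq> lspan L K" using one by (auto dest: lspan_incl lspan_incl')
  obtain n where n: "Om.dimension n (adjoin k x) K" using x(3) by (auto simp: Om.finite_dimension_def)
  obtain b where b: "\<And>i. i < n \<Longrightarrow> b i \<in> K" "\<And>y. y \<in> K \<Longrightarrow> \<exists>c. (\<forall>i<n. c i \<in> adjoin k x) \<and> y = (\<Sum>i<n. c i * b i)"
    using dimension_imp(3)[OF adjoin_props(1) n] by blast
  have mono: "adjoin k x \<subseteq> adjoin L x"
    using adjoin_props[where k=L and x=x] L by (intro adjoin_props(4)) auto
  have "b ` {..<n} \<subseteq> alg_closure_of (adjoin L x)"
  proof -
    have "b ` {..<n} \<subseteq> K" using b(1) by auto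
    also have "K \<subseteq> alg_closure_of (adjoin k x)"
      using finite_dimension_algebraic[OF adjoin_props(1) sf_sr[OF kK(2)] x(3)] by blast
    also have "\<dots> \<subseteq> alg_closure_of (adjoin L x)" by (intro alg_closure_of_mono adjoin_props(1) mono)
    finally show ?thesis .
  qed
  then obtain E where E: "subfield E \<Omega>" "Om.finite_dimension (adjoin L x) E" "adjoin L x \<subseteq> E" "b ` {..<n} \<subseteq> E"
    using finite_ext[OF adjoin_props(1)[of L x], of "b ` {..<n}"] by auto
  have Er: "subring E \<Omega>" using E(1) by (rule sf_sr)
  have "K \<subseteq> E"
  proof
    fix y assume "y \<in> K"
    then obtain c where "\<forall>i<n. c i \<in> adjoin k x" "y = (\<Sum>i<n. c i * b i)" using b(2) by blast
    then show "y \<in> E" using mono E(3,4) by (auto intro!: sr_sum[OF Er] sr_mult[OF Er])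
  qed
  moreover have "L \<subseteq> E" using E(3) adjoin_props(2)[of L x] by blast
  ultimately have KLE: "lspan L K \<subseteq> E" using Er by (intro lspan_minimal subspc_subring)
  have "adjoin L x \<subseteq> lspan L K" using incl x(1) KL by (intro adjoin_props(4)) auto
  then have "subspc (adjoin L x) (lspan L K)" using KL by (intro subspc_subring sf_sr)
  then have "Om.finite_dimension (adjoin L x) (lspan L K)"
    by (rule finite_dimension_subspc[OF adjoin_props(1) E(2) _ KLE])
  then show ?thesis
    unfolding function_field_def transcendental_iff alg_closure_of_trans[OF kK(1) L]
    by (intro conjI bexI[of _ x] L(1) KL incl(2) x(2) subsetD[OF incl(1) x(1)])
qed

text \<open>\<open>x\<close> is a root of \<open>q(X) - q(x)\<close>, so \<open>k(x)\<close> has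
  degree at most \<open>degree q\<close> over \<open>k(q(x))\<close>, and the tower gives the
  product.\<close>

lemma polydep_poly:
  assumes ff: "function_field k K" and x: "x \<in> K" "x \<notin> alg_closure_of k"
    and n: "Om.dimension n (adjoin k x) K" and q: "q \<in> poly_over k"
  shows "polydep k K (poly q x) (Polynomial.degree q * n)"
proof -
  note kK = function_fieldD[OF ff]
  have sr: "subring k \<Omega>" using kK(1) by (rule sf_sr)
  define w where "w = poly q x"
  show ?thesis
  proof (cases "Polynomial.degree q = 0")
    \<comment> \<open>For a constant \<open>q\<close> the polynomial \<open>X - c\<close> vanishes
      at the value, so a single vector is already dependent in the sense of
      \<open>polydep\<close>.\<close>
    case True
    then obtain c where c: "q = [:c:]" by (auto elim: degree_eq_zeroE)
    have ck: "c \<in> k" using q c by simp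
    have "[:-c, 1:] \<in> poly_over k" using ck sr by (auto intro: sr_intros poly_over_0)
    then show ?thesis unfolding polydep_def using c by (auto intro!: exI[of _ "\<lambda>_. [:-c, 1:]"])
  next
    case False
    note a = adjoin_props[where k=k and x=w]
    have sra: "subring (adjoin k w) \<Omega>" using a(1) by (rule sf_sr)
    define p where "p = q + [:- w:]"
    have "p \<in> poly_over (adjoin k w)" unfolding p_def
      using poly_over_mono[OF q a(2)] a(3) sr_0[OF sra] sr_minus[OF sra] by (intro poly_over_add[OF sra]) auto
    moreover have dp: "Polynomial.degree p = Polynomial.degree q"
      unfolding p_def using False degree_add_eq_left[of "[:- w:]" q] by simp
    then have "p \<noteq> 0" using False by auto
    moreover have "poly p x = 0" by (simp add: p_def w_def)
    ultimately obtain m where m: "subfield (Om.simple_extension (adjoin k w) x) \<Omega>"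
      "m \<le> Polynomial.degree q" "Om.dimension m (adjoin k w) (Om.simple_extension (adjoin k w) x)"
      using simple_extension_algebraic[OF a(1)] dp by metis
    note ar = adjoin_ring[OF sra, where u = x, folded simple_extension_eq_polys[OF a(1)]]
    note ax = adjoin_props[where k=k and x=x]
    have "w \<in> adjoin k x" unfolding w_def
      using poly_in_subring[OF sf_sr[OF ax(1)] poly_over_mono[OF q ax(2)] ax(3)] .
    then have "adjoin k w \<subseteq> adjoin k x" using ax by (intro adjoin_props(4))
    then have "Om.simple_extension (adjoin k w) x \<subseteq> adjoin k x"
      using ax by (intro ar(4) sf_sr)
    moreover have "adjoin k x \<subseteq> Om.simple_extension (adjoin k w) x"
      using ar(2,3) a(2) m(1) by (intro adjoin_props(4)) auto
    ultimately have "Om.dimension (m * n) (adjoin k w) K"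
      using tower[OF a(1) m(1) m(3)] n by auto
    then have "polydep k K w (m * n)" by (rule dimension_imp_polydep[OF kK(1)])
    then show ?thesis unfolding w_def by (rule polydep_mono) (use m(2) sr_0[OF sr] in auto)
  qed
qed

subsection \<open>Weak approximation\<close>

context dplace
begin

lemma ord_one_plus:
  assumes "w \<in> K" "w \<noteq> 0"
  shows "ord_at R w > 0 \<Longrightarrow> 1 + w \<noteq> 0" "ord_at R w > 0 \<Longrightarrow> ord_at R (1 + w) = 0"
    "ord_at R w < 0 \<Longrightarrow> 1 + w \<noteq> 0" "ord_at R w < 0 \<Longrightarrow> ord_at R (1 + w) = ord_at R w"
  using ord_add_eq[of 1 w] ord_add_eq[of w 1] assms K by (auto simp: add.commute intro: sr_intros)

end

context ffield
begin

text \<open>Distinct places are incomparable, as only the whole field lies properly above a place.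
  The quotient of the witnesses for the two non-inclusions has the required signs.\<close>

lemma separate_two:
  assumes P: "P \<in> places k K" and Q: "Q \<in> places k K" and ne: "P \<noteq> Q"
  shows "\<exists>b\<in>K. b \<noteq> 0 \<and> ord_at P b < 0 \<and> ord_at Q b > 0"
proof -
  have main: "\<exists>a\<in>K. a \<noteq> 0 \<and> ord_at P a \<ge> 0 \<and> ord_at Q a < 0"
    if P: "P \<in> places k K" and Q: "Q \<in> places k K" and ne: "P \<noteq> Q" for P Q
  proof -
    interpret P: dplace P K by (rule place_dplace[OF P])
    interpret Q: dplace Q K by (rule place_dplace[OF Q])
    have "\<not> P \<subseteq> Q" using P.maximal[of Q] placeD[OF Q] ne by auto
    then obtain a where a: "a \<in> P" "a \<notin> Q" by blast
    then have "a \<in> K" "a \<noteq> 0" using P.RK sr_0[OF Q.Rr] by auto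
    then show ?thesis using a P.R_iff Q.R_iff by (intro bexI[of _ a]) auto
  qed
  interpret P: dplace P K by (rule place_dplace[OF P])
  interpret Q: dplace Q K by (rule place_dplace[OF Q])
  obtain a where a: "a \<in> K" "a \<noteq> 0" "ord_at P a \<ge> 0" "ord_at Q a < 0" using main[OF P Q ne] by blast
  obtain b where b: "b \<in> K" "b \<noteq> 0" "ord_at Q b \<ge> 0" "ord_at P b < 0" using main[OF Q P] ne by blast
  have "b / a \<in> K" using a b K by (auto intro: sr_intros)
  then show ?thesis using a b by (intro bexI[of _ "b / a"]) (auto simp: P.ord_divide Q.ord_divide)
qed

text \<open>The function found for \<open>T\<close> is corrected at the new place \<open>Q\<close>
  according to its order there, with the help of a function \<open>b\<close> that separates
  \<open>P\<close> from \<open>Q\<close>.\<close>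

lemma separate_finite:
  assumes "finite T" "T \<subseteq> places k K" and P: "P \<in> places k K" "P \<notin> T"
  shows "\<exists>w\<in>K. w \<noteq> 0 \<and> ord_at P w < 0 \<and> (\<forall>Q\<in>T. ord_at Q w > 0)"
  using assms
proof (induction T)
  case empty
  interpret P: dplace P K by (rule place_dplace[OF P(1)])
  obtain t where t: "t \<in> K" "t \<noteq> 0" "ord_at P t = 1" by (rule P.obtain_uniformizer) blast
  then show ?case using K by (intro bexI[of _ "inverse t"]) (auto simp: P.ord_inverse sf_inverse)
next
  case (insert Q T)
  then obtain w where w: "w \<in> K" "w \<noteq> 0" "ord_at P w < 0" "\<And>R. R \<in> T \<Longrightarrow> ord_at R w > 0" by auto
  have Q: "Q \<in> places k K" "P \<noteq> Q" using insert by auto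
  interpret P: dplace P K by (rule place_dplace[OF P(1)])
  interpret Q: dplace Q K by (rule place_dplace[OF Q(1)])
  have dp: "dplace R K" if "R \<in> T" for R using insert.prems(1) that by (auto intro: place_dplace)
  obtain b where b: "b \<in> K" "b \<noteq> 0" "ord_at P b < 0" "ord_at Q b > 0" using separate_two[OF P(1) Q] by blast
  \<comment> \<open>Large enough for the zeros of \<open>w ^ N\<close> at the places of
    \<open>T\<close> to outweigh the poles of \<open>b\<close> there.\<close>
  define N where "N = Suc (nat (\<Sum>R\<in>T. \<bar>ord_at R b\<bar>))"
  have big: "int N * ord_at R w + ord_at R b > 0" if "R \<in> T" for R
  proof -
    have "\<bar>ord_at R b\<bar> \<le> (\<Sum>R\<in>T. \<bar>ord_at R b\<bar>)" using insert.hyps(1) that by (intro member_le_sum) auto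
    moreover have "int N * 1 \<le> int N * ord_at R w" using w(4)[OF that] by (intro mult_left_mono) auto
    ultimately show ?thesis by (simp add: N_def)
  qed
  have sr: "subring K \<Omega>" using K by (rule sf_sr)
  have wN: "w ^ N \<in> K" "w ^ N \<noteq> 0" using w sr by (auto intro: sr_intros)
  have N0: "N > 0" by (simp add: N_def)
  consider "ord_at Q w > 0" | "ord_at Q w = 0" | "ord_at Q w < 0" by linarith
  then show ?case
  proof cases
    case 1
    then show ?thesis using w by (intro bexI[of _ w]) auto
  next
    case 2
    show ?thesis
    proof (intro bexI[of _ "w ^ N * b"] conjI ballI)
      show "w ^ N * b \<noteq> 0" "w ^ N * b \<in> K" using wN b sr by (auto intro: sr_intros)
      have "ord_at P (w ^ N * b) = int N * ord_at P w + ord_at P b"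
        using wN b w by (simp add: P.ord_mult P.ord_power)
      moreover have "int N * ord_at P w < 0" using N0 w(3) by (simp add: mult_pos_neg)
      ultimately show "ord_at P (w ^ N * b) < 0" using b by simp
      fix R assume "R \<in> insert Q T"
      then show "ord_at R (w ^ N * b) > 0"
      proof
        assume "R = Q"
        then show ?thesis using wN b w 2 by (simp add: Q.ord_mult Q.ord_power)
      next
        assume R: "R \<in> T"
        interpret R: dplace R K by (rule dp[OF R])
        show ?thesis using big[OF R] wN b w by (simp add: R.ord_mult R.ord_power)
      qed
    qed
  next
    case 3
    have ordP: "ord_at P (w ^ N) < 0" using N0 w by (simp add: P.ord_power mult_pos_neg)
    have ordQ: "ord_at Q (w ^ N) < 0" using N0 w 3 by (simp add: Q.ord_power mult_pos_neg)
    have w1: "1 + w ^ N \<noteq> 0" "1 + w ^ N \<in> K" using P.ord_one_plus(3)[OF wN ordP] wN sr by (auto intro: sr_intros)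
    \<comment> \<open>This has order zero at the poles of \<open>w\<close>, in particular at
      \<open>P\<close> and \<open>Q\<close>, and the order of \<open>w ^ N\<close> at the places of
      \<open>T\<close>. Multiplied by \<open>b\<close> it takes the signs of \<open>b\<close> at
      \<open>P\<close> and \<open>Q\<close>.\<close>
    define y where "y = w ^ N / (1 + w ^ N)"
    have y: "y \<in> K" "y \<noteq> 0" using wN w1 K by (auto simp: y_def intro: sr_intros)
    have yP: "ord_at P y = 0" unfolding y_def using wN w1 P.ord_one_plus(4)[OF wN ordP] P.ord_divide by simp
    have yQ: "ord_at Q y = 0" unfolding y_def using wN w1 Q.ord_one_plus(4)[OF wN ordQ] Q.ord_divide by simp
    show ?thesis
    proof (intro bexI[of _ "y * b"] conjI ballI)
      show "y * b \<noteq> 0" using y b by simp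
      show "y * b \<in> K" using y b by (intro sr_mult[OF sr])
      show "ord_at P (y * b) < 0" using y b yP by (simp add: P.ord_mult)
      fix R assume "R \<in> insert Q T"
      then show "ord_at R (y * b) > 0"
      proof
        assume "R = Q"
        then show ?thesis using y b yQ by (simp add: Q.ord_mult)
      next
        assume R: "R \<in> T"
        interpret R: dplace R K by (rule dp[OF R])
        have "ord_at R (w ^ N) > 0" using N0 w(1,2) w(4)[OF R] by (simp add: R.ord_power)
        then have "ord_at R y = ord_at R (w ^ N)"
          unfolding y_def using wN w1 R.ord_one_plus(2)[OF wN] R.ord_divide by simp
        then show ?thesis using big[OF R] y b w by (simp add: R.ord_mult R.ord_power)
      qed
    qed
  qed
qed

text \<open>If \<open>w\<close> has a pole at \<open>P\<close> and zeros on \<open>T\<close>, then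
  \<open>w / (1 + w)\<close> is a unit at \<open>P\<close> and keeps the zeros on
  \<open>T\<close>.\<close>

lemma approximation:
  assumes "finite T" "T \<subseteq> places k K" and P: "P \<in> places k K" "P \<notin> T"
  shows "\<exists>v\<in>K. v \<noteq> 0 \<and> ord_at P v = 0 \<and> (\<forall>Q\<in>T. ord_at Q v > 0)"
proof -
  obtain w where w: "w \<in> K" "w \<noteq> 0" "ord_at P w < 0" "\<And>R. R \<in> T \<Longrightarrow> ord_at R w > 0"
    using separate_finite[OF assms] by blast
  interpret P: dplace P K by (rule place_dplace[OF P(1)])
  have w1: "1 + w \<noteq> 0" "1 + w \<in> K" using P.ord_one_plus(3)[OF w(1,2,3)] w K by (auto intro: sr_intros)
  show ?thesis
  proof (intro bexI[of _ "w / (1 + w)"] conjI ballI)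
    show "w / (1 + w) \<noteq> 0" "w / (1 + w) \<in> K" using w w1 K by (auto intro: sr_intros)
    show "ord_at P (w / (1 + w)) = 0" using w w1 P.ord_one_plus(4)[OF w(1,2,3)] by (simp add: P.ord_divide)
    fix R assume R: "R \<in> T"
    then interpret R: dplace R K using assms(2) by (auto intro: place_dplace)
    show "ord_at R (w / (1 + w)) > 0" using w(1,2) w(4)[OF R] w1 R.ord_one_plus(2)[OF w(1,2)] by (simp add: R.ord_divide)
  qed
qed

text \<open>There are at most \<open>[K : k(a)]\<close> zeros. For more of them, functions
  \<open>v i\<close> that are units at one and vanish at the others admit a relation over
  \<open>k[a]\<close> with a nonzero constant term at some \<open>j\<close>; at the place
  \<open>h j\<close> this constant would lie in the maximal ideal.\<close>

lemma finite_zeros: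
  assumes a: "a \<in> K" "a \<noteq> 0"
  shows "finite {R \<in> places k K. a \<in> max_ideal R}"
proof (cases "a \<in> alg_closure_of k")
  case True
  have "a \<notin> max_ideal R" if "R \<in> places k K" for R
    using max_ideal_transcendental[OF k placeD(1,2)[OF that]] True a by blast
  then have "{R \<in> places k K. a \<in> max_ideal R} = {}" by blast
  then show ?thesis by (simp only: finite.emptyI)
next
  case False
  then obtain N where N: "polydep k K a N" using fin a by blast
  show ?thesis
  proof (rule ccontr)
    assume "infinite {R \<in> places k K. a \<in> max_ideal R}"
    then obtain T where T: "T \<subseteq> {R \<in> places k K. a \<in> max_ideal R}" "card T = Suc N" "finite T"
      using infinite_arbitrarily_large by blast
    obtain h where h: "bij_betw h {..<Suc N} T"
      using ex_bij_betw_nat_finite[OF T(3)] T(2) by (auto simp: lessThan_atLeast0)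
    have hT: "h i \<in> places k K" "a \<in> max_ideal (h i)" "h i \<in> T" if "i \<le> N" for i
    proof -
      show "h i \<in> T" using bij_betwE[OF h] that by auto
      then show "h i \<in> places k K" "a \<in> max_ideal (h i)" using T(1) by auto
    qed
    have "\<exists>v\<in>K. v \<noteq> 0 \<and> ord_at (h i) v = 0 \<and> (\<forall>Q\<in>T-{h i}. ord_at Q v > 0)" if "i \<le> N" for i
      by (rule approximation) (use T hT[OF that] in auto)
    then obtain v where v: "\<And>i. i \<le> N \<Longrightarrow> v i \<in> K \<and> v i \<noteq> 0 \<and> ord_at (h i) (v i) = 0 \<and> (\<forall>Q\<in>T-{h i}. ord_at Q (v i) > 0)"
      by metis
    obtain p j where p: "\<And>i. i \<le> N \<Longrightarrow> p i \<in> poly_over k" "j \<le> N" "Polynomial.coeff (p j) 0 \<noteq> 0"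
      "(\<Sum>i\<le>N. poly (p i) a * v i) = 0"
      using polydep_normal[OF N a(2), of v] v by blast
    define R where "R = h j"
    have R: "R \<in> places k K" "a \<in> max_ideal R" using hT[OF p(2)] by (auto simp: R_def)
    interpret R: dplace R K by (rule place_dplace[OF R(1)])
    note pl = placeD[OF R(1)]
    have aR: "a \<in> R" using R(2) by (simp add: max_ideal_iff)
    have pR: "poly (p i) a \<in> R" if "i \<le> N" for i
      by (rule poly_in_subring[OF pl(1) poly_over_mono[OF p(1)[OF that] pl(2)] aR])
    have others: "poly (p i) a * v i \<in> max_ideal R" if i: "i \<in> {..N} - {j}" for i
    proof -
      have "h i \<noteq> h j" using h i p(2) by (auto simp: bij_betw_def inj_on_def less_Suc_eq_le)
      then have "ord_at R (v i) > 0" using v[of i] i hT(3)[OF p(2)] by (auto simp: R_def)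
      then have "v i \<in> max_ideal R" using R.max_ideal_ord v[of i] i by auto
      then show ?thesis using pR i by (intro max_ideal_mult[OF pl(1)]) auto
    qed
    have "poly (p j) a * v j = - (\<Sum>i\<in>{..N}-{j}. poly (p i) a * v i)"
      using p(4) sum.remove[of "{..N}" j "\<lambda>i. poly (p i) a * v i"] p(2) by (simp add: eq_neg_iff_add_eq_0)
    also have "\<dots> \<in> max_ideal R"
      using others by (intro max_ideal_minus[OF pl(1)] max_ideal_sum[OF pl(5) K])
    finally have 1: "poly (p j) a * v j \<in> max_ideal R" .
    have "inverse (v j) \<in> R" using v[OF p(2)] R.R_iff[of "inverse (v j)"] K by (auto simp: R_def R.ord_inverse[unfolded R_def] sf_inverse)
    then have "inverse (v j) * (poly (p j) a * v j) \<in> max_ideal R" using 1 by (rule max_ideal_mult[OF pl(1)])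
    moreover have "inverse (v j) * (poly (p j) a * v j) = poly (p j) a" using v[OF p(2)] by (simp add: field_simps)
    ultimately have 2: "poly (p j) a \<in> max_ideal R" by simp
    define c where "c = Polynomial.coeff (p j) 0"
    have pp: "p j = pCons c (poly_shift 1 (p j))"
      by (intro poly_eqI) (auto simp: c_def coeff_pCons coeff_poly_shift split: nat.splits)
    have e: "poly (p j) a = c + a * poly (poly_shift 1 (p j)) a"
      using arg_cong[OF pp, of "\<lambda>p. poly p a"] by simp
    have "poly_shift 1 (p j) \<in> poly_over k" using p(1)[OF p(2)] by (simp add: poly_over_def coeff_poly_shift)
    then have "poly (poly_shift 1 (p j)) a \<in> R" by (rule poly_in_subring[OF pl(1) poly_over_mono[OF _ pl(2)] aR])
    then have "poly (poly_shift 1 (p j)) a * a \<in> max_ideal R" using R(2) by (rule max_ideal_mult[OF pl(1)])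
    then have "poly (p j) a + - (poly (poly_shift 1 (p j)) a * a) \<in> max_ideal R"
      by (intro max_ideal_add[OF pl(5) K] max_ideal_minus[OF pl(1)] 2)
    then have cm: "c \<in> max_ideal R" using e by (simp add: mult.commute)
    have "c \<in> k" using p(1)[OF p(2)] by (simp add: c_def poly_over_def)
    then have "inverse c \<in> R" using pl(2) sf_inverse[OF k] by blast
    with cm p(3) show False by (simp add: max_ideal_iff c_def)
  qed
qed

subsection \<open>Degrees of places\<close>

lemma residue_dim_finite:
  assumes R: "R \<in> places k K"
  shows "\<exists>N. \<not> dim_ge k R (max_ideal R) (Suc N)"
proof -
  note pl = placeD[OF R]
  obtain x where x: "x \<in> max_ideal R" "x \<noteq> 0" using place_not_field[OF R] by blast
  have xR: "x \<in> R" using x by (simp add: max_ideal_iff)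
  obtain N where N: "polydep k K x N"
    using fin[of x] max_ideal_transcendental[OF k pl(1,2) x] xR pl(3) by blast
  have "\<not> dim_ge k R (max_ideal R) (Suc N)"
  proof (rule not_dim_ge_step[OF N x(2) k pl(3)])
    fix c q v assume a: "\<And>i. i \<le> N \<Longrightarrow> c i \<in> k" "\<And>i. i \<le> N \<Longrightarrow> q i \<in> poly_over k"
       "\<And>i. i \<le> N \<Longrightarrow> v i \<in> R" "(\<Sum>i\<le>N. c i * v i) = x * (\<Sum>i\<le>N. poly (q i) x * v i)"
    have "(\<Sum>i\<le>N. poly (q i) x * v i) \<in> R"
      using a xR by (intro sr_sum sr_mult pl(1) poly_in_subring poly_over_mono[OF _ pl(2)]) auto
    then have "(\<Sum>i\<le>N. poly (q i) x * v i) * x \<in> max_ideal R" using x(1) by (rule max_ideal_mult[OF pl(1)])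
    then show "(\<Sum>i\<le>N. c i * v i) \<in> max_ideal R" unfolding a(4) by (simp add: mult.commute)
  qed
  then show ?thesis by blast
qed

text \<open>The residue field in the definition is a quotient ring of cosets. A family that is a
  basis modulo the maximal ideal is carried to it by the residue map, and from here on degrees are
  plain dimensions inside \<open>K\<close>.\<close>

lemma place_degree_dim:
  assumes R: "R \<in> places k K"
  shows "dim_ge k R (max_ideal R) (place_degree k R)" "\<not> dim_ge k R (max_ideal R) (Suc (place_degree k R))"
proof -
  note pl = placeD[OF R]
  define I where "I = max_ideal R"
  obtain n where n: "dim_ge k R I n" "\<not> dim_ge k R I (Suc n)"
    using residue_dim_finite[OF R] not_dim_ge_ex unfolding I_def by blast
  obtain v where v: "\<And>i. i < n \<Longrightarrow> v i \<in> R" "indep_mod k I {..<n} v" using n(1) unfolding dim_ge_def by blast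
  define A where "A = \<Omega>\<lparr>carrier := R\<rparr>"
  have A [simp]: "carrier A = R" "x \<otimes>\<^bsub>A\<^esub> y = x * y" "x \<oplus>\<^bsub>A\<^esub> y = x + y" "\<zero>\<^bsub>A\<^esub> = 0" "\<one>\<^bsub>A\<^esub> = 1" for x y
    by (simp_all add: A_def)
  interpret A: ring A unfolding A_def by (rule Om.subring_is_ring[OF pl(1)])
  have A_inv: "\<ominus>\<^bsub>A\<^esub> x = - x" if "x \<in> R" for x
    using that sr_minus[OF pl(1) that] by (intro A.minus_equality) auto
  have A_minus: "x \<ominus>\<^bsub>A\<^esub> y = x - y" if "x \<in> R" "y \<in> R" for x y
    using that by (simp add: A.minus_eq A_inv)
  have I_R: "I \<subseteq> R" by (auto simp: I_def max_ideal_iff)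
  have sg: "subgroup I (add_monoid A)"
  proof (rule A.add.subgroupI)
    show "I \<subseteq> carrier A" "I \<noteq> {}" using I_R max_ideal_0[OF pl(1)] by (auto simp: I_def)
    show "\<ominus>\<^bsub>A\<^esub> a \<in> I" if "a \<in> I" for a
      using that A_inv I_R max_ideal_minus[OF pl(1)] by (auto simp: I_def subset_iff)
    show "a \<oplus>\<^bsub>A\<^esub> b \<in> I" if "a \<in> I" "b \<in> I" for a b
      using that max_ideal_add[OF pl(5) K] by (simp add: I_def)
  qed
  have idl: "ideal I A"
  proof (rule idealI[OF A.ring_axioms sg])
    fix a x assume "a \<in> I" "x \<in> carrier A"
    then have "x * a \<in> I" using max_ideal_mult[OF pl(1)] by (simp add: I_def)
    then show "x \<otimes>\<^bsub>A\<^esub> a \<in> I" "a \<otimes>\<^bsub>A\<^esub> x \<in> I" by (simp_all add: mult.commute)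
  qed
  interpret I: ideal I A by (rule idl)
  define kappa where "kappa = A Quot I"
  define h where "h = (\<lambda>a. I +>\<^bsub>A\<^esub> a)"
  interpret S: ring kappa unfolding kappa_def by (rule I.quotient_is_ring)
  interpret h: ring_hom_ring A kappa h
    unfolding kappa_def h_def by (rule I.rcos_ring_hom_ring)
  have h_eq: "h x = h y \<longleftrightarrow> x - y \<in> I" if "x \<in> R" "y \<in> R" for x y
    using A.quotient_eq_iff_same_a_r_cos[OF idl, of x y] that A_minus by (simp add: h_def)
  have h_surj: "carrier kappa = h ` R"
    by (auto simp: kappa_def h_def FactRing_def A_RCOSETS_def')
  have kA: "subfield k A"
    by (rule A.subfield_iff(1)) (use Om.subfield_iff(2)[OF k] pl(2) in \<open>simp_all add: A_def\<close>)
  have "h 1 \<noteq> h 0" using h_eq[of 1 0] sr_0[OF pl(1)] sr_1[OF pl(1)] by (simp add: I_def)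
  then have "\<one>\<^bsub>kappa\<^esub> \<noteq> \<zero>\<^bsub>kappa\<^esub>" using h.hom_one h.hom_zero by simp
  then have hk: "subfield (h ` k) kappa" by (rule h.img_is_subfield(2)[OF kA])
  have Span_h: "ring.Span kappa (h ` k) (map h us) = h ` Om.Span k us" if "set us \<subseteq> R" for us
    using h.Span_hom[of k us] that pl(2) Om.Span_consistent[OF pl(1)] by (simp add: A_def)
  have Span_R: "Om.Span k us \<subseteq> R" if "set us \<subseteq> R" for us
    using that pl(2) by (auto simp: Span_iff[OF k] subset_iff intro!: sr_sum[OF pl(1)] sr_mult[OF pl(1)])
  have ind: "ring.independent kappa (h ` k) (map h (map v js))" if "distinct js" "set js \<subseteq> {..<n}" for js
    using that
  proof (induction js)
    case Nil
    then show ?case using S.li_Nil by simp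
  next
    case (Cons j js)
    have vR: "set (map v js) \<subseteq> R" using Cons.prems v(1) by auto
    have j: "j < n" "j \<notin> set js" "distinct js" "set js \<subseteq> {..<n}" using Cons.prems by auto
    have "h (v j) \<notin> h ` Om.Span k (map v js)"
    proof
      assume "h (v j) \<in> h ` Om.Span k (map v js)"
      then obtain s where s: "s \<in> Om.Span k (map v js)" "h (v j) = h s" by blast
      then have vs: "v j - s \<in> I" using h_eq v(1)[OF j(1)] Span_R[OF vR] by blast
      obtain c where c: "\<And>i. i < length js \<Longrightarrow> c i \<in> k" "s = (\<Sum>i<length js. c i * v (js ! i))"
        using s(1) by (auto simp: Span_iff[OF k])
      have bij: "bij_betw ((!) js) {..<length js} (set js)" using j(3) by (intro bij_betw_nth) auto
      define d where "d x = (if x = j then 1 else if x \<in> set js then - c (the_inv_into {..<length js} ((!) js) x) else 0)" for x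
      have "(\<Sum>x<n. d x * v x) = (\<Sum>x\<in>insert j (set js). d x * v x)"
        by (rule sum.mono_neutral_right) (use j in \<open>auto simp: d_def\<close>)
      also have "\<dots> = v j + (\<Sum>x\<in>set js. d x * v x)" using j(2) by (simp add: d_def)
      also have "(\<Sum>x\<in>set js. d x * v x) = (\<Sum>i<length js. d (js ! i) * v (js ! i))"
        by (rule sum.reindex_bij_betw[OF bij, symmetric])
      also have "\<dots> = (\<Sum>i<length js. - c i * v (js ! i))"
      proof (intro sum.cong refl)
        fix i assume i: "i \<in> {..<length js}"
        then have "js ! i \<in> set js" by simp
        moreover have "the_inv_into {..<length js} ((!) js) (js ! i) = i"
          using bij i by (intro the_inv_into_f_f) (auto simp: bij_betw_def)
        ultimately show "d (js ! i) * v (js ! i) = - c i * v (js ! i)" using j(2) by (auto simp: d_def)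
      qed
      finally have "(\<Sum>x<n. d x * v x) = v j - s" by (simp add: c(2) sum_negf)
      moreover have "d x \<in> k" if "x < n" for x
      proof -
        have "the_inv_into {..<length js} ((!) js) x < length js" if "x \<in> set js"
          using bij_betwE[OF bij_betw_the_inv_into[OF bij]] that by auto
        then show ?thesis using c(1) sf_sr[OF k] by (auto simp: d_def intro: sr_intros)
      qed
      ultimately have "d j = 0" using indep_modD[OF v(2), of d j] vs j(1) by auto
      then show False by (simp add: d_def)
    qed
    then show ?case
      using Cons.IH[OF j(3,4)] Span_h[OF vR] v(1)[OF j(1)] h_surj by (auto intro!: S.li_Cons)
  qed
  have "ring.Span kappa (h ` k) (map h (map v [0..<n])) = carrier kappa"
  proof -
    have vR: "set (map v [0..<n]) \<subseteq> R" using v(1) by auto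
    have "h z \<in> h ` Om.Span k (map v [0..<n])" if z: "z \<in> R" for z
    proof -
      define w where "w i = (if i < n then v i else z)" for i
      have "\<forall>i<Suc n. w i \<in> R" using z v(1) by (simp add: w_def)
      then have "\<not> indep_mod k I {..<Suc n} w"
        using n(2) unfolding dim_ge_def by blast
      then obtain c i where c: "\<And>i. i < Suc n \<Longrightarrow> c i \<in> k" "(\<Sum>i<Suc n. c i * w i) \<in> I" "i < Suc n" "c i \<noteq> 0"
        unfolding indep_mod_def by auto
      have s: "(\<Sum>i<n. c i * v i) + c n * z \<in> I" using c(2) by (simp add: w_def)
      have cn: "c n \<noteq> 0"
      proof
        assume 0: "c n = 0"
        then have "i < n" using c(3,4) by (cases "i = n") auto
        then show False using indep_modD[OF v(2), of c i] c s 0 by auto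
      qed
      have "inverse (c n) \<in> R" using c(1)[of n] sf_inverse[OF k] pl(2) by auto
      then have "inverse (c n) * ((\<Sum>i<n. c i * v i) + c n * z) \<in> I"
        using s unfolding I_def by (rule max_ideal_mult[OF pl(1)])
      also have "inverse (c n) * ((\<Sum>i<n. c i * v i) + c n * z) = z - (\<Sum>i<n. (- inverse (c n) * c i) * v i)"
        using cn by (simp add: distrib_left sum_distrib_left sum_negf mult.assoc)
      finally have zI: "z - (\<Sum>i<n. (- inverse (c n) * c i) * v i) \<in> I" .
      have sp: "(\<Sum>i<n. (- inverse (c n) * c i) * v i) \<in> Om.Span k (map v [0..<n])"
        unfolding Span_iff[OF k]
        by (rule exI[of _ "\<lambda>i. - inverse (c n) * c i"]) (use c(1) k in \<open>auto intro!: sr_mult[OF sf_sr[OF k]] sr_minus[OF sf_sr[OF k]] sf_inverse\<close>)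
      have "h z = h (\<Sum>i<n. (- inverse (c n) * c i) * v i)"
        using h_eq[OF z] Span_R[OF vR] sp zI by blast
      with sp show ?thesis by blast
    qed
    then show ?thesis unfolding Span_h[OF vR] h_surj using Span_R[OF vR] by blast
  qed
  from S.dimensionI[OF hk ind this] have "ring.dimension kappa n (h ` k) (carrier kappa)"
    by (auto simp: lessThan_atLeast0)
  then have "ring.dim kappa (h ` k) (carrier kappa) = n"
    using S.dimI[OF hk] by (simp add: over_def)
  then have "place_degree k R = n"
    by (simp add: place_degree_def Let_def kappa_def h_def A_def I_def)
  with n show "dim_ge k R (max_ideal R) (place_degree k R)" "\<not> dim_ge k R (max_ideal R) (Suc (place_degree k R))"
    by (simp_all add: I_def)
qed

end

subsection \<open>Riemann-Roch spaces\<close>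

context ffield
begin

abbreviation "RRspace \<equiv> riemann_roch_space k K"

text \<open>Pole conditions at the places of \<open>T\<close> only: all places give the Riemann-Roch
  space, a single place a local lattice, and finite \<open>T\<close> the case in which approximation
  makes dimension counts exact.\<close>

definition semilocal :: "'a set set \<Rightarrow> ('a set \<Rightarrow> int) \<Rightarrow> 'a set"
  where "semilocal T D = {z \<in> K. z = 0 \<or> (\<forall>R\<in>T. ord_at R z \<ge> - D R)}"

lemma semilocalI:
  "z \<in> K \<Longrightarrow> (\<And>R. z \<noteq> 0 \<Longrightarrow> R \<in> T \<Longrightarrow> ord_at R z \<ge> - D R) \<Longrightarrow> z \<in> semilocal T D"
  by (auto simp: semilocal_def)

lemma semilocalD:
  "z \<in> semilocal T D \<Longrightarrow> z \<in> K" "z \<in> semilocal T D \<Longrightarrow> z \<noteq> 0 \<Longrightarrow> R \<in> T \<Longrightarrow> ord_at R z \<ge> - D R"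
  by (simp_all add: semilocal_def)

lemma RRspace_semilocal: "RRspace D = semilocal (places k K) D"
  by (simp add: riemann_roch_space_def semilocal_def)

lemma ord_k:
  assumes "R \<in> places k K" "c \<in> k" "c \<noteq> 0"
  shows "ord_at R c = 0"
proof -
  interpret R: dplace R K by (rule place_dplace[OF assms(1)])
  have "c \<in> R" "inverse c \<in> R" using assms placeD(2)[OF assms(1)] sf_inverse[OF k] by auto
  then have "ord_at R c \<ge> 0" "ord_at R (inverse c) \<ge> 0"
    using R.R_iff R.RK assms(3) by auto
  then show ?thesis using R.ord_inverse assms kK by auto
qed

lemma subspc_semilocal:
  assumes "T \<subseteq> places k K"
  shows "subspc k (semilocal T D)"
  unfolding subspc_def
proof (intro conjI ballI)
  show "0 \<in> semilocal T D" using K by (auto simp: semilocal_def intro: sr_intros)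
  fix x y assume xy: "x \<in> semilocal T D" "y \<in> semilocal T D"
  show "x + y \<in> semilocal T D"
  proof (rule semilocalI)
    show "x + y \<in> K" using xy K by (auto simp: semilocal_def intro: sr_intros)
    fix R assume ne: "x + y \<noteq> 0" and R: "R \<in> T"
    interpret R: dplace R K using R assms by (auto intro: place_dplace)
    show "ord_at R (x + y) \<ge> - D R"
      using xy R ne by (intro R.ord_add_ge) (auto simp: semilocal_def)
  qed
next
  fix c x assume c: "c \<in> k" and x: "x \<in> semilocal T D"
  show "c * x \<in> semilocal T D"
  proof (rule semilocalI)
    show "c * x \<in> K" using c x K kK by (auto simp: semilocal_def intro: sr_intros)
    fix R assume ne: "c * x \<noteq> 0" and R: "R \<in> T"
    interpret R: dplace R K using R assms by (auto intro: place_dplace)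
    have "c \<in> K" using c kK by blast
    then show "ord_at R (c * x) \<ge> - D R"
      using x R ne ord_k[OF _ c, of R] assms by (auto simp: semilocal_def R.ord_mult)
  qed
qed

lemma semilocal_mono: "(\<And>R. R \<in> T \<Longrightarrow> D R \<le> E R) \<Longrightarrow> semilocal T D \<subseteq> semilocal T E"
  by (intro subsetI semilocalI) (auto simp: semilocal_def intro: order_trans[OF le_imp_neg_le])

text \<open>Multiplication by a function of order \<open>E P + 1\<close> at \<open>P\<close> embeds
  the quotient into the residue field at \<open>P\<close>.\<close>

lemma semilocal_step_le:
  assumes T: "T \<subseteq> places k K" and P: "P \<in> T"
  shows "\<not> dim_ge k (semilocal T (E(P := E P + 1))) (semilocal T E) (Suc (place_degree k P))"
proof
  let ?M = "semilocal T (E(P := E P + 1))"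
  assume ge: "dim_ge k ?M (semilocal T E) (Suc (place_degree k P))"
  have Pp: "P \<in> places k K" using T P by blast
  interpret P: dplace P K by (rule place_dplace[OF Pp])
  obtain t where t: "t \<in> K" "t \<noteq> 0" "ord_at P t = 1" by (rule P.obtain_uniformizer) blast
  define h where "h = t powi (E P + 1)"
  have h: "h \<in> K" "h \<noteq> 0" "ord_at P h = E P + 1" using t by (auto simp: h_def P.powi_K P.ord_powi)
  have MK: "?M \<subseteq> K" by (auto simp: semilocal_def)
  have "dim_ge k ?M {x. h * x \<in> max_ideal P} (Suc (place_degree k P))"
  proof (rule dim_ge_Int[OF ge subspc_semilocal[OF T]], safe)
    fix x assume x: "x \<in> ?M" "h * x \<in> max_ideal P"
    have xK: "x \<in> K" using x(1) by (simp add: semilocal_def)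
    have "ord_at R x \<ge> - E R" if "R \<in> T" "x \<noteq> 0" for R
    proof (cases "R = P")
      case True
      have "ord_at P (h * x) \<ge> 1" using P.max_ideal_ord[of "h * x"] x(2) that(2) h xK P.Rr K by (auto intro: sr_intros)
      then show ?thesis using True h xK that(2) by (simp add: P.ord_mult)
    next
      case False
      then show ?thesis using semilocalD(2)[OF x(1) that(2,1)] by simp
    qed
    then show "x \<in> semilocal T E" using xK by (intro semilocalI)
  qed
  then have "dim_ge k P (max_ideal P) (Suc (place_degree k P))"
  proof (rule dim_ge_scale)
    fix x assume x: "x \<in> ?M"
    show "h * x \<in> P"
    proof (cases "x = 0")
      case True
      then show ?thesis using sr_0[OF P.Rr] by simp
    next
      case False
      have "x \<in> K" "ord_at P x \<ge> - (E P + 1)" using semilocalD(1)[OF x] semilocalD(2)[OF x False P] by simp_all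
      then have "h * x \<in> K" "ord_at P (h * x) \<ge> 0" using h False K by (auto simp: P.ord_mult intro: sr_intros)
      then show ?thesis using P.R_iff[of "h * x"] h(2) False by simp
    qed
  qed auto
  then show False using place_degree_dim(2)[OF Pp] by blast
qed

text \<open>Lifts of a basis of the residue field are multiplied by a function with the prescribed
  pole at \<open>P\<close> and enough zeros at the other places of \<open>T\<close>. The
  approximation that provides these zeros needs \<open>T\<close> to be finite.\<close>

lemma semilocal_step_ge:
  assumes T: "T \<subseteq> places k K" "finite T" and P: "P \<in> T"
  shows "dim_ge k (semilocal T (E(P := E P + 1))) (semilocal T E) (place_degree k P)"
proof -
  have Pp: "P \<in> places k K" using T P by blast
  interpret P: dplace P K by (rule place_dplace[OF Pp])
  have sr: "subring K \<Omega>" using K by (rule sf_sr)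
  define n where "n = place_degree k P"
  obtain v where v: "\<And>i. i < n \<Longrightarrow> v i \<in> P" "indep_mod k (max_ideal P) {..<n} v"
    using place_degree_dim(1)[OF Pp] unfolding dim_ge_def n_def by blast
  obtain t where t: "t \<in> K" "t \<noteq> 0" "ord_at P t = 1" by (rule P.obtain_uniformizer) blast
  define s where "s = t powi (- (E P + 1))"
  have s: "s \<in> K" "s \<noteq> 0" "ord_at P s = - (E P + 1)" using t by (auto simp: s_def P.powi_K P.ord_powi)
  obtain u where u: "u \<in> K" "u \<noteq> 0" "ord_at P u = 0" "\<And>Q. Q \<in> T - {P} \<Longrightarrow> ord_at Q u > 0"
  proof -
    have "finite (T - {P})" "T - {P} \<subseteq> places k K" "P \<notin> T - {P}" using T by auto
    from approximation[OF this(1,2) Pp this(3)] that show ?thesis by blast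
  qed
  \<comment> \<open>Bounds, at every place of \<open>T\<close>, the combined effect of
    \<open>s\<close>, of \<open>E\<close> and of all lifts \<open>v i\<close>, so that the zeros of
    \<open>u ^ N\<close> compensate for them.\<close>
  define N where "N = nat (\<Sum>Q\<in>T. \<bar>ord_at Q s\<bar> + \<bar>E Q\<bar> + (\<Sum>i<n. \<bar>ord_at Q (v i)\<bar>))"
  define h where "h = s * u ^ N"
  have uN: "u ^ N \<in> K" "u ^ N \<noteq> 0" using u sr by (auto intro: sr_intros)
  have h: "h \<in> K" "h \<noteq> 0" "ord_at P h = - (E P + 1)"
    using s u uN sr by (auto simp: h_def P.ord_mult P.ord_power intro: sr_intros)
  have vK: "v i \<in> K" if "i < n" for i using v(1)[OF that] P.RK by blast
  have hv: "h * v i \<in> semilocal T (E(P := E P + 1))" if i: "i < n" for i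
  proof (rule semilocalI)
    show "h * v i \<in> K" using h vK[OF i] sr by (auto intro: sr_intros)
    fix Q assume ne: "h * v i \<noteq> 0" and Q: "Q \<in> T"
    interpret Q: dplace Q K using Q T by (auto intro: place_dplace)
    show "ord_at Q (h * v i) \<ge> - (E(P := E P + 1)) Q"
    proof (cases "Q = P")
      case True
      have "ord_at P (v i) \<ge> 0" using v(1)[OF i] vK[OF i] ne P.R_iff[of "v i"] by auto
      then show ?thesis using True h ne vK[OF i] by (simp add: P.ord_mult)
    next
      case False
      have "ord_at Q u \<ge> 1" using u(4)[of Q] Q False by auto
      then have "int N * 1 \<le> int N * ord_at Q u" by (intro mult_left_mono) auto
      moreover have "\<bar>ord_at Q s\<bar> + \<bar>E Q\<bar> + (\<Sum>i<n. \<bar>ord_at Q (v i)\<bar>) \<le> int N"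
      proof -
        have "\<bar>ord_at Q s\<bar> + \<bar>E Q\<bar> + (\<Sum>i<n. \<bar>ord_at Q (v i)\<bar>)
            \<le> (\<Sum>Q\<in>T. \<bar>ord_at Q s\<bar> + \<bar>E Q\<bar> + (\<Sum>i<n. \<bar>ord_at Q (v i)\<bar>))"
          by (rule member_le_sum[OF Q _ T(2)]) (auto intro: add_nonneg_nonneg sum_nonneg)
        then show ?thesis unfolding N_def by linarith
      qed
      moreover have "\<bar>ord_at Q (v i)\<bar> \<le> (\<Sum>i<n. \<bar>ord_at Q (v i)\<bar>)" using i by (intro member_le_sum) auto
      moreover have "ord_at Q (h * v i) = ord_at Q s + int N * ord_at Q u + ord_at Q (v i)"
        using ne s u uN vK[OF i] sr by (simp add: h_def Q.ord_mult Q.ord_power sr_mult)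
      ultimately show ?thesis using False by simp
    qed
  qed
  have "dim_ge k (v ` {..<n}) (max_ideal P) n" unfolding dim_ge_def using v by (intro exI[of _ v]) auto
  then show ?thesis unfolding n_def[symmetric]
  proof (rule dim_ge_scale)
    show "h * x \<in> semilocal T (E(P := E P + 1))" if "x \<in> v ` {..<n}" for x using hv that by auto
    fix x assume x: "h * x \<in> semilocal T E"
    show "x \<in> max_ideal P"
    proof (cases "x = 0")
      case True
      then show ?thesis using max_ideal_0[OF P.Rr] by simp
    next
      case False
      have "h * x \<in> K" using x by (simp add: semilocal_def)
      then have "h * x / h \<in> K" using h(1) by (rule sf_divide[OF K])
      then have xK: "x \<in> K" using h(2) by simp
      have "ord_at P (h * x) \<ge> - E P" using semilocalD(2)[OF x _ P] False h(2) by simp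
      then have "ord_at P x \<ge> 1" using h xK False by (simp add: P.ord_mult)
      then show ?thesis using P.max_ideal_ord[OF xK False] by simp
    qed
  qed
qed

text \<open>One point is added at a time, by induction on the sum of the differences. The upper
  bound holds for any set of places and serves the Riemann-Roch spaces; the lower bound is confined
  to finite sets. The sums are nonnegative, so \<open>nat\<close> loses nothing.\<close>

lemma semilocal_dim:
  assumes T: "T \<subseteq> places k K" and S: "finite S" "S \<subseteq> T" and DE: "\<And>R. D R \<le> E R" "\<And>R. R \<notin> S \<Longrightarrow> D R = E R"
  shows "\<not> dim_ge k (semilocal T E) (semilocal T D) (Suc (nat (\<Sum>R\<in>S. (E R - D R) * int (place_degree k R))))"
    "finite T \<Longrightarrow> dim_ge k (semilocal T E) (semilocal T D) (nat (\<Sum>R\<in>S. (E R - D R) * int (place_degree k R)))"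
proof -
  have sr: "subring k \<Omega>" using k by (rule sf_sr)
  have "\<not> dim_ge k (semilocal T E) (semilocal T D) (Suc (nat (\<Sum>R\<in>S. (E R - D R) * int (place_degree k R)))) \<and>
    (finite T \<longrightarrow> dim_ge k (semilocal T E) (semilocal T D) (nat (\<Sum>R\<in>S. (E R - D R) * int (place_degree k R))))"
    if "nat (\<Sum>R\<in>S. E R - D R) = n" "\<And>R. D R \<le> E R" "\<And>R. R \<notin> S \<Longrightarrow> D R = E R" for n E
    using that
  proof (induction n arbitrary: E)
    case 0
    have nn: "\<And>R. R \<in> S \<Longrightarrow> 0 \<le> E R - D R" using 0(2) by simp
    have "(\<Sum>R\<in>S. E R - D R) = 0" using 0(1) sum_nonneg[of S "\<lambda>R. E R - D R"] nn by fastforce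
    then have "E R = D R" if "R \<in> S" for R using sum_nonneg_eq_0_iff[OF S(1), of "\<lambda>R. E R - D R"] nn that by simp
    then have "E = D" using 0(3) by (metis ext)
    moreover have "\<not> dim_ge k M M (Suc 0)" if "subspc k M" for M
      unfolding dim_ge_def indep_mod_def
      using that sr_1[OF sr] by (auto simp: subspc_scale dest!: spec[of _ "\<lambda>_. 1"])
    ultimately show ?case using subspc_semilocal[OF T] by auto
  next
    case (Suc n)
    have "\<exists>P\<in>S. E P > D P"
    proof (rule ccontr)
      assume neg: "\<not> ?thesis"
      have "E R - D R = 0" if "R \<in> S" for R using neg that Suc.prems(2)[of R] by force
      then have "(\<Sum>R\<in>S. E R - D R) = 0" by (intro sum.neutral) auto
      then show False using Suc.prems(1) by simp
    qed
    then obtain P where P: "P \<in> S" "E P > D P" by blast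
    define F where "F = E(P := E P - 1)"
    have EF: "E = F(P := F P + 1)" by (auto simp: F_def)
    have FS: "E R - D R = (F R - D R) + (if R = P then 1 else 0)" for R by (simp add: F_def)
    have DF: "\<And>R. D R \<le> F R" "\<And>R. R \<notin> S \<Longrightarrow> D R = F R" using P Suc.prems(2,3) by (auto simp: F_def)
    have "(\<Sum>R\<in>S. E R - D R) = (\<Sum>R\<in>S. F R - D R) + 1" using P S(1) by (simp add: FS sum.distrib)
    moreover have "(\<Sum>R\<in>S. F R - D R) \<ge> 0" using DF(1) by (intro sum_nonneg) simp
    ultimately have n: "nat (\<Sum>R\<in>S. F R - D R) = n" using Suc.prems(1) by simp
    define d where "d = nat (\<Sum>R\<in>S. (F R - D R) * int (place_degree k R))"
    have IH: "\<not> dim_ge k (semilocal T F) (semilocal T D) (Suc d) \<and>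
        (finite T \<longrightarrow> dim_ge k (semilocal T F) (semilocal T D) d)"
      unfolding d_def by (rule Suc.IH[OF n]) (fact DF)+
    have "(\<Sum>R\<in>S. (E R - D R) * int (place_degree k R)) = (\<Sum>R\<in>S. (F R - D R) * int (place_degree k R)) + int (place_degree k P)"
      using P S(1) by (simp add: FS distrib_right sum.distrib if_distrib[of "\<lambda>x. x * _"] cong: if_cong)
    moreover have "(\<Sum>R\<in>S. (F R - D R) * int (place_degree k R)) \<ge> 0" using DF(1) by (intro sum_nonneg) simp
    ultimately have d: "nat (\<Sum>R\<in>S. (E R - D R) * int (place_degree k R)) = place_degree k P + d"
      by (simp add: d_def nat_add_distrib)
    have PT: "P \<in> T" using P S by blast
    note sp = subspc_semilocal[OF T]
    have 1: "\<not> dim_ge k (semilocal T E) (semilocal T D) (Suc (place_degree k P + d))"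
      by (rule dim_le_add[OF semilocal_step_le[OF T PT, of F, folded EF] IH[THEN conjunct1] k sp sp])
    have 2: "dim_ge k (semilocal T E) (semilocal T D) (place_degree k P + d)" if fT: "finite T"
    proof (rule dim_ge_add[OF semilocal_step_ge[OF T fT PT, of F, folded EF] IH[THEN conjunct2, rule_format, OF fT] sp _ _ sr])
      show "semilocal T F \<subseteq> semilocal T E" by (rule semilocal_mono) (simp add: F_def)
      show "semilocal T D \<subseteq> semilocal T F" by (rule semilocal_mono) (rule DF(1))
    qed
    show ?case unfolding d using 1 2 by blast
  qed
  from this[OF refl] DE have main: "\<not> dim_ge k (semilocal T E) (semilocal T D) (Suc (nat (\<Sum>R\<in>S. (E R - D R) * int (place_degree k R)))) \<and>
    (finite T \<longrightarrow> dim_ge k (semilocal T E) (semilocal T D) (nat (\<Sum>R\<in>S. (E R - D R) * int (place_degree k R))))" .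
  show "\<not> dim_ge k (semilocal T E) (semilocal T D) (Suc (nat (\<Sum>R\<in>S. (E R - D R) * int (place_degree k R))))"
    "finite T \<Longrightarrow> dim_ge k (semilocal T E) (semilocal T D) (nat (\<Sum>R\<in>S. (E R - D R) * int (place_degree k R)))"
    using main by (rule conjunct1, use main in blast)
qed

text \<open>A transcendental element is not integral over \<open>k\<close>, so some valuation ring
  over \<open>k\<close> misses it and is therefore a place.\<close>

lemma in_all_places_algebraic:
  assumes z: "z \<in> K" "\<And>R. R \<in> places k K \<Longrightarrow> z \<in> R"
  shows "z \<in> alg_closure_of k"
proof (rule ccontr)
  assume n: "z \<notin> alg_closure_of k"
  have "\<not> integral_over k z"
  proof
    assume "integral_over k z"
    then obtain p where "p \<in> poly_over k" "Polynomial.lead_coeff p = 1" "poly p z = 0" by (auto simp: integral_over_def)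
    moreover from this have "p \<noteq> 0" by auto
    ultimately have "z \<in> alg_closure_of k" unfolding alg_closure_of_iff[OF k] by (intro bexI[of _ p]) auto
    with n show False by blast
  qed
  then obtain V where "valring V K" "k \<subseteq> V" "z \<notin> V" using chevalley[OF sf_sr[OF k] kK K z(1)] by blast
  then show False using z by (auto simp: places_iff)
qed

lemma div_degree_eq:
  assumes "finite S" "{R. D R \<noteq> 0} \<subseteq> S"
  shows "div_degree k D = (\<Sum>R\<in>S. D R * int (place_degree k R))"
  unfolding div_degree_def by (rule sum.mono_neutral_left) (use assms in auto)

text \<open>\<open>Om.dim\<close> is meaningful only for spaces of finite dimension. Finiteness
  follows by comparing \<open>D\<close> with its positive part and with the zero divisor, whose
  functions are constants.\<close>

lemma RRspace_dim:
  assumes const: "K \<inter> alg_closure_of k \<subseteq> k" and D: "D \<in> divisors k K"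
  shows "dim_ge k (RRspace D) {0} m \<longleftrightarrow> m \<le> Om.dim k (RRspace D)"
proof -
  define S where "S = {R. D R \<noteq> 0}"
  have S: "finite S" "S \<subseteq> places k K" using D by (auto simp: S_def divisors_def)
  define E where "E R = max (D R) 0" for R
  note sp = subspc_semilocal[OF order_refl]
  have "RRspace (\<lambda>_. 0) \<subseteq> k"
  proof
    fix z assume z: "z \<in> RRspace (\<lambda>_. 0)"
    then have zK: "z \<in> K" by (simp add: riemann_roch_space_def)
    have "z \<in> R" if R: "R \<in> places k K" for R
    proof (cases "z = 0")
      case True
      then show ?thesis using placeD(1)[OF R] sr_0 by blast
    next
      case False
      then show ?thesis using dplace.R_iff[OF place_dplace[OF R] zK] z R by (auto simp: riemann_roch_space_def)
    qed
    then show "z \<in> k" using in_all_places_algebraic[OF zK] zK const by blast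
  qed
  moreover have "\<not> dim_ge k k {0} (Suc 1)"
    using dimension_imp(2)[OF k Om.dimension_one[OF k], of "Suc 1"] by simp
  ultimately have "\<not> dim_ge k (RRspace (\<lambda>_. 0)) {0} (Suc 1)"
    using dim_ge_mono[of k "RRspace (\<lambda>_. 0)" "{0}" "Suc 1" k "{0}" "Suc 1"] sr_0[OF sf_sr[OF k]] by blast
  moreover have "\<not> dim_ge k (RRspace E) (RRspace (\<lambda>_. 0)) (Suc (nat (\<Sum>R\<in>S. (E R - 0) * int (place_degree k R))))"
    unfolding RRspace_semilocal
    by (rule semilocal_dim(1)[OF order_refl S]) (auto simp: E_def S_def)
  ultimately have nE: "\<not> dim_ge k (RRspace E) {0} (Suc (nat (\<Sum>R\<in>S. (E R - 0) * int (place_degree k R)) + 1))"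
    using dim_le_add[OF _ _ k] sp unfolding RRspace_semilocal by blast
  have DE: "RRspace D \<subseteq> RRspace E" unfolding RRspace_semilocal by (rule semilocal_mono) (simp add: E_def)
  have "\<not> dim_ge k (RRspace D) {0} (Suc (nat (\<Sum>R\<in>S. (E R - 0) * int (place_degree k R)) + 1))"
    using nE dim_ge_mono[OF _ DE order_refl order_refl sr_0[OF sf_sr[OF k]]] by blast
  then obtain n where n: "Om.dimension n k (RRspace D)"
    using dimension_ex[OF k, of "RRspace D"] sp unfolding RRspace_semilocal by blast
  have "Om.dim k (RRspace D) = n" using Om.dimI[OF k n] by (simp add: over_def)
  then show ?thesis using dimension_imp(2)[OF k n] by simp
qed

text \<open>Replacing \<open>D\<close> by its positive part raises the dimension by at most the rise
  in degree, so lower bounds for effective divisors bound the whole supremum.\<close>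

lemma genus_le:
  assumes const: "K \<inter> alg_closure_of k \<subseteq> k"
    and lower: "\<And>E. E \<in> divisors k K \<Longrightarrow> (\<And>R. E R \<ge> 0) \<Longrightarrow>
        \<exists>m. dim_ge k (RRspace E) {0} m \<and> div_degree k E + 1 - g \<le> int m"
  shows "genus k K \<le> g"
  unfolding genus_def
proof (rule cSUP_least)
  show "divisors k K \<noteq> {}" by (auto simp: divisors_def intro!: exI[of _ "\<lambda>_. 0"])
  fix D assume D: "D \<in> divisors k K"
  define S where "S = {R. D R \<noteq> 0}"
  have S: "finite S" "S \<subseteq> places k K" using D by (auto simp: S_def divisors_def)
  define E where "E R = max (D R) 0" for R
  have "{R. E R \<noteq> 0} \<subseteq> S" by (auto simp: E_def S_def)
  then have E: "E \<in> divisors k K" using S finite_subset by (auto simp: divisors_def)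
  obtain m where m: "dim_ge k (RRspace E) {0} m" "div_degree k E + 1 - g \<le> int m"
    using lower[OF E] by (auto simp: E_def)
  define d where "d = nat (\<Sum>R\<in>S. (E R - D R) * int (place_degree k R))"
  define l where "l = Om.dim k (RRspace D)"
  note sp = subspc_semilocal[OF order_refl]
  have "\<not> dim_ge k (RRspace E) (RRspace D) (Suc d)"
    unfolding RRspace_semilocal d_def
    by (rule semilocal_dim(1)[OF order_refl S]) (auto simp: E_def S_def)
  moreover have "\<not> dim_ge k (RRspace D) {0} (Suc l)" using RRspace_dim[OF const D] by (simp add: l_def)
  ultimately have "\<not> dim_ge k (RRspace E) {0} (Suc (d + l))"
    using dim_le_add[OF _ _ k] sp unfolding RRspace_semilocal by blast
  then have "m \<le> d + l" using dim_ge_mono[OF m(1) order_refl order_refl, of "Suc (d + l)"] sr_0[OF sf_sr[OF k]] by force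
  moreover have "int d = div_degree k E - div_degree k D"
  proof -
    have "(\<Sum>R\<in>S. (E R - D R) * int (place_degree k R)) \<ge> 0" by (intro sum_nonneg) (simp add: E_def)
    then have "int d = (\<Sum>R\<in>S. (E R - D R) * int (place_degree k R))" by (simp add: d_def)
    also have "\<dots> = div_degree k E - div_degree k D"
      using \<open>{R. E R \<noteq> 0} \<subseteq> S\<close> S(1)
      by (simp add: div_degree_eq[of S] S_def left_diff_distrib sum_subtractf)
    finally show ?thesis .
  qed
  ultimately show "div_degree k D - int (Om.dim k (RRspace D)) + 1 \<le> g"
    using m(2) unfolding l_def by linarith
qed

end

subsection \<open>The separable closure is a field\<close>

lemma poly_eq_0_of_roots:
  assumes "finite W" "\<And>w. w \<in> W \<Longrightarrow> poly p w = 0" "Polynomial.degree p < card W"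
  shows "(p :: 'a::idom poly) = 0"
proof (rule ccontr)
  assume p: "p \<noteq> 0"
  have "card W \<le> card {x. poly p x = 0}" using assms p by (intro card_mono poly_roots_finite) auto
  also have "\<dots> \<le> Polynomial.degree p" using p by (rule card_poly_roots_bound)
  finally show False using assms(3) by simp
qed

lemma rsquarefree_prod_linear:
  assumes "finite W"
  shows "rsquarefree (\<Prod>w\<in>W. [:- w, 1:] :: 'a::idom poly)"
  using assms
proof (induction W)
  case (insert w W)
  define P where "P = (\<Prod>w\<in>W. [:- w, 1:])"
  have P: "(\<Prod>w\<in>insert w W. [:- w, 1:]) = [:- w, 1:] * P"
    using insert.hyps unfolding P_def by (rule prod.insert)
  have "P \<noteq> 0" using insert.hyps by (simp add: P_def prod_zero_iff)
  then have ne: "[:- w, 1:] * P \<noteq> 0" by (intro no_zero_divisors) auto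
  have o: "order a ([:- w, 1:] * P) = order a [:- w, 1:] + order a P" for a
    by (rule order_mult[OF ne])
  have lin: "order a [:- w, 1:] = (if a = w then 1 else 0)" for a
    using order_power_n_n[of w 1] by (auto intro: order_0I)
  have "order w P = 0" using insert.hyps by (intro order_0I) (auto simp: P_def poly_prod)
  then have "\<forall>a. order a ([:- w, 1:] * P) = 0 \<or> order a ([:- w, 1:] * P) = 1"
    using insert.IH[folded P_def] unfolding rsquarefree_def o lin by auto
  then show ?case unfolding P rsquarefree_def using ne by blast
qed (simp add: rsquarefree_def)

lemma card_roots_rsquarefree:
  assumes "rsquarefree (p :: 'a::alg_closed_field poly)"
  shows "card {x. poly p x = 0} = Polynomial.degree p"
proof -
  have p: "p \<noteq> 0" using assms by (simp add: rsquarefree_def)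
  obtain A where A: "size A = Polynomial.degree p"
      "p = Polynomial.smult (Polynomial.lead_coeff p) (\<Prod>x\<in>#A. [:-x, 1:])"
    using alg_closed_imp_factorization[OF p] by blast
  have P0: "(\<Prod>x\<in>#A. [:-x, 1:]) \<noteq> 0" by (auto simp: prod_mset_zero_iff)
  have ord: "order a (\<Prod>x\<in>#A. [:-x, 1:]) = count A a" for a
  proof (induction A)
    case (add x A)
    have "order a [:- x, 1:] = (if a = x then 1 else 0)"
      using order_power_n_n[of x 1] by (auto intro: order_0I)
    moreover have "[:- x, 1:] * (\<Prod>x\<in>#A. [:-x, 1:]) \<noteq> 0"
      by (auto simp: prod_mset_zero_iff simp del: mult_pCons_left)
    ultimately show ?case using add by (simp add: order_mult del: mult_eq_0_iff mult_pCons_left)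
  qed simp
  have "order a p = count A a" for a
    using p by (subst A(2)) (simp add: order_smult ord)
  then have cnt: "count A a \<le> 1" for a using assms unfolding rsquarefree_def by (metis le_numeral_extra(4) zero_le)
  have roots: "{x. poly p x = 0} = set_mset A"
    using p by (subst A(2)) (auto simp: poly_prod_mset prod_mset_zero_iff)
  have "size A = (\<Sum>x\<in>set_mset A. count A x)" by (simp add: size_multiset_overloaded_eq)
  also have "\<dots> = (\<Sum>x\<in>set_mset A. 1)"
    using cnt by (intro sum.cong refl) (metis count_greater_zero_iff le_antisym One_nat_def Suc_leI)
  finally show ?thesis using A(1) roots by simp
qed

text \<open>Sums and products of separable elements are treated as functions on all pairs of
  conjugates at once, so neither splitting fields nor embeddings are needed. The cardinality
  conditions say that \<open>f\<close> and \<open>g\<close> have simple roots.\<close>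

locale root_functions =
  fixes k :: "'a::alg_closed_field set" and f g :: "'a poly" and m n :: nat
  assumes k: "subfield k \<Omega>"
    and f: "f \<in> poly_over k" "Polynomial.degree f = m" "Polynomial.lead_coeff f = 1" "m > 0" "card {x. poly f x = 0} = m"
    and g: "g \<in> poly_over k" "Polynomial.degree g = n" "Polynomial.lead_coeff g = 1" "n > 0" "card {x. poly g x = 0} = n"
begin

text \<open>The elements of \<open>k[U, V]/(f(U), g(V))\<close>, seen as functions on pairs of roots.\<close>

definition rep :: "('a \<Rightarrow> 'a \<Rightarrow> 'a) \<Rightarrow> (nat \<Rightarrow> nat \<Rightarrow> 'a) \<Rightarrow> bool"
  where "rep F c \<longleftrightarrow> (\<forall>a b. c a b \<in> k) \<and> (\<forall>u v. poly f u = 0 \<longrightarrow> poly g v = 0 \<longrightarrow>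
     F u v = (\<Sum>a<m. \<Sum>b<n. c a b * (u ^ a * v ^ b)))"

lemma sr: "subring k \<Omega>" using k by (rule sf_sr)

lemma rep_add: "rep F c \<Longrightarrow> rep G d \<Longrightarrow> rep (\<lambda>u v. F u v + G u v) (\<lambda>a b. c a b + d a b)"
  by (auto simp: rep_def distrib_right sum.distrib intro: sr_add[OF sr])

lemma rep_scale: "rep F c \<Longrightarrow> s \<in> k \<Longrightarrow> rep (\<lambda>u v. s * F u v) (\<lambda>a b. s * c a b)"
  by (auto simp: rep_def sum_distrib_left mult.assoc intro: sr_mult[OF sr])

lemma rep_1: "rep (\<lambda>u v. 1) (\<lambda>a b. if a = 0 \<and> b = 0 then 1 else 0)"
proof -
  obtain m' n' where mn: "m = Suc m'" "n = Suc n'" using f(4) g(4) by (metis gr0_implies_Suc)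
  have "(\<Sum>a<m. \<Sum>b<n. (if a = 0 \<and> b = 0 then 1 else 0) * (u ^ a * v ^ b)) = (1::'a)" for u v
    by (simp add: mn sum.lessThan_Suc_shift del: sum.lessThan_Suc)
  then show ?thesis by (auto simp: rep_def intro: sr_0[OF sr] sr_1[OF sr])
qed

lemma root_power:
  fixes p :: "'a poly"
  assumes "Polynomial.degree p = N" "Polynomial.lead_coeff p = 1" "poly p u = 0"
  shows "u ^ N = (\<Sum>a<N. - Polynomial.coeff p a * u ^ a)"
proof -
  have "poly p u = (\<Sum>a<N. Polynomial.coeff p a * u ^ a) + u ^ N"
    using assms(1,2) by (simp add: poly_altdef lessThan_Suc_atMost[symmetric])
  then show ?thesis using assms(3) by (simp add: sum_negf add_eq_0_iff)
qed

text \<open>Multiplication by \<open>u\<close> on the powers \<open>u ^ a\<close> with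
  \<open>a < N\<close> is given by the companion matrix of \<open>p\<close>: the overflow
  \<open>u ^ N\<close> is rewritten with the monic equation.\<close>

lemma reduce:
  fixes p :: "'a poly" and w :: "nat \<Rightarrow> 'a"
  assumes "Polynomial.degree p = N" "Polynomial.lead_coeff p = 1" "N > 0" "poly p u = 0"
  shows "u * (\<Sum>a<N. w a * u ^ a) =
    (\<Sum>a<N. ((if a = 0 then 0 else w (a - 1)) + w (N - 1) * - Polynomial.coeff p a) * u ^ a)"
proof -
  obtain N' where N': "N = Suc N'" using assms(3) by (cases N) auto
  have "u * (\<Sum>a<N. w a * u ^ a) = (\<Sum>a<N'. w a * u ^ Suc a) + w N' * u ^ N"
    by (simp add: N' sum_distrib_left distrib_left mult_ac)
  also have "(\<Sum>a<N'. w a * u ^ Suc a) = (\<Sum>a<N. (if a = 0 then 0 else w (a - 1)) * u ^ a)"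
    unfolding N' by (subst sum.lessThan_Suc_shift) simp
  also have "w N' * u ^ N = (\<Sum>a<N. w N' * - Polynomial.coeff p a * u ^ a)"
    by (subst root_power[OF assms(1,2,4)]) (simp add: sum_distrib_left mult.assoc)
  finally show ?thesis by (simp add: N' distrib_right left_diff_distrib sum.distrib[symmetric] del: sum.lessThan_Suc)
qed

lemma rep_u: assumes "rep F c" shows "\<exists>d. rep (\<lambda>u v. u * F u v) d"
proof -
  define d where "d a b = (if a = 0 then 0 else c (a - 1) b) + c (m - 1) b * - Polynomial.coeff f a" for a b
  have "u * F u v = (\<Sum>a<m. \<Sum>b<n. d a b * (u ^ a * v ^ b))" if r: "poly f u = 0" "poly g v = 0" for u v
  proof -
    have "F u v = (\<Sum>a<m. (\<Sum>b<n. c a b * v ^ b) * u ^ a)"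
      using assms r by (simp add: rep_def sum_distrib_right sum_distrib_left mult_ac)
    then have "u * F u v = u * (\<Sum>a<m. (\<Sum>b<n. c a b * v ^ b) * u ^ a)" by simp
    also have "\<dots> = (\<Sum>a<m. ((if a = 0 then 0 else \<Sum>b<n. c (a - 1) b * v ^ b) + (\<Sum>b<n. c (m - 1) b * v ^ b) * - Polynomial.coeff f a) * u ^ a)"
      by (rule reduce[OF f(2,3,4) r(1)])
    also have "\<dots> = (\<Sum>a<m. \<Sum>b<n. d a b * (u ^ a * v ^ b))"
    proof (intro sum.cong refl)
      fix a
      have e: "(if a = 0 then 0 else \<Sum>b<n. c (a - 1) b * v ^ b) + (\<Sum>b<n. c (m - 1) b * v ^ b) * - Polynomial.coeff f a
          = (\<Sum>b<n. d a b * v ^ b)"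
        by (cases "a = 0") (simp_all add: d_def sum_distrib_right sum_distrib_left sum.distrib sum_negf sum_subtractf algebra_simps)
      show "((if a = 0 then 0 else \<Sum>b<n. c (a - 1) b * v ^ b) + (\<Sum>b<n. c (m - 1) b * v ^ b) * - Polynomial.coeff f a) * u ^ a
          = (\<Sum>b<n. d a b * (u ^ a * v ^ b))"
        unfolding e by (simp add: sum_distrib_right sum_distrib_left mult_ac)
    qed
    finally show ?thesis .
  qed
  moreover have "d a b \<in> k" for a b
    using assms f(1) by (auto simp: d_def rep_def poly_over_def intro!: sr_add[OF sr] sr_mult[OF sr] sr_minus[OF sr] sr_diff[OF sr] sr_0[OF sr])
  ultimately show ?thesis by (auto simp: rep_def)
qed

lemma rep_swap: "rep F c \<longleftrightarrow> root_functions.rep k g f n m (\<lambda>u v. F v u) (\<lambda>a b. c b a)"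
proof -
  interpret s: root_functions k g f n m by (rule root_functions.intro) (rule k f g)+
  have "(\<Sum>a<m. \<Sum>b<n. c a b * (u ^ a * v ^ b)) = (\<Sum>b<n. \<Sum>a<m. c a b * (v ^ b * u ^ a))" for u v
    by (subst sum.swap) (simp add: mult.commute)
  then show ?thesis unfolding rep_def s.rep_def by auto
qed

lemma rep_v: assumes "rep F c" shows "\<exists>d. rep (\<lambda>u v. v * F u v) d"
proof -
  interpret s: root_functions k g f n m by (rule root_functions.intro) (rule k f g)+
  obtain d where "s.rep (\<lambda>u v. u * F v u) d" using s.rep_u assms unfolding rep_swap by blast
  then have "rep (\<lambda>u v. v * F u v) (\<lambda>a b. d b a)" unfolding rep_swap .
  then show ?thesis by blast
qed

lemma rep_0: "rep (\<lambda>u v. 0) (\<lambda>a b. 0)"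
  using rep_scale[OF rep_1 sr_0[OF sr]] by simp

lemma rep_monomial: "rep F c \<Longrightarrow> \<exists>d. rep (\<lambda>u v. (u ^ a * v ^ b) * F u v) d"
proof (induction a)
  case 0
  show ?case
  proof (induction b)
    case 0
    then show ?case using \<open>rep F c\<close> by auto
  next
    case (Suc b)
    then obtain d where "rep (\<lambda>u v. (u ^ 0 * v ^ b) * F u v) d" by blast
    from rep_v[OF this] show ?case by (simp add: mult_ac)
  qed
next
  case (Suc a)
  then obtain d where "rep (\<lambda>u v. (u ^ a * v ^ b) * F u v) d" by blast
  from rep_u[OF this] show ?case by (simp add: mult_ac)
qed

lemma rep_sum:
  assumes "finite I" "\<And>i. i \<in> I \<Longrightarrow> \<exists>c. rep (F i) c"
  shows "\<exists>c. rep (\<lambda>u v. \<Sum>i\<in>I. F i u v) c"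
  using assms
proof (induction I)
  case empty
  then show ?case using rep_0 by auto
next
  case (insert i I)
  then obtain c d where "rep (F i) c" "rep (\<lambda>u v. \<Sum>i\<in>I. F i u v) d" by blast
  from rep_add[OF this] insert.hyps show ?case by auto
qed

lemma rep_cong: "rep F c \<Longrightarrow> (\<And>u v. poly f u = 0 \<Longrightarrow> poly g v = 0 \<Longrightarrow> F u v = G u v) \<Longrightarrow> rep G c"
  by (simp add: rep_def)

lemma rep_mult:
  assumes "rep F c" "rep G d"
  shows "\<exists>e. rep (\<lambda>u v. F u v * G u v) e"
proof -
  have "\<exists>e. rep (\<lambda>u v. c (fst p) (snd p) * ((u ^ fst p * v ^ snd p) * G u v)) e" for p
    using rep_monomial[OF assms(2), of "fst p" "snd p"] rep_scale assms(1) unfolding rep_def[of F] by blast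
  then obtain e where "rep (\<lambda>u v. \<Sum>p\<in>{..<m}\<times>{..<n}. c (fst p) (snd p) * ((u ^ fst p * v ^ snd p) * G u v)) e"
    using rep_sum[of "{..<m}\<times>{..<n}" "\<lambda>p u v. c (fst p) (snd p) * ((u ^ fst p * v ^ snd p) * G u v)"] by auto
  then have "rep (\<lambda>u v. F u v * G u v) e"
  proof (rule rep_cong)
    fix u v assume r: "poly f u = 0" "poly g v = 0"
    have "F u v = (\<Sum>p\<in>{..<m}\<times>{..<n}. c (fst p) (snd p) * (u ^ fst p * v ^ snd p))"
      using assms(1) r by (simp add: rep_def sum.cartesian_product case_prod_beta)
    then show "(\<Sum>p\<in>{..<m}\<times>{..<n}. c (fst p) (snd p) * ((u ^ fst p * v ^ snd p) * G u v)) = F u v * G u v"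
      by (simp add: sum_distrib_right mult.assoc)
  qed
  then show ?thesis by blast
qed

lemma rep_power: "rep F c \<Longrightarrow> \<exists>d. rep (\<lambda>u v. F u v ^ i) d"
proof (induction i)
  case 0
  then show ?case using rep_1 by auto
next
  case (Suc i)
  then obtain d where "rep (\<lambda>u v. F u v ^ i) d" by blast
  from rep_mult[OF \<open>rep F c\<close> this] show ?case by simp
qed

text \<open>A polynomial of degree below \<open>m\<close> that vanishes at the \<open>m\<close>
  distinct roots of \<open>f\<close> is zero; this is used for the variable \<open>u\<close> and
  then, with \<open>n\<close> and \<open>g\<close>, for \<open>v\<close>.\<close>

lemma monomials_independent:
  assumes "\<And>u v. poly f u = 0 \<Longrightarrow> poly g v = 0 \<Longrightarrow> (\<Sum>a<m. \<Sum>b<n. c a b * (u ^ a * v ^ b)) = 0" and ab: "a < m" "b < n"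
  shows "c a b = 0"
proof -
  have one: "h a = 0" if "a < N" and van: "\<And>u. poly p u = 0 \<Longrightarrow> (\<Sum>a<N. h a * u ^ a) = 0"
    and p: "card {x. poly p x = 0} = N" "p \<noteq> 0" for h :: "nat \<Rightarrow> 'a" and N a p
  proof -
    define q where "q = (\<Sum>a<N. Polynomial.monom (h a) a)"
    have pq: "poly q u = (\<Sum>a<N. h a * u ^ a)" for u by (simp add: q_def poly_sum poly_monom)
    have "Polynomial.degree q \<le> N - 1" unfolding q_def
      by (intro degree_sum_le) (auto intro: order_trans[OF degree_monom_le])
    then have "q = 0" using van pq p \<open>a < N\<close>
      by (intro poly_eq_0_of_roots[of "{x. poly p x = 0}"]) (auto simp: poly_roots_finite)
    then have "Polynomial.coeff q a = 0" by simp
    then show ?thesis using \<open>a < N\<close> by (simp add: q_def coeff_sum)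
  qed
  have f0: "f \<noteq> 0" "g \<noteq> 0" using f(3) g(3) by auto
  have "(\<Sum>b<n. c a b * v ^ b) = 0" if v: "poly g v = 0" for v
  proof (rule one[OF ab(1) _ f(5) f0(1), of "\<lambda>a. \<Sum>b<n. c a b * v ^ b"])
    fix u assume "poly f u = 0"
    from assms(1)[OF this v] show "(\<Sum>a<m. (\<Sum>b<n. c a b * v ^ b) * u ^ a) = 0"
      by (simp add: sum_distrib_right sum_distrib_left mult_ac)
  qed
  then show ?thesis by (rule one[OF ab(2) _ g(5) f0(2)])
qed

text \<open>
  The minimal polynomial of \<open>Z\<close> in the algebra of functions is the product of \<open>X - w\<close> over its distinct values.
  The linear system for its coefficients has coefficients in \<open>k\<close>; project a solution to \<open>k\<close>.
\<close>

lemma value_separable: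
  assumes Z: "rep Z z" and xy: "poly f x = 0" "poly g y = 0"
  shows "Z x y \<in> sep_closure_of k"
proof -
  define W where "W = (\<lambda>(u, v). Z u v) ` ({u. poly f u = 0} \<times> {v. poly g v = 0})"
  have f0: "f \<noteq> 0" "g \<noteq> 0" using f(3) g(3) by auto
  have finW: "finite W" using f0 by (auto simp: W_def poly_roots_finite)
  define P where "P = (\<Prod>w\<in>W. [:- w, 1:])"
  define e where "e = card W"
  have degP: "Polynomial.degree P = e" by (simp add: P_def e_def degree_prod_eq_sum_degree)
  have leadP: "Polynomial.coeff P e = 1" using lead_coeff_prod[of "\<lambda>w. [:- w, 1:]" W] degP by (simp add: P_def)
  obtain c where c: "\<And>i. rep (\<lambda>u v. Z u v ^ i) (c i)" using rep_power[OF Z] by metis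
  have ck: "c i a b \<in> k" for i a b using c[of i] by (simp add: rep_def)
  have Zc: "Z u v ^ i = (\<Sum>a<m. \<Sum>b<n. c i a b * (u ^ a * v ^ b))" if "poly f u = 0" "poly g v = 0" for i u v
    using c[of i] that by (simp add: rep_def)
  have comb: "(\<Sum>i\<le>e. s i * Z u v ^ i) = (\<Sum>a<m. \<Sum>b<n. (\<Sum>i\<le>e. s i * c i a b) * (u ^ a * v ^ b))"
    if "poly f u = 0" "poly g v = 0" for s u v
  proof -
    have "(\<Sum>i\<le>e. s i * Z u v ^ i) = (\<Sum>i\<le>e. \<Sum>a<m. \<Sum>b<n. s i * c i a b * (u ^ a * v ^ b))"
      by (simp add: Zc[OF that] sum_distrib_left mult.assoc)
    also have "\<dots> = (\<Sum>a<m. \<Sum>i\<le>e. \<Sum>b<n. s i * c i a b * (u ^ a * v ^ b))" by (rule sum.swap)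
    also have "\<dots> = (\<Sum>a<m. \<Sum>b<n. \<Sum>i\<le>e. s i * c i a b * (u ^ a * v ^ b))"
      by (intro sum.cong refl sum.swap)
    finally show ?thesis by (simp add: sum_distrib_right)
  qed
  have P0: "(\<Sum>i\<le>e. Polynomial.coeff P i * c i a b) = 0" if "a < m" "b < n" for a b
  proof (rule monomials_independent[OF _ that])
    fix u v assume r: "poly f u = 0" "poly g v = 0"
    then have "Z u v \<in> W" by (auto simp: W_def)
    then have "poly P (Z u v) = 0" using finW by (auto simp: P_def poly_prod)
    then have "(\<Sum>i\<le>e. Polynomial.coeff P i * Z u v ^ i) = 0" by (simp add: poly_altdef degP)
    then show "(\<Sum>a<m. \<Sum>b<n. (\<Sum>i\<le>e. Polynomial.coeff P i * c i a b) * (u ^ a * v ^ b)) = 0"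
      by (simp add: comb[OF r])
  qed
  have spk: "subspc k k" using sr by (intro subspc_subring) auto
  \<comment> \<open>Each coefficient of \<open>P\<close> is an element \<open>q i\<close> of
    \<open>k\<close> plus a combination of coefficients that are independent modulo
    \<open>k\<close>. As the linear system has coefficients in \<open>k\<close>, the part
    \<open>q\<close> solves it by itself.\<close>
  obtain J d where J: "J \<subseteq> {..e}" "indep_mod k k J (Polynomial.coeff P)"
    and d: "\<forall>i\<in>{..e}. (\<forall>j\<in>J. d i j \<in> k) \<and> Polynomial.coeff P i - (\<Sum>j\<in>J. d i j * Polynomial.coeff P j) \<in> k"
    using maximal_indep_mod[OF k spk finite_atMost, of e "Polynomial.coeff P"] by blast
  define q where "q i = Polynomial.coeff P i - (\<Sum>j\<in>J. d i j * Polynomial.coeff P j)" for i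
  have qk: "q i \<in> k" if "i \<le> e" for i using d that by (simp add: q_def)
  have dk: "d i j \<in> k" if "i \<le> e" "j \<in> J" for i j using d that by simp
  have q0: "(\<Sum>i\<le>e. q i * c i a b) = 0" if ab: "a < m" "b < n" for a b
  proof -
    have split: "(\<Sum>i\<le>e. Polynomial.coeff P i * c i a b) =
        (\<Sum>i\<le>e. q i * c i a b) + (\<Sum>j\<in>J. (\<Sum>i\<le>e. d i j * c i a b) * Polynomial.coeff P j)"
    proof -
      have "(\<Sum>j\<in>J. (\<Sum>i\<le>e. d i j * c i a b) * Polynomial.coeff P j) = (\<Sum>i\<le>e. (\<Sum>j\<in>J. d i j * Polynomial.coeff P j) * c i a b)"
        unfolding sum_distrib_right by (subst sum.swap) (simp add: mult_ac)
      then show ?thesis by (simp add: q_def sum.distrib[symmetric] distrib_right[symmetric])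
    qed
    have "(\<Sum>i\<le>e. q i * c i a b) \<in> k" using qk ck by (intro sr_sum[OF sr] sr_mult[OF sr]) auto
    then have "- (\<Sum>i\<le>e. q i * c i a b) \<in> k" by (rule sr_minus[OF sr])
    moreover have "(\<Sum>j\<in>J. (\<Sum>i\<le>e. d i j * c i a b) * Polynomial.coeff P j) = - (\<Sum>i\<le>e. q i * c i a b)"
      using split P0[OF ab] by (simp add: eq_neg_iff_add_eq_0 add.commute)
    ultimately have s: "(\<Sum>j\<in>J. (\<Sum>i\<le>e. d i j * c i a b) * Polynomial.coeff P j) \<in> k" by simp
    have "(\<Sum>i\<le>e. d i j * c i a b) = 0" if "j \<in> J" for j
    proof (rule indep_modD[OF J(2) _ s that])
      fix j assume "j \<in> J"
      then show "(\<Sum>i\<le>e. d i j * c i a b) \<in> k" using dk ck by (intro sr_sum[OF sr] sr_mult[OF sr]) auto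
    qed
    then show ?thesis using split P0[OF ab] by simp
  qed
  have qe: "q e = 1"
  proof -
    have "(\<Sum>j\<in>J. d e j * Polynomial.coeff P j) = 1 - q e" using leadP by (simp add: q_def)
    then have "(\<Sum>j\<in>J. d e j * Polynomial.coeff P j) \<in> k" using qk[of e] sr_diff[OF sr sr_1[OF sr]] by simp
    then have "d e j = 0" if "j \<in> J" for j
      using indep_modD[OF J(2), of "d e" j] dk that by auto
    then show ?thesis using leadP by (simp add: q_def)
  qed
  define Q where "Q = (\<Sum>i\<le>e. Polynomial.monom (q i) i)"
  have Qk: "Q \<in> poly_over k" unfolding Q_def using qk by (intro poly_over_sum[OF sr] poly_over_monom[OF sr]) auto
  have coeffQ: "Polynomial.coeff Q i = (if i \<le> e then q i else 0)" for i by (simp add: Q_def coeff_sum)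
  \<comment> \<open>Both are monic of degree \<open>e\<close> and vanish at the \<open>e\<close>
    distinct values, so their difference has more roots than its degree allows.\<close>
  have "Q - P = 0"
  proof (rule poly_eq_0_of_roots[OF finW])
    have "W \<noteq> {}" using xy by (auto simp: W_def)
    then have e0: "e > 0" using finW by (simp add: e_def card_gt_0_iff)
    have "Polynomial.degree (Q - P) \<le> e - 1"
    proof (rule degree_le, intro allI impI)
      fix i assume "e - 1 < i"
      then have "i \<ge> e" using e0 by simp
      then show "Polynomial.coeff (Q - P) i = 0"
        using coeffQ qe leadP degP by (cases "i = e") (auto simp: coeff_eq_0)
    qed
    then show "Polynomial.degree (Q - P) < card W" using e0 by (simp add: e_def)
    fix w assume w: "w \<in> W"
    then obtain u v where r: "poly f u = 0" "poly g v = 0" "w = Z u v" by (auto simp: W_def)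
    have "poly Q w = (\<Sum>i\<le>e. q i * Z u v ^ i)" by (simp add: Q_def poly_sum poly_monom r)
    also have "\<dots> = 0" using q0 by (simp add: comb[OF r(1,2)])
    finally have "poly Q w = 0" .
    moreover have "poly P w = 0" using w finW by (auto simp: P_def poly_prod)
    ultimately show "poly (Q - P) w = 0" by simp
  qed
  then have "P \<in> poly_over k" using Qk by simp
  moreover have "rsquarefree P" unfolding P_def by (rule rsquarefree_prod_linear[OF finW])
  moreover have "Z x y \<in> W" using xy by (auto simp: W_def)
  then have "poly P (Z x y) = 0" using finW by (auto simp: P_def poly_prod)
  ultimately show ?thesis unfolding sep_closure_of_def by blast
qed

end

lemma sep_closure_monic:
  assumes k: "subfield k \<Omega>" and x: "x \<in> sep_closure_of k"
  obtains f m where "f \<in> poly_over k" "Polynomial.degree f = m" "Polynomial.lead_coeff f = 1" "m > 0"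
    "card {x. poly f x = 0} = m" "poly f x = 0"
proof -
  obtain p where p: "p \<in> poly_over k" "rsquarefree p" "poly p x = 0" using x by (auto simp: sep_closure_of_def)
  have p0: "p \<noteq> 0" using p(2) by (simp add: rsquarefree_def)
  define l where "l = inverse (Polynomial.lead_coeff p)"
  have l: "l \<noteq> 0" "l \<in> k" using p0 p(1) k by (auto simp: l_def poly_over_def intro: sf_inverse)
  show ?thesis
  proof (rule that[of "Polynomial.smult l p" "Polynomial.degree p"])
    show "Polynomial.smult l p \<in> poly_over k" using l p sf_sr[OF k] by (intro poly_over_smult)
    show "Polynomial.degree p > 0"
    proof (rule ccontr)
      assume "\<not> ?thesis"
      then obtain a where "p = [:a:]" by (auto elim: degree_eq_zeroE)
      with p p0 show False by simp
    qed
    show "card {x. poly (Polynomial.smult l p) x = 0} = Polynomial.degree p"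
      using card_roots_rsquarefree[OF p(2)] l by simp
  qed (use l p p0 in \<open>auto simp: l_def\<close>)
qed

lemma sep_closure_subfield:
  assumes k: "subfield k \<Omega>"
  shows "subfield (sep_closure_of k) \<Omega>" "k \<subseteq> sep_closure_of k" "sep_closure_of k \<subseteq> alg_closure_of k"
proof -
  have sr: "subring k \<Omega>" using k by (rule sf_sr)
  show kS: "k \<subseteq> sep_closure_of k"
  proof
    fix c assume "c \<in> k"
    then have "[:- c, 1:] \<in> poly_over k" using sr by (auto intro: sr_intros poly_over_0)
    moreover have "rsquarefree [:- c, 1:]" using rsquarefree_prod_linear[of "{c}"] by simp
    ultimately show "c \<in> sep_closure_of k" unfolding sep_closure_of_def by (intro CollectI bexI[of _ "[:- c, 1:]"]) auto
  qed
  show SA: "sep_closure_of k \<subseteq> alg_closure_of k"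
    by (auto simp: sep_closure_of_def alg_closure_of_iff[OF k] rsquarefree_def)
  have two: "x + y \<in> sep_closure_of k \<and> x * y \<in> sep_closure_of k \<and> - x \<in> sep_closure_of k \<and> inverse x \<in> sep_closure_of k"
    if xy: "x \<in> sep_closure_of k" "y \<in> sep_closure_of k" for x y
  proof -
    obtain f m where f: "f \<in> poly_over k" "Polynomial.degree f = m" "Polynomial.lead_coeff f = 1" "m > 0"
      "card {x. poly f x = 0} = m" "poly f x = 0" by (rule sep_closure_monic[OF k xy(1)])
    obtain g n where g: "g \<in> poly_over k" "Polynomial.degree g = n" "Polynomial.lead_coeff g = 1" "n > 0"
      "card {x. poly g x = 0} = n" "poly g y = 0" by (rule sep_closure_monic[OF k xy(2)])
    interpret r: root_functions k f g m n by (rule root_functions.intro) (rule k f g)+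
    obtain cu where u: "r.rep (\<lambda>u v. u) cu" using r.rep_u[OF r.rep_1] by auto
    obtain cv where v: "r.rep (\<lambda>u v. v) cv" using r.rep_v[OF r.rep_1] by auto
    have "x + y \<in> sep_closure_of k" by (rule r.value_separable[OF r.rep_add[OF u v] f(6) g(6)])
    moreover obtain c where "r.rep (\<lambda>u v. u * v) c" using r.rep_mult[OF u v] by blast
    then have "x * y \<in> sep_closure_of k" by (rule r.value_separable[OF _ f(6) g(6)])
    moreover have "- 1 \<in> k" using sr by (auto intro: sr_intros)
    then have "- 1 * x \<in> sep_closure_of k" by (rule r.value_separable[OF r.rep_scale[OF u] f(6) g(6)])
    \<comment> \<open>The inverse is a polynomial in \<open>x\<close> over \<open>k\<close>, hence
      also a value of a function in the algebra.\<close>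
    moreover obtain q where q: "q \<in> poly_over k" "inverse x = poly q x" using inverse_algebraic[OF k] SA xy(1) by blast
    have "\<exists>c. r.rep (\<lambda>u v. \<Sum>i\<le>Polynomial.degree q. Polynomial.coeff q i * u ^ i) c"
    proof (rule r.rep_sum)
      fix i
      show "\<exists>c. r.rep (\<lambda>u v. Polynomial.coeff q i * u ^ i) c"
        using r.rep_power[OF u, of i] r.rep_scale q(1) unfolding poly_over_def by blast
    qed simp
    then obtain c where "r.rep (\<lambda>u v. \<Sum>i\<le>Polynomial.degree q. Polynomial.coeff q i * u ^ i) c" by blast
    then have "(\<Sum>i\<le>Polynomial.degree q. Polynomial.coeff q i * x ^ i) \<in> sep_closure_of k"
      by (rule r.value_separable[OF _ f(6) g(6)])
    then have "inverse x \<in> sep_closure_of k" by (simp add: q(2) poly_altdef)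
    ultimately show ?thesis by simp
  qed
  show "subfield (sep_closure_of k) \<Omega>"
    unfolding subfield_Omega_iff subring_Omega_iff using two kS sr_1[OF sr] by blast
qed

subsection \<open>The base change of a smooth curve to the separable closure\<close>

lemma integral_over_mono: "integral_over A z \<Longrightarrow> A \<subseteq> B \<Longrightarrow> integral_over B z"
  unfolding integral_over_def using poly_over_mono by blast

context dplace
begin

lemma valring_restrict_eq:
  assumes V: "subring V \<Omega>" "R \<subseteq> V" and ne: "\<not> K \<subseteq> V"
  shows "V \<inter> K = R"
proof (rule ccontr)
  assume "V \<inter> K \<noteq> R"
  moreover have "subring (V \<inter> K) \<Omega>"
    using V(1) K by (auto simp: subring_Omega_iff subfield_Omega_iff)
  moreover have "R \<subseteq> V \<inter> K" using V(2) RK by blast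
  ultimately have "V \<inter> K = K" using maximal[of "V \<inter> K"] by blast
  with ne show False by blast
qed

end

text \<open>Disjointness and smoothness are stated over \<open>C\<close>, while gonal maps live over
  \<open>L\<close>, which may be smaller than \<open>C\<close> in positive characteristic.
  Properties over \<open>C\<close> come down to \<open>L\<close> by intersecting spans.\<close>

locale curve =
  fixes k K L C K' :: "'a::alg_closed_field set"
  assumes smooth: "smooth_curve k K"
    and L_def: "L = sep_closure_of k" and C_def: "C = alg_closure_of k" and K'_def: "K' = base_change_sep k K"
begin

lemma ffk: "function_field k K"
  using smooth by (simp add: smooth_curve_def)

lemma k: "subfield k \<Omega>" and K: "subfield K \<Omega>" and kK: "k \<subseteq> K"
  using function_fieldD[OF ffk] by auto

lemma L: "subfield L \<Omega>" and kL: "k \<subseteq> L" and LC: "L \<subseteq> C"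
  using sep_closure_subfield[OF k] by (auto simp: L_def C_def)

lemma C: "subfield C \<Omega>" and kC: "k \<subseteq> C"
  using alg_closure_of_subfield[OF k] by (auto simp: C_def)

lemma Lr: "subring L \<Omega>" and Cr: "subring C \<Omega>" and kr: "subring k \<Omega>" and Kr: "subring K \<Omega>"
  using L C k K by (auto intro: sf_sr)

lemma K'_eq: "K' = lspan L K"
  unfolding K'_def base_change_sep_def L_def[symmetric]
  by (rule compositum_eq_lspan[OF k K kK L LC[unfolded C_def]])

lemma K': "subfield K' \<Omega>"
  unfolding K'_def base_change_sep_def compositum_def by (rule generate_field_props(1))

lemma K'r: "subring K' \<Omega>" using K' by (rule sf_sr)

lemma KK': "K \<subseteq> K'" and LK': "L \<subseteq> K'"
  unfolding K'_eq using lspan_incl[OF sr_1[OF Lr]] lspan_incl'[OF sr_1[OF Kr]] by auto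

lemma C_L: "alg_closure_of L = C"
  unfolding C_def by (rule alg_closure_of_trans[OF k L kL LC[unfolded C_def]])

sublocale D: disjoint_exts k K C
  using smooth by (intro disjoint_exts.intro k K C kK kC) (simp add: smooth_curve_def C_def)

sublocale D': disjoint_exts L K' C
  unfolding K'_eq by (rule D.base_change[OF L kL LC]) (rule K'[unfolded K'_eq])

lemma ffL: "function_field L K'"
  unfolding K'_eq by (rule function_field_base_change[OF ffk L kL LC[unfolded C_def] K'[unfolded K'_eq]])

sublocale F: ffield k K by (rule function_field_ffield[OF ffk])

sublocale F': ffield L K' by (rule function_field_ffield[OF ffL])

lemma spk: "k \<subseteq> A \<Longrightarrow> subring A \<Omega> \<Longrightarrow> subspc k A"
  by (intro subspc_subring)

text \<open>An element of \<open>K\<close> and of \<open>C\<close> lies in both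
  \<open>k \<otimes> K\<close> and \<open>C \<otimes> k\<close>, whose intersection is
  \<open>k\<close>.\<close>

lemma const: "K \<inter> C \<subseteq> k"
proof
  fix z assume z: "z \<in> K \<inter> C"
  have "z \<in> lspan k (K \<inter> k)"
  proof (rule D.lspan_Int1)
    show "z \<in> lspan k K" using z lspan_incl[OF sr_1[OF kr], of K] by blast
    show "z \<in> lspan C k" using z lspan_incl'[OF sr_1[OF kr], of C] by blast
  qed (use kC kK kr Kr in \<open>auto intro: spk\<close>)
  moreover have "lspan k (K \<inter> k) \<subseteq> k" by (rule lspan_minimal) (auto intro: spk kr)
  ultimately show "z \<in> k" by blast
qed

lemma const': "K' \<inter> C \<subseteq> L"
proof
  fix z assume z: "z \<in> K' \<inter> C"
  have "z \<in> lspan L (K' \<inter> L)"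
  proof (rule D'.lspan_Int1)
    show "z \<in> lspan L K'" using z lspan_incl[OF sr_1[OF Lr], of K'] by blast
    show "z \<in> lspan C L" using z lspan_incl'[OF sr_1[OF Lr], of C] by blast
  qed (use LC LK' Lr K'r in \<open>auto intro: subspc_subring\<close>)
  moreover have "lspan L (K' \<inter> L) \<subseteq> L" by (rule lspan_minimal) (auto intro: subspc_subring Lr)
  ultimately show "z \<in> L" by blast
qed

lemma smooth_at_C:
  assumes R: "R \<in> places k K" and z: "z \<in> lspan C K" "integral_over (lspan C R) z"
  shows "z \<in> lspan C R"
proof -
  have "smooth_at k K R" using smooth R by (simp add: smooth_curve_def)
  moreover have "compositum K C = lspan C K"
    by (rule compositum_eq_lspan[OF k K kK C]) (simp add: C_def)
  moreover have "generate_ring \<Omega> (R \<union> C) = lspan C R"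
    by (rule generate_ring_Un[OF Cr F.placeD(1)[OF R]])
  ultimately show ?thesis using z by (simp add: smooth_at_def C_def[symmetric])
qed

text \<open>Smoothness puts \<open>z\<close> into \<open>C \<otimes> R\<close>, and the intersection
  of this ring with \<open>L \<otimes> K\<close> is \<open>L \<otimes> R\<close>.\<close>

lemma integral_closed_L:
  assumes R: "R \<in> places k K" and z: "z \<in> K'" "integral_over (lspan L R) z"
  shows "z \<in> lspan L R"
proof -
  note pl = F.placeD[OF R]
  have "z \<in> lspan C R"
    using z lspan_mono[OF LC order_refl] unfolding K'_eq
    by (intro smooth_at_C[OF R] integral_over_mono[OF z(2)]) auto
  then have "z \<in> lspan L (K \<inter> R)"
    using z(1) unfolding K'_eq
    by (intro D.lspan_Int1) (use LC kL kK pl Lr Kr in \<open>auto intro: spk\<close>)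
  moreover have "K \<inter> R = R" using pl by blast
  ultimately show ?thesis by simp
qed

lemma lspan_R_props:
  assumes R: "R \<in> places k K"
  shows "subring (lspan L R) \<Omega>" "R \<subseteq> lspan L R" "L \<subseteq> lspan L R" "lspan L R \<subseteq> K'"
proof -
  note pl = F.placeD[OF R]
  show "subring (lspan L R) \<Omega>" by (rule subring_lspan[OF Lr pl(1)])
  show "R \<subseteq> lspan L R" "L \<subseteq> lspan L R" using lspan_incl[OF sr_1[OF Lr]] lspan_incl'[OF sr_1[OF pl(1)]] by auto
  show "lspan L R \<subseteq> K'" unfolding K'_eq by (rule lspan_mono[OF order_refl pl(3)])
qed

lemma K_not_in_place:
  assumes "V \<in> places L K'" shows "\<not> K \<subseteq> V"
proof
  assume "K \<subseteq> V"
  moreover note pl = F'.placeD[OF assms]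
  ultimately have "K' \<subseteq> V" unfolding K'_eq by (intro lspan_minimal subspc_subring)
  then show False using pl by blast
qed

text \<open>Since \<open>L \<otimes> R\<close> is integrally closed, valuation rings detect its
  elements: it is the intersection of the places above \<open>R\<close>. Most uses of smoothness
  pass through this form.\<close>

lemma place_above:
  assumes R: "R \<in> places k K" and z: "z \<in> K'" "z \<notin> lspan L R"
  shows "\<exists>V\<in>places L K'. V \<inter> K = R \<and> z \<notin> V"
proof -
  note lp = lspan_R_props[OF R]
  have "\<not> integral_over (lspan L R) z" using integral_closed_L[OF R z(1)] z(2) by blast
  then obtain V where V: "valring V K'" "lspan L R \<subseteq> V" "z \<notin> V"
    using chevalley[OF lp(1,4) K' z(1)] by blast
  then have Vp: "V \<in> places L K'" using lp z by (auto simp: places_iff)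
  have "V \<inter> K = R"
    using V lp K_not_in_place[OF Vp] by (intro dplace.valring_restrict_eq[OF F.place_dplace[OF R]]) (auto simp: valring_def)
  with Vp V show ?thesis by blast
qed

lemma place_restrict:
  assumes V: "V \<in> places L K'"
  shows "V \<inter> K \<in> places k K"
proof -
  note pl = F'.placeD[OF V]
  have "subring (V \<inter> K) \<Omega>" using pl(1) Kr by (auto simp: subring_Omega_iff)
  moreover have "x \<in> V \<inter> K \<or> inverse x \<in> V \<inter> K" if "x \<in> K" for x
    using that pl(5) KK' sf_inverse[OF K that] by (auto simp: valring_def)
  moreover have "V \<inter> K \<noteq> K" using K_not_in_place[OF V] by blast
  ultimately show ?thesis using pl(2) kL kK by (auto simp: places_iff valring_def)
qed

text \<open>Normalise an equation of \<open>f\<close> over \<open>K\<close> to constant term 1. At a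
  zero of \<open>f\<close> not all other coefficients can be integral, so the place below is a pole
  of one of these finitely many functions of \<open>K\<close>.\<close>

lemma finite_zeros_restrict:
  assumes f: "f \<in> K'" "f \<noteq> 0"
  shows "finite ((\<lambda>V. V \<inter> K) ` {V \<in> places L K'. f \<in> max_ideal V})"
proof -
  have "C \<subseteq> alg_closure_of K" unfolding C_def by (rule alg_closure_of_mono[OF k K kK])
  then have "K' \<subseteq> alg_closure_of K"
    unfolding K'_eq using LC alg_closure_of_subfield[OF K]
    by (intro lspan_minimal subspc_subring) (auto intro: sf_sr)
  then have "\<exists>p. p \<in> poly_over K \<and> p \<noteq> 0 \<and> poly p f = 0" using f(1) alg_closure_of_iff[OF K] by blast
  then obtain p where p: "p \<in> poly_over K" "p \<noteq> 0" "poly p f = 0"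
    and least: "\<And>q. q \<in> poly_over K \<Longrightarrow> q \<noteq> 0 \<Longrightarrow> poly q f = 0 \<Longrightarrow> Polynomial.degree p \<le> Polynomial.degree q"
    using ex_has_least_nat[of "\<lambda>p. p \<in> poly_over K \<and> p \<noteq> 0 \<and> poly p f = 0" _ Polynomial.degree] by metis
  define c where "c = Polynomial.coeff p 0"
  \<comment> \<open>Otherwise \<open>f\<close> could be cancelled and the equation would not have
    least degree.\<close>
  have c0: "c \<noteq> 0"
  proof
    assume "c = 0"
    then obtain q where q: "p = pCons 0 q" unfolding c_def by (metis coeff_pCons_0 pCons_cases)
    then have "q \<noteq> 0" "poly q f = 0" "q \<in> poly_over K" using p f by auto
    then have "Polynomial.degree p \<le> Polynomial.degree q" by (intro least)
    then show False using q \<open>q \<noteq> 0\<close> by (simp add: degree_pCons_eq)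
  qed
  have cK: "Polynomial.coeff p i \<in> K" for i using p(1) by (simp add: poly_over_def)
  define a where "a i = Polynomial.coeff p i / c" for i
  have aK: "a i \<in> K" for i using cK K by (auto simp: a_def c_def intro: sf_divide)
  define n where "n = Polynomial.degree p"
  have one: "1 = - (\<Sum>i<n. a (Suc i) * f ^ Suc i)"
  proof -
    have "poly p f = c + (\<Sum>i<n. Polynomial.coeff p (Suc i) * f ^ Suc i)"
      by (simp add: poly_altdef c_def n_def sum.lessThan_Suc_shift lessThan_Suc_atMost[symmetric] del: sum.lessThan_Suc)
    then have "0 = (c + (\<Sum>i<n. Polynomial.coeff p (Suc i) * f ^ Suc i)) / c" using p(3) by simp
    also have "\<dots> = 1 + (\<Sum>i<n. a (Suc i) * f ^ Suc i)"
      using c0 by (simp add: add_divide_distrib sum_divide_distrib a_def)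
    finally show ?thesis by (simp add: eq_neg_iff_add_eq_0)
  qed
  have "(\<lambda>V. V \<inter> K) ` {V \<in> places L K'. f \<in> max_ideal V}
     \<subseteq> (\<Union>i\<in>{i. i < n \<and> a (Suc i) \<noteq> 0}. {R \<in> places k K. inverse (a (Suc i)) \<in> max_ideal R})"
  proof safe
    fix V assume V: "V \<in> places L K'" "f \<in> max_ideal V"
    note pl = F'.placeD[OF V(1)]
    have "\<exists>i<n. a (Suc i) \<notin> V"
    proof (rule ccontr)
      assume "\<not> ?thesis"
      then have aV: "a (Suc i) \<in> V" if "i < n" for i using that by blast
      have fV: "f \<in> V" using V(2) by (simp add: max_ideal_iff)
      have "a (Suc i) * f ^ Suc i \<in> max_ideal V" if "i < n" for i
      proof -
        have "(a (Suc i) * f ^ i) * f \<in> max_ideal V"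
          using aV[OF that] fV by (intro max_ideal_mult[OF pl(1) _ V(2)] sr_mult[OF pl(1)] sr_power[OF pl(1)])
        then show ?thesis by (simp add: mult_ac)
      qed
      then have "1 \<in> max_ideal V"
        by (subst one) (intro max_ideal_minus[OF pl(1)] max_ideal_sum[OF pl(5) K'], auto)
      then show False by simp
    qed
    then obtain i where i: "i < n" "a (Suc i) \<notin> V" by blast
    then have "a (Suc i) \<noteq> 0" using sr_0[OF pl(1)] by auto
    moreover have "inverse (a (Suc i)) \<in> max_ideal (V \<inter> K)"
    proof -
      have "inverse (a (Suc i)) \<in> V" using i(2) pl(5) aK KK' by (auto simp: valring_def)
      then show ?thesis using i(2) sf_inverse[OF K aK] by (auto simp: max_ideal_iff)
    qed
    ultimately show "V \<inter> K \<in> (\<Union>i\<in>{i. i < n \<and> a (Suc i) \<noteq> 0}. {R \<in> places k K. inverse (a (Suc i)) \<in> max_ideal R})"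
      using place_restrict[OF V(1)] i(1) by blast
  qed
  moreover have "finite (\<Union>i\<in>{i. i < n \<and> a (Suc i) \<noteq> 0}. {R \<in> places k K. inverse (a (Suc i)) \<in> max_ideal R})"
    using aK by (intro finite_UN_I F.finite_zeros) (auto intro: sf_inverse[OF K])
  ultimately show ?thesis by (rule finite_subset)
qed

end

subsection \<open>Castelnuovo's inequality\<close>

lemma poly_div_pole:
  assumes V: "subring V \<Omega>" "L \<subseteq> V" and w: "inverse x \<in> V" "x \<noteq> 0" and p: "p \<in> poly_over L" "Polynomial.degree p \<le> N"
  shows "poly p x / x ^ N \<in> V"
proof -
  have "poly p x / x ^ N = (\<Sum>i\<le>Polynomial.degree p. Polynomial.coeff p i * inverse x ^ (N - i))"
    unfolding poly_altdef sum_divide_distrib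
  proof (intro sum.cong refl)
    fix i assume "i \<in> {..Polynomial.degree p}"
    then have "x ^ N = x ^ (N - i) * x ^ i" using p(2) by (simp add: power_add[symmetric])
    then show "Polynomial.coeff p i * x ^ i / x ^ N = Polynomial.coeff p i * inverse x ^ (N - i)"
      using w(2) by (simp add: power_inverse field_simps)
  qed
  also have "\<dots> \<in> V" using V w p(1) by (intro sr_sum[OF V(1)] sr_mult[OF V(1)] sr_power[OF V(1)]) (auto simp: poly_over_def)
  finally show ?thesis .
qed

text \<open>At a pole of \<open>x\<close> the leading term dominates: after division by the power of
  \<open>x\<close>, the lower terms fall into the maximal ideal and the leading coefficient is a
  unit.\<close>

lemma poly_pole_unit:
  assumes L: "subfield L \<Omega>" and V: "valring V F" "subfield F \<Omega>" "L \<subseteq> V" and x: "x \<in> F" "x \<notin> V"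
    and p: "p \<in> poly_over L" "p \<noteq> 0"
  shows "poly p x \<noteq> 0" "x ^ Polynomial.degree p / poly p x \<in> V"
proof -
  have sr: "subring V \<Omega>" using V by (simp add: valring_def)
  have x0: "x \<noteq> 0" using x(2) sr_0[OF sr] by auto
  have w: "inverse x \<in> V" using V x by (auto simp: valring_def)
  then have wm: "inverse x \<in> max_ideal V" using x(2) by (simp add: max_ideal_iff)
  define d where "d = Polynomial.degree p"
  define c where "c = Polynomial.lead_coeff p"
  define q where "q = p - Polynomial.monom c d"
  have cL: "c \<in> L" "c \<noteq> 0" using p by (auto simp: c_def poly_over_def)
  have qL: "q \<in> poly_over L" unfolding q_def using p(1) cL by (intro poly_over_diff poly_over_monom sf_sr[OF L])
  have px: "poly p x = c * x ^ d + poly q x" by (simp add: q_def poly_monom)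
  have "poly q x / x ^ d \<in> max_ideal V"
  proof (cases d)
    case 0
    then obtain a where "p = [:a:]" by (auto simp: d_def elim: degree_eq_zeroE)
    then have "q = 0" by (simp add: q_def c_def 0 monom_0)
    then show ?thesis using max_ideal_0[OF sr] by simp
  next
    case (Suc e)
    have "Polynomial.degree q \<le> e"
    proof (rule degree_le, intro allI impI)
      fix i assume "e < i"
      then show "Polynomial.coeff q i = 0" using Suc by (cases "i = d") (auto simp: q_def c_def d_def coeff_eq_0)
    qed
    then have "poly q x / x ^ e \<in> V" by (intro poly_div_pole[OF sr V(3) w x0 qL])
    then have "poly q x / x ^ e * inverse x \<in> max_ideal V" using wm by (rule max_ideal_mult[OF sr])
    then show ?thesis using x0 Suc by (simp add: field_simps)
  qed
  then have m: "poly q x / x ^ d \<in> max_ideal V" .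
  define u where "u = poly p x / x ^ d"
  have u: "u = c + poly q x / x ^ d" using x0 by (simp add: u_def px add_divide_distrib)
  have "u \<notin> max_ideal V"
  proof
    assume "u \<in> max_ideal V"
    then have "u + - (poly q x / x ^ d) \<in> max_ideal V"
      by (intro max_ideal_add[OF V(1,2)] max_ideal_minus[OF sr] m)
    then have "c \<in> max_ideal V" by (simp add: u)
    moreover have "inverse c \<in> V" using cL V(3) sf_inverse[OF L] by blast
    ultimately show False using cL by (simp add: max_ideal_iff)
  qed
  moreover have "u \<in> V" unfolding u using cL V(3) m by (intro sr_add[OF sr]) (auto simp: max_ideal_iff)
  ultimately have ui: "u \<noteq> 0" "inverse u \<in> V" by (auto simp: max_ideal_iff)
  then show "poly p x \<noteq> 0" by (auto simp: u_def)
  show "x ^ Polynomial.degree p / poly p x \<in> V" using ui(2) by (simp add: u_def d_def)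
qed

text \<open>The divisor is given by local equations: \<open>- ord_at V (e V)\<close> bounds the pole order at \<open>V\<close>.\<close>

definition fracmod :: "'a::alg_closed_field set \<Rightarrow> 'a set set \<Rightarrow> ('a set \<Rightarrow> 'a) \<Rightarrow> 'a set"
  where "fracmod F T e = {z \<in> F. \<forall>V\<in>T. z / e V \<in> V}"

lemma subspc_fracmod:
  assumes F: "subring F \<Omega>" "L \<subseteq> F" and T: "\<And>V. V \<in> T \<Longrightarrow> subring V \<Omega> \<and> L \<subseteq> V"
  shows "subspc L (fracmod F T e)"
  unfolding subspc_def
proof (intro conjI ballI)
  show "0 \<in> fracmod F T e" using F T by (auto simp: fracmod_def intro: sr_0)
  show "x + y \<in> fracmod F T e" if "x \<in> fracmod F T e" "y \<in> fracmod F T e" for x y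
    using that F T by (auto simp: fracmod_def add_divide_distrib intro: sr_add)
  fix c x assume c: "c \<in> L" and x: "x \<in> fracmod F T e"
  have "c * (x / e V) \<in> V" if "V \<in> T" for V
    using that x c T by (intro sr_mult) (auto simp: fracmod_def)
  then show "c * x \<in> fracmod F T e" using x c F by (auto simp: fracmod_def intro: sr_mult)
qed

lemma fracmod_mono:
  assumes T: "\<And>V. V \<in> T \<Longrightarrow> subring V \<Omega>" "\<And>V. V \<in> T \<Longrightarrow> e V \<noteq> 0" "\<And>V. V \<in> T \<Longrightarrow> e V / e' V \<in> V"
  shows "fracmod F T e \<subseteq> fracmod F T e'"
proof
  fix z assume z: "z \<in> fracmod F T e"
  have "z / e' V \<in> V" if V: "V \<in> T" for V
  proof -
    have "(z / e V) * (e V / e' V) \<in> V" using z T V by (intro sr_mult) (auto simp: fracmod_def)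
    then show ?thesis using T(2)[OF V] by simp
  qed
  then show "z \<in> fracmod F T e'" using z by (simp add: fracmod_def)
qed

context ffield
begin

text \<open>Removing part of the zeros of \<open>f\<close> from the divisor costs at most
  \<open>[K : k(f)]\<close> dimensions. At each place the condition is either sharpened by the
  factor \<open>f\<close> or not sharpened at all; the two forms of the sum in
  \<open>not_dim_ge_step\<close> serve these two cases.\<close>

lemma fracmod_step:
  assumes T: "T \<subseteq> places k K" and f: "f \<noteq> 0" and N: "polydep k K f N"
    and e: "\<And>V. V \<in> T \<Longrightarrow> e V \<noteq> 0"
    and e': "\<And>V. V \<in> T \<Longrightarrow> (f \<in> V \<and> e' V = e V * f) \<or> e V / e' V \<in> V"
  shows "\<not> dim_ge k (fracmod K T e) (fracmod K T e') (Suc N)"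
proof (rule not_dim_ge_step[OF N f k])
  show "fracmod K T e \<subseteq> K" by (auto simp: fracmod_def)
  fix c q v assume c: "\<And>i. i \<le> N \<Longrightarrow> c i \<in> k" and q: "\<And>i. i \<le> N \<Longrightarrow> q i \<in> poly_over k"
    and v: "\<And>i. i \<le> N \<Longrightarrow> v i \<in> fracmod K T e" and eq: "(\<Sum>i\<le>N. c i * v i) = f * (\<Sum>i\<le>N. poly (q i) f * v i)"
  have vK: "v i \<in> K" if "i \<le> N" for i using v[OF that] by (simp add: fracmod_def)
  have "(\<Sum>i\<le>N. c i * v i) / e' V \<in> V" if V: "V \<in> T" for V
  proof -
    have pl: "subring V \<Omega>" "k \<subseteq> V" using placeD[of V] T V by auto
    have ve: "v i / e V \<in> V" if "i \<le> N" for i using v[OF that] V by (simp add: fracmod_def)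
    from e'[OF V] show ?thesis
    proof
      assume fV: "f \<in> V \<and> e' V = e V * f"
      have "(\<Sum>i\<le>N. c i * v i) / e' V = (\<Sum>i\<le>N. poly (q i) f * (v i / e V))"
        using fV f e[OF V] by (simp add: eq sum_divide_distrib)
      also have "\<dots> \<in> V"
        using ve fV q by (intro sr_sum[OF pl(1)] sr_mult[OF pl(1)] poly_in_subring[OF pl(1) poly_over_mono[OF _ pl(2)]]) auto
      finally show ?thesis .
    next
      assume ee: "e V / e' V \<in> V"
      have "(\<Sum>i\<le>N. c i * v i) / e' V = (\<Sum>i\<le>N. c i * (v i / e V)) * (e V / e' V)"
        using e[OF V] by (simp add: sum_divide_distrib[symmetric])
      also have "\<dots> \<in> V" using ve c pl(2) ee by (intro sr_sum[OF pl(1)] sr_mult[OF pl(1)]) auto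
      finally show ?thesis .
    qed
  qed
  moreover have "(\<Sum>i\<le>N. c i * v i) \<in> K" using c vK kK by (intro sr_sum sr_mult sf_sr[OF K]) auto
  ultimately show "(\<Sum>i\<le>N. c i * v i) \<in> fracmod K T e'" by (simp add: fracmod_def)
qed

text \<open>An \<open>m\<close>-fold multiple of a divisor of zeros is removed one copy at a time;
  \<open>e (Suc j)\<close> allows one copy more than \<open>e j\<close>.\<close>

lemma fracmod_steps:
  assumes T: "T \<subseteq> places k K" and f: "f \<noteq> 0" and N: "polydep k K f N"
    and e: "\<And>j V. V \<in> T \<Longrightarrow> e j V \<noteq> 0"
    and e': "\<And>j V. V \<in> T \<Longrightarrow> (f \<in> V \<and> e j V = e (Suc j) V * f) \<or> e (Suc j) V / e j V \<in> V"
  shows "\<not> dim_ge k (fracmod K T (e m)) (fracmod K T (e 0)) (Suc (m * N))"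
proof (induction m)
  case 0
  have sp: "subspc k (fracmod K T (e 0))"
    using T placeD by (intro subspc_fracmod sf_sr[OF K] kK) blast
  have "1 \<in> k" using k by (auto intro: sr_intros)
  then show ?case using sp unfolding dim_ge_def indep_mod_def
    by (auto simp: subspc_scale dest!: spec[of _ "\<lambda>_. 1"])
next
  case (Suc m)
  have sp: "subspc k (fracmod K T e)" for e
    using T placeD by (intro subspc_fracmod sf_sr[OF K] kK) blast
  have "\<not> dim_ge k (fracmod K T (e (Suc m))) (fracmod K T (e m)) (Suc N)"
    by (rule fracmod_step[OF T f N e e'])
  from dim_le_add[OF this Suc.IH k sp sp] show ?case by simp
qed

text \<open>Here \<open>q\<close> is the constant term of an equation of \<open>t\<close> over \<open>k[x]\<close>.\<close>

lemma dominate: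
  assumes x: "x \<in> K" and N: "polydep k K x N" and t: "t \<in> K" "t \<noteq> 0"
  shows "\<exists>q s. q \<in> poly_over k \<and> q \<noteq> 0 \<and> (\<forall>V\<in>places k K. t \<in> V \<longrightarrow>
     (x \<in> V \<longrightarrow> poly q x / t \<in> V) \<and> (x \<notin> V \<longrightarrow> inverse x ^ s / t \<in> V))"
proof -
  have "\<forall>i\<le>N. t ^ i \<in> K" using t K by (auto intro: sr_intros)
  then obtain p where p: "\<And>i. i \<le> N \<Longrightarrow> p i \<in> poly_over k" "\<exists>i\<le>N. p i \<noteq> 0" "(\<Sum>i\<le>N. poly (p i) x * t ^ i) = 0"
    using N[unfolded polydep_def, rule_format, of "\<lambda>i. t ^ i"] by blast
  \<comment> \<open>Division by \<open>t ^ j\<close> makes \<open>p j\<close> the constant term, so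
    that \<open>poly q x\<close> is a multiple of \<open>t\<close> wherever \<open>x\<close> and
    \<open>t\<close> are integral.\<close>
  define j where "j = (LEAST i. i \<le> N \<and> p i \<noteq> 0)"
  have j: "j \<le> N" "p j \<noteq> 0" using LeastI_ex[OF p(2)] by (auto simp: j_def)
  have below: "p i = 0" if "i < j" for i
    using not_less_Least[of i "\<lambda>i. i \<le> N \<and> p i \<noteq> 0"] that j by (auto simp: j_def)
  define q where "q = p j"
  have key: "poly q x / t = - (\<Sum>i\<in>{Suc j..N}. poly (p i) x * t ^ (i - Suc j))"
  proof -
    have "(\<Sum>i\<le>N. poly (p i) x * t ^ i) = (\<Sum>i\<in>{j..N}. poly (p i) x * t ^ i)"
      by (rule sum.mono_neutral_right) (use below in auto)
    also have "\<dots> = poly q x * t ^ j + (\<Sum>i\<in>{Suc j..N}. poly (p i) x * t ^ i)"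
      using j(1) by (simp add: q_def sum.atLeast_Suc_atMost)
    also have "(\<Sum>i\<in>{Suc j..N}. poly (p i) x * t ^ i) = (\<Sum>i\<in>{Suc j..N}. poly (p i) x * t ^ (i - Suc j)) * t ^ Suc j"
      unfolding sum_distrib_right
    proof (intro sum.cong refl)
      fix i assume "i \<in> {Suc j..N}"
      then have "t ^ i = t ^ (i - Suc j) * t ^ Suc j" by (subst power_add[symmetric]) simp
      then show "poly (p i) x * t ^ i = poly (p i) x * t ^ (i - Suc j) * t ^ Suc j" by simp
    qed
    finally have "(poly q x + (\<Sum>i\<in>{Suc j..N}. poly (p i) x * t ^ (i - Suc j)) * t) * t ^ j = 0"
      using p(3) by (simp add: algebra_simps)
    then have "poly q x = - (\<Sum>i\<in>{Suc j..N}. poly (p i) x * t ^ (i - Suc j)) * t"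
      using t(2) by (simp add: eq_neg_iff_add_eq_0)
    then show ?thesis using t(2) by simp
  qed
  define s where "s = Max ((\<lambda>i. Polynomial.degree (p i)) ` {..N})"
  have s: "Polynomial.degree (p i) \<le> s" if "i \<le> N" for i unfolding s_def using that by (intro Max_ge) auto
  have qk: "q \<in> poly_over k" "q \<noteq> 0" using p(1) j by (auto simp: q_def)
  have "(x \<in> V \<longrightarrow> poly q x / t \<in> V) \<and> (x \<notin> V \<longrightarrow> inverse x ^ s / t \<in> V)"
    if V: "V \<in> places k K" and tV: "t \<in> V" for V
  proof (intro conjI impI)
    note pl = placeD[OF V]
    show "poly q x / t \<in> V" if xV: "x \<in> V"
      unfolding key using xV tV p(1)
      by (intro sr_minus[OF pl(1)] sr_sum[OF pl(1)] sr_mult[OF pl(1)] sr_power[OF pl(1)] poly_in_subring[OF pl(1) poly_over_mono[OF _ pl(2)]]) auto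
    assume xV: "x \<notin> V"
    have x0: "x \<noteq> 0" using xV sr_0[OF pl(1)] by auto
    have w: "inverse x \<in> V" using xV x pl(5) by (auto simp: valring_def)
    note unit = poly_pole_unit[OF k pl(5) K pl(2) x xV qk]
    have "poly q x / t / x ^ s = - (\<Sum>i\<in>{Suc j..N}. poly (p i) x / x ^ s * t ^ (i - Suc j))"
      unfolding key by (simp add: sum_divide_distrib)
    also have "\<dots> \<in> V"
      using p(1) s tV
      by (intro sr_minus[OF pl(1)] sr_sum[OF pl(1)] sr_mult[OF pl(1)] sr_power[OF pl(1)] poly_div_pole[OF pl(1,2) w x0]) auto
    \<comment> \<open>At a pole of \<open>x\<close> the value \<open>poly q x\<close> is
      \<open>x ^ degree q\<close> up to a unit, so its inverse is integral and can be multiplied in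
      to cancel it.\<close>
    finally have "inverse x ^ Polynomial.degree q * (x ^ Polynomial.degree q / poly q x) * (poly q x / t / x ^ s) \<in> V"
      using unit(2) w by (intro sr_mult[OF pl(1)] sr_power[OF pl(1)])
    also have "inverse x ^ Polynomial.degree q * (x ^ Polynomial.degree q / poly q x) * (poly q x / t / x ^ s) = inverse x ^ s / t"
      using unit(1) x0 by (simp add: power_inverse field_simps)
    finally show "inverse x ^ s / t \<in> V" .
  qed
  with qk show ?thesis by blast
qed

text \<open>A relation would be an equation for \<open>y\<close> over \<open>k(x)\<close> of degree
  below \<open>n\<close>, although \<open>y\<close> generates the extension of degree
  \<open>n\<close>. The remaining coefficients vanish because \<open>x\<close> is
  transcendental.\<close>

lemma monomials_indep:
  assumes ff: "function_field k K" and x: "x \<in> K" "x \<notin> alg_closure_of k" and n: "Om.dimension n (adjoin k x) K"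
    and y: "y \<in> K" "K \<subseteq> adjoin (adjoin k x) y"
  shows "indep_mod k {0} ({..N} \<times> {..<n}) (\<lambda>(i, j). x ^ i * y ^ j)"
  unfolding indep_mod_def
proof (intro allI impI)
  fix c assume c: "\<forall>p\<in>{..N} \<times> {..<n}. c p \<in> k" and s: "(\<Sum>p\<in>{..N} \<times> {..<n}. c p * (case p of (i, j) \<Rightarrow> x ^ i * y ^ j)) \<in> {0}"
  note a = adjoin_props[where k = k and x = x]
  have sra: "subring (adjoin k x) \<Omega>" using a(1) by (rule sf_sr)
  have aK: "adjoin k x \<subseteq> K" by (rule a(4)[OF K kK x(1)])
  define p where "p j = (\<Sum>i\<le>N. Polynomial.monom (c (i, j)) i)" for j
  have pk: "p j \<in> poly_over k" if "j < n" for j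
    unfolding p_def using c that by (intro poly_over_sum poly_over_monom sf_sr[OF k]) auto
  have px: "poly (p j) x = (\<Sum>i\<le>N. c (i, j) * x ^ i)" for j by (simp add: p_def poly_sum poly_monom)
  have "(\<Sum>p\<in>{..N} \<times> {..<n}. c p * (case p of (i, j) \<Rightarrow> x ^ i * y ^ j)) = (\<Sum>i\<le>N. \<Sum>j<n. c (i, j) * (x ^ i * y ^ j))"
    by (simp add: sum.cartesian_product case_prod_beta)
  also have "\<dots> = (\<Sum>j<n. poly (p j) x * y ^ j)"
    by (subst sum.swap) (simp add: px sum_distrib_right mult.assoc)
  finally have e: "(\<Sum>j<n. poly (p j) x * y ^ j) = 0" using s by simp
  define r where "r = (\<Sum>j<n. Polynomial.monom (poly (p j) x) j)"
  have r: "poly r y = 0" using e by (simp add: r_def poly_sum poly_monom)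
  have ra: "r \<in> poly_over (adjoin k x)" unfolding r_def
    using pk by (intro poly_over_sum[OF sra] poly_over_monom[OF sra] poly_in_subring[OF sra poly_over_mono[OF _ a(2)] a(3)]) auto
  have "r = 0"
  proof (rule ccontr)
    assume r0: "r \<noteq> 0"
    have dr: "Polynomial.degree r \<le> n - 1" unfolding r_def
      by (intro degree_sum_le) (auto intro: order_trans[OF degree_monom_le])
    have n0: "n > 0" using r0 by (auto simp: r_def intro: gr0I)
    note se = simple_extension_algebraic[OF a(1) ra r0 r]
    note ar = adjoin_ring[OF sra, where u = y, folded simple_extension_eq_polys[OF a(1)]]
    have "Om.simple_extension (adjoin k x) y \<subseteq> K" by (rule ar(4)[OF sf_sr[OF K] aK y(1)])
    moreover have "K \<subseteq> Om.simple_extension (adjoin k x) y"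
      using y(2) adjoin_props(4)[OF se(1) ar(2) ar(3)] by blast
    ultimately have "Om.simple_extension (adjoin k x) y = K" by blast
    then obtain m where "m \<le> Polynomial.degree r" "Om.dimension m (adjoin k x) K" using se(2) by auto
    then have "m = n" "m \<le> n - 1" using Om.dimension_is_inj[OF a(1) n] dr by auto
    then show False using n0 by simp
  qed
  have "poly (p j) x = 0" if "j < n" for j
  proof -
    have "Polynomial.coeff r j = poly (p j) x" using that by (simp add: r_def coeff_sum)
    then show ?thesis using \<open>r = 0\<close> by simp
  qed
  then have p0: "p j = 0" if "j < n" for j
    using that pk[OF that] x(2) alg_closure_of_iff[OF k] by blast
  have "c (i, j) = 0" if "i \<le> N" "j < n" for i j
  proof -
    have "Polynomial.coeff (p j) i = c (i, j)" using that by (simp add: p_def coeff_sum)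
    then show ?thesis using p0[OF that(2)] by simp
  qed
  then show "\<forall>p\<in>{..N} \<times> {..<n}. c p = 0" by auto
qed

end

text \<open>A basis of \<open>B\<close> over \<open>k\<close> spans the base change over
  \<open>L\<close>.\<close>

lemma (in disjoint_exts) lspan_dim_le:
  assumes L: "subfield L \<Omega>" "k \<subseteq> L" "L \<subseteq> C" and B: "Om.dimension l k B" "B \<subseteq> K"
  shows "\<not> dim_ge L (lspan L B) {0} (Suc l)"
proof
  assume "dim_ge L (lspan L B) {0} (Suc l)"
  then obtain v where v: "\<forall>i<Suc l. v i \<in> lspan L B" "indep_mod L {0} {..<Suc l} v" unfolding dim_ge_def by blast
  obtain bs where bs: "length bs = l" "Om.Span k bs = B" "Om.independent k bs" using Om.exists_base[OF k B(1)] by blast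
  have "set bs \<subseteq> B" using Om.Span_base_incl[OF k, of bs] bs(2) by simp
  then have "bs ! i \<in> K" if "i < length bs" for i using that B(2) nth_mem by blast
  then have "indep_mod C {0} {..<length bs} (\<lambda>i. bs ! i)"
    using bs(3) by (intro indep_over_C) (auto simp: independent_iff[OF k])
  then have bsL: "Om.independent L bs"
    unfolding independent_iff[OF L(1)] by (rule indep_mod_antimono) (use L in auto)
  have Lr: "subring L \<Omega>" using L(1) by (rule sf_sr)
  have sp: "subspc L (Om.Span L bs)"
    using Om.Span_subgroup_props[OF L(1), of bs] Om.Span_smult_closed[OF L(1), of bs] by (auto simp: subspc_def)
  have "B \<subseteq> Om.Span L bs"
  proof
    fix b assume "b \<in> B"
    then obtain c where "\<forall>i<length bs. c i \<in> k" "b = (\<Sum>i<length bs. c i * bs ! i)"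
      using bs(2) Span_iff[OF k, of b bs] by blast
    then show "b \<in> Om.Span L bs" using Span_iff[OF L(1), of b bs] L(2) by blast
  qed
  then have "lspan L B \<subseteq> Om.Span L bs" by (rule lspan_minimal[OF sp])
  then have "set (map v [0..<Suc l]) \<subseteq> Om.Span L bs" using v(1) by auto
  moreover have "Om.independent L (map v [0..<Suc l])"
    unfolding independent_iff[OF L(1)] using v(2) unfolding indep_mod_def by (simp del: upt_Suc)
  ultimately have "length (map v [0..<Suc l]) \<le> length bs"
    using Om.independent_length_le[OF L(1) _ bsL] by blast
  then show False using bs(1) by simp
qed

section \<open>Counting sections for Castelnuovo's inequality\<close>

context curve
begin

text \<open>Write \<open>M U f\<close> for \<open>fracmod K' U f\<close>. Three counts are combined:
  \<open>M P e\<close> has \<open>N1\<close> independent functions, \<open>M T e\<close> exceeds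
  \<open>M T 1\<close> by at most \<open>N2\<close>, and \<open>M T eD\<close> exceeds
  \<open>M T 1\<close> by at least the degree of \<open>E\<close>. So \<open>M T e\<close> exceeds
  \<open>M T eD\<close> by at most \<open>N2\<close> minus that degree, and so does
  \<open>M P e\<close> its subspace in \<open>M P eD\<close>. The latter lies in the base change of
  the Riemann-Roch space, of dimension at most \<open>l\<close>; together \<open>N1\<close> is at
  most \<open>N2\<close> minus the degree plus \<open>l\<close>.\<close>

lemma castelnuovo_lower:
  assumes x: "x \<in> K'" "x \<notin> C" and y: "y \<in> K'" "y \<notin> C"
    and n: "Om.dimension n (adjoin L x) K'" and n': "Om.dimension n' (adjoin L y) K'"
    and gen: "K' \<subseteq> adjoin (adjoin L x) y"
    and E: "E \<in> divisors k K" "\<And>R. E R \<ge> 0"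
  shows "\<exists>m. dim_ge k (riemann_roch_space k K E) {0} m \<and> div_degree k E + 1 - (int n - 1) * (int n' - 1) \<le> int m"
proof -
  define S where "S = {R. E R \<noteq> 0}"
  have S: "finite S" "S \<subseteq> places k K" using E(1) by (auto simp: S_def divisors_def)
  have x0: "x \<noteq> 0" "inverse x \<in> K'" and y0: "y \<noteq> 0" "inverse y \<in> K'"
    using x y sr_0[OF Cr] sf_inverse[OF K'] by auto
  have depx: "polydep L K' x n" by (rule dimension_imp_polydep[OF L n])
  have adjoin_inverse: "adjoin L (inverse z) = adjoin L z" for z
  proof -
    have "adjoin L (inverse z) \<subseteq> adjoin L z" for z
      using adjoin_props[where k = L and x = z] by (intro adjoin_props(4)) (auto intro: sf_inverse)
    from this[of z] this[of "inverse z"] show ?thesis by simp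
  qed
  have depx': "polydep L K' (inverse x) n" and depy': "polydep L K' (inverse y) n'"
    using n n' by (auto intro!: dimension_imp_polydep[OF L] simp: adjoin_inverse)
  have nC: "x \<notin> alg_closure_of L" using x(2) C_L by simp
  have "\<exists>t\<in>K. t \<noteq> 0 \<and> ord_at R t = 1" if "R \<in> S" for R
  proof -
    interpret R: dplace R K using that S by (auto intro: F.place_dplace)
    show ?thesis using R.obtain_uniformizer by metis
  qed
  then obtain t where t: "\<And>R. R \<in> S \<Longrightarrow> t R \<in> K \<and> t R \<noteq> 0 \<and> ord_at R (t R) = 1" by metis
  have tR: "t R \<in> R" if "R \<in> S" for R
    using dplace.R_iff[OF F.place_dplace, of R "t R"] t[OF that] S that by auto
  have "\<exists>qs. fst qs \<in> poly_over L \<and> fst qs \<noteq> 0 \<and> (\<forall>V\<in>places L K'. t R \<in> V \<longrightarrow>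
     (x \<in> V \<longrightarrow> poly (fst qs) x / t R \<in> V) \<and> (x \<notin> V \<longrightarrow> inverse x ^ snd qs / t R \<in> V))" if "R \<in> S" for R
  proof -
    have "t R \<in> K'" "t R \<noteq> 0" using t[OF that] KK' by auto
    from F'.dominate[OF x(1) depx this] show ?thesis by auto
  qed
  then have "\<forall>R\<in>S. \<exists>qs. fst qs \<in> poly_over L \<and> fst qs \<noteq> 0 \<and> (\<forall>V\<in>places L K'. t R \<in> V \<longrightarrow>
     (x \<in> V \<longrightarrow> poly (fst qs) x / t R \<in> V) \<and> (x \<notin> V \<longrightarrow> inverse x ^ snd qs / t R \<in> V))" by blast
  from bchoice[OF this] obtain qs where qs: "\<And>R. R \<in> S \<Longrightarrow> fst (qs R) \<in> poly_over L \<and> fst (qs R) \<noteq> 0"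
    "\<And>R V. R \<in> S \<Longrightarrow> V \<in> places L K' \<Longrightarrow> t R \<in> V \<Longrightarrow>
     (x \<in> V \<longrightarrow> poly (fst (qs R)) x / t R \<in> V) \<and> (x \<notin> V \<longrightarrow> inverse x ^ snd (qs R) / t R \<in> V)"
    by blast
  define dE where "dE R = nat (E R)" for R
  have dE: "int (dE R) = E R" for R using E(2)[of R] by (simp add: dE_def)
  \<comment> \<open>\<open>q\<close> makes \<open>Q\<close> vanish along \<open>E\<close> where
    \<open>x\<close> is finite, and \<open>a\<close> is large enough for \<open>a\<close> times the
    poles of \<open>x\<close> to contain \<open>E\<close> at the remaining places.\<close>
  define q where "q = (\<Prod>R\<in>S. fst (qs R) ^ dE R)"
  define a where "a = (\<Sum>R\<in>S. dE R * snd (qs R))"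
  define d where "d = Polynomial.degree q"
  have qL: "q \<in> poly_over L" unfolding q_def using qs(1) by (intro poly_over_prod[OF Lr] poly_over_power[OF Lr]) auto
  have q0: "q \<noteq> 0" unfolding q_def using qs(1) S(1) by simp
  define Q where "Q = poly q x"
  have Q0: "Q \<noteq> 0" unfolding Q_def using q0 qL x(2) alg_closure_of_iff[OF L] C_L by blast
  have QK: "Q \<in> K'" unfolding Q_def by (rule poly_in_subring[OF K'r poly_over_mono[OF qL LK'] x(1)])
  have depQ: "polydep L K' Q (d * n)"
    unfolding Q_def d_def by (rule polydep_poly[OF ffL x(1) nC n qL])
  note pl = F'.placeD
  have invV: "inverse z \<in> V" if "z \<in> K'" "z \<notin> V" "V \<in> places L K'" for z V
    using pl(5)[OF that(3)] that(1,2) by (auto simp: valring_def)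
  have QV: "Q \<in> V" if "V \<in> places L K'" "x \<in> V" for V
    unfolding Q_def by (rule poly_in_subring[OF pl(1)[OF that(1)] poly_over_mono[OF qL pl(2)[OF that(1)]] that(2)])
  have domx: "Q / t R ^ dE R \<in> V" if V: "V \<in> places L K'" "x \<in> V" and R: "R \<in> S" "t R \<in> V" for V R
  proof -
    have "Q = poly (fst (qs R)) x ^ dE R * (\<Prod>P\<in>S-{R}. poly (fst (qs P)) x ^ dE P)"
      unfolding Q_def q_def poly_prod poly_power using R(1) S(1) by (intro prod.remove) auto
    then have "Q / t R ^ dE R = (poly (fst (qs R)) x / t R) ^ dE R * (\<Prod>P\<in>S-{R}. poly (fst (qs P)) x ^ dE P)"
      by (simp add: power_divide)
    also have "\<dots> \<in> V"
      using qs(1) qs(2)[OF R(1) V(1) R(2)] V(2)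
      by (intro sr_mult[OF pl(1)[OF V(1)]] sr_power[OF pl(1)[OF V(1)]] sr_prod[OF pl(1)[OF V(1)]]
          poly_in_subring[OF pl(1)[OF V(1)] poly_over_mono[OF _ pl(2)[OF V(1)]]]) auto
    finally show ?thesis .
  qed
  have domx': "inverse x ^ a / t R ^ dE R \<in> V" if V: "V \<in> places L K'" "x \<notin> V" and R: "R \<in> S" "t R \<in> V" for V R
  proof -
    have le: "dE R * snd (qs R) \<le> a" unfolding a_def using R(1) S(1) by (intro member_le_sum) auto
    then have "inverse x ^ a = inverse x ^ (a - dE R * snd (qs R)) * inverse x ^ (dE R * snd (qs R))"
      by (simp add: power_add[symmetric])
    then have "inverse x ^ a / t R ^ dE R = inverse x ^ (a - dE R * snd (qs R)) * (inverse x ^ snd (qs R) / t R) ^ dE R"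
      by (simp add: power_divide power_mult[symmetric] mult.commute)
    also have "\<dots> \<in> V"
      using qs(2)[OF R(1) V(1) R(2)] V invV[OF x(1) V(2,1)]
      by (intro sr_mult[OF pl(1)[OF V(1)]] sr_power[OF pl(1)[OF V(1)]]) auto
    finally show ?thesis .
  qed
  \<comment> \<open>Local equations: \<open>alpha j\<close> allows \<open>j\<close> times the poles
    of \<open>x\<close> and, where \<open>x\<close> is finite, the zeros of \<open>Q\<close>;
    \<open>beta j\<close> allows \<open>j\<close> times the poles of \<open>y\<close>.\<close>
  define alpha where "alpha j V = (if x \<in> V then inverse Q else x ^ j)" for j V
  define beta where "beta j V = (if y \<in> V then 1 else y ^ j)" for j V
  define e where "e V = alpha a V * beta (n - 1) V" for V
  have ab0: "alpha j V \<noteq> 0" "beta j V \<noteq> 0" for j V using x0 y0 Q0 by (auto simp: alpha_def beta_def)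
  have e0: "e V \<noteq> 0" for V using ab0 by (simp add: e_def)
  \<comment> \<open>The local equation of the divisor \<open>E\<close>, pulled back from the place
    of \<open>K\<close> below.\<close>
  define eD where "eD V = (if V \<inter> K \<in> S then inverse (t (V \<inter> K) ^ dE (V \<inter> K)) else 1)" for V
  have eD0: "eD V \<noteq> 0" for V using t by (auto simp: eD_def)
  \<comment> \<open>The places of \<open>K\<close> below anything where the divisors differ. Working
    with all places above a finite set downstairs keeps approximation over \<open>k\<close>
    available.\<close>
  define T0 where "T0 = S \<union> (\<lambda>V. V \<inter> K) ` {V \<in> places L K'. inverse x \<in> max_ideal V}
     \<union> (\<lambda>V. V \<inter> K) ` {V \<in> places L K'. inverse y \<in> max_ideal V}
     \<union> (\<lambda>V. V \<inter> K) ` {V \<in> places L K'. Q \<in> max_ideal V}"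
  have T0: "finite T0" "T0 \<subseteq> places k K"
    unfolding T0_def using S x0 y0 Q0 QK place_restrict by (auto intro: finite_zeros_restrict)
  define T where "T = {V \<in> places L K'. V \<inter> K \<in> T0}"
  have T: "T \<subseteq> places L K'" by (auto simp: T_def)
  define P where "P = places L K'"
  let ?M = "fracmod K'"
  have sp: "U \<subseteq> places L K' \<Longrightarrow> subspc L (?M U f)" for U f
    using pl by (intro subspc_fracmod K'r LK') blast
  have kr0: "0 \<in> k" "0 \<in> L" using kr Lr by (auto intro: sr_0)
  \<comment> \<open>the pole divisor of \<open>y\<close>, of degree \<open>n'\<close>, enters \<open>n - 1\<close> times, that of \<open>x\<close> \<open>a\<close> times, and \<open>1/Q\<close> once\<close>
  define N2 where "N2 = (n - 1) * n' + (a * n + d * n)"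
  have U: "\<not> dim_ge L (?M T e) (?M T (\<lambda>_. 1)) (Suc N2)"
  proof -
    have 1: "\<not> dim_ge L (?M T (\<lambda>V. alpha a V * beta (n - 1) V)) (?M T (\<lambda>V. alpha a V * beta 0 V)) (Suc ((n - 1) * n'))"
    proof (rule F'.fracmod_steps[OF T _ depy'])
      show "inverse y \<noteq> 0" using y0 by simp
      show "alpha a V * beta j V \<noteq> 0" for j V using ab0 by simp
      fix j V assume V: "V \<in> T"
      then have Vp: "V \<in> places L K'" using T by blast
      show "inverse y \<in> V \<and> alpha a V * beta j V = alpha a V * beta (Suc j) V * inverse y \<or>
        alpha a V * beta (Suc j) V / (alpha a V * beta j V) \<in> V"
        using invV[OF y(1) _ Vp] y0 ab0(1)[of a V] sr_1[OF pl(1)[OF Vp]] by (auto simp: beta_def)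
    qed
    have 2: "\<not> dim_ge L (?M T (\<lambda>V. alpha a V * beta 0 V)) (?M T (\<lambda>V. alpha 0 V * beta 0 V)) (Suc (a * n))"
    proof (rule F'.fracmod_steps[OF T _ depx'])
      show "inverse x \<noteq> 0" using x0 by simp
      show "alpha j V * beta 0 V \<noteq> 0" for j V using ab0 by simp
      fix j V assume V: "V \<in> T"
      then have Vp: "V \<in> places L K'" using T by blast
      show "inverse x \<in> V \<and> alpha j V * beta 0 V = alpha (Suc j) V * beta 0 V * inverse x \<or>
        alpha (Suc j) V * beta 0 V / (alpha j V * beta 0 V) \<in> V"
        using invV[OF x(1) _ Vp] x0 ab0(1)[of 0 V] Q0 sr_1[OF pl(1)[OF Vp]] by (auto simp: alpha_def beta_def)
    qed
    have 3: "\<not> dim_ge L (?M T (\<lambda>V. alpha 0 V * beta 0 V)) (?M T (\<lambda>_. 1)) (Suc (d * n))"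
    proof (rule F'.fracmod_step[OF T Q0 depQ])
      show "alpha 0 V * beta 0 V \<noteq> 0" for V using ab0 by simp
      fix V assume V: "V \<in> T"
      then have Vp: "V \<in> places L K'" using T by blast
      show "Q \<in> V \<and> 1 = alpha 0 V * beta 0 V * Q \<or> alpha 0 V * beta 0 V / 1 \<in> V"
        using QV[OF Vp] Q0 sr_1[OF pl(1)[OF Vp]] by (auto simp: alpha_def beta_def)
    qed
    note sps = sp[OF T]
    show ?thesis unfolding N2_def e_def
      by (rule dim_le_add[OF 1 dim_le_add[OF 2 3 L sps sps] L sps sps])
  qed
  \<comment> \<open>the sections \<open>x^i y^j / Q\<close> with \<open>i \<le> a + d\<close> and \<open>j < n\<close>\<close>
  define N1 where "N1 = (a + d + 1) * n"
  have G: "dim_ge L (?M P e) {0} N1"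
  proof -
    have ind: "indep_mod L {0} ({..a + d} \<times> {..<n}) (\<lambda>(i, j). x ^ i * y ^ j)"
      by (rule F'.monomials_indep[OF ffL x(1) nC n y(1) gen])
    have "dim_ge L ((\<lambda>(i, j). x ^ i * y ^ j) ` ({..a + d} \<times> {..<n})) {0} N1"
      by (rule dim_geI[OF _ _ _ ind]) (use kr0 in \<open>auto simp: N1_def card_cartesian_product\<close>)
    then show ?thesis
    proof (rule dim_ge_scale)
      show "z \<in> {0}" if "inverse Q * z \<in> {0}" for z using that Q0 by simp
      fix z assume "z \<in> (\<lambda>(i, j). x ^ i * y ^ j) ` ({..a + d} \<times> {..<n})"
      then obtain i j where z: "z = x ^ i * y ^ j" "i \<le> a + d" "j < n" by auto
      have "inverse Q * z / e V \<in> V" if V: "V \<in> places L K'" for V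
      proof -
        note sr = pl(1)[OF V]
        have yV: "y ^ j / beta (n - 1) V \<in> V"
        proof (cases "y \<in> V")
          case True
          then show ?thesis using sr by (simp add: beta_def sr_power)
        next
          case False
          have "y ^ (n - 1) = y ^ j * y ^ (n - 1 - j)" using z(3) by (simp add: power_add[symmetric])
          then have "y ^ j / beta (n - 1) V = inverse y ^ (n - 1 - j)"
            using y0 False by (simp add: beta_def power_inverse field_simps)
          then show ?thesis using invV[OF y(1) False V] by (simp add: sr_power[OF sr])
        qed
        have xV: "inverse Q * x ^ i / alpha a V \<in> V"
        proof (cases "x \<in> V")
          case True
          then show ?thesis using sr Q0 by (simp add: alpha_def sr_power)
        next
          case False
          note unit = poly_pole_unit(2)[OF L pl(5)[OF V] K' pl(2)[OF V] x(1) False qL q0, folded d_def Q_def]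
          have "x ^ (a + d) = x ^ i * x ^ (a + d - i)" using z(2) by (simp add: power_add[symmetric])
          then have "inverse x ^ (a + d - i) * x ^ (a + d) = x ^ i" using x0 by (simp add: power_inverse)
          then have "inverse Q * x ^ i / alpha a V = (x ^ d / Q) * inverse x ^ (a + d - i)"
            using x0 False Q0 by (simp add: alpha_def power_add field_simps)
          also have "\<dots> \<in> V" using unit invV[OF x(1) False V] by (intro sr_mult[OF sr] sr_power[OF sr])
          finally show ?thesis .
        qed
        have "inverse Q * z / e V = (inverse Q * x ^ i / alpha a V) * (y ^ j / beta (n - 1) V)"
          by (simp add: z(1) e_def)
        then show ?thesis using sr_mult[OF sr xV yV] by simp
      qed
      moreover have "inverse Q * z \<in> K'"
        unfolding z(1) using x(1) y(1) QK K'
        by (intro sr_mult[OF K'r] sr_power[OF K'r] sf_inverse[OF K'])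
      ultimately show "inverse Q * z \<in> ?M P e" by (simp add: fracmod_def P_def)
    qed
  qed
  \<comment> \<open>The exact count takes place over \<open>k\<close>; independence modulo
    \<open>B\<close> then persists modulo \<open>C \<otimes> B\<close>. No degree of a place of
    \<open>K'\<close> appears.\<close>
  have DE: "dim_ge L (?M T eD) (?M T (\<lambda>_. 1)) (nat (div_degree k E))"
  proof -
    define B where "B = F.semilocal T0 (\<lambda>_. 0)"
    have ST0: "S \<subseteq> T0" by (auto simp: T0_def)
    have deg: "(\<Sum>R\<in>S. (E R - 0) * int (place_degree k R)) = div_degree k E"
      using F.div_degree_eq[OF S(1), of E] by (simp add: S_def)
    have "dim_ge k (F.semilocal T0 E) B (nat (\<Sum>R\<in>S. (E R - 0) * int (place_degree k R)))"
      unfolding B_def by (rule F.semilocal_dim(2)[OF T0(2) S(1) ST0 _ _ T0(1)]) (use E(2) in \<open>auto simp: S_def\<close>)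
    then have ge: "dim_ge k (F.semilocal T0 E) B (nat (div_degree k E))" unfolding deg .
    then obtain v where v: "\<And>i. i < nat (div_degree k E) \<Longrightarrow> v i \<in> F.semilocal T0 E" "indep_mod k B {..<nat (div_degree k E)} v"
      unfolding dim_ge_def by blast
    have vK: "v i \<in> K" if "i < nat (div_degree k E)" for i using v(1)[OF that] by (simp add: F.semilocal_def)
    have Bsp: "subspc k B" unfolding B_def by (rule F.subspc_semilocal[OF T0(2)])
    have BK: "B \<subseteq> K" by (auto simp: B_def F.semilocal_def)
    have "indep_mod C (lspan C B) {..<nat (div_degree k E)} v"
      by (rule D.indep_mod_lspan[OF finite_lessThan _ Bsp BK v(2)]) (use vK in auto)
    \<comment> \<open>A function integral at all places above each \<open>R\<close> in
      \<open>T0\<close> lies in every \<open>L \<otimes> R\<close>, hence in the base change of the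
      intersection.\<close>
    moreover have "?M T (\<lambda>_. 1) \<subseteq> lspan C B"
    proof
      fix z assume z: "z \<in> ?M T (\<lambda>_. 1)"
      have zK: "z \<in> K'" using z by (simp add: fracmod_def)
      have zR: "z \<in> lspan L R" if R: "R \<in> T0" for R
      proof (rule ccontr)
        assume "z \<notin> lspan L R"
        then obtain V where "V \<in> places L K'" "V \<inter> K = R" "z \<notin> V"
          using place_above[of R z] zK R T0(2) by blast
        then show False using z R by (auto simp: fracmod_def T_def)
      qed
      have "z \<in> lspan L (K \<inter> \<Inter>T0)"
      proof (rule D.lspan_Int)
        show "z \<in> lspan L K" using zK K'_eq by simp
        show "z \<in> lspan C R" if "R \<in> T0" for R using zR[OF that] lspan_mono[OF LC order_refl] by blast
        show "subspc k R \<and> R \<subseteq> K" if "R \<in> T0" for R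
          using that T0(2) F.placeD[of R] by (auto intro: spk)
      qed (use LC kL kK Lr Kr in \<open>auto intro: spk\<close>)
      moreover have "K \<inter> \<Inter>T0 \<subseteq> B"
      proof
        fix z assume z: "z \<in> K \<inter> \<Inter>T0"
        show "z \<in> B" unfolding B_def
        proof (rule F.semilocalI)
          show "ord_at R z \<ge> - 0" if "z \<noteq> 0" "R \<in> T0" for R
            using dplace.R_iff[OF F.place_dplace, of R z] that z T0(2) by auto
        qed (use z in blast)
      qed
      ultimately show "z \<in> lspan C B" using lspan_mono[OF LC, of "K \<inter> \<Inter>T0" B] by blast
    qed
    ultimately have ind: "indep_mod L (?M T (\<lambda>_. 1)) {..<nat (div_degree k E)} v"
      by (rule indep_mod_antimono) (rule LC)
    have "v i \<in> ?M T eD" if i: "i < nat (div_degree k E)" for i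
    proof -
      have "v i / eD V \<in> V" if V: "V \<in> T" for V
      proof -
        define R where "R = V \<inter> K"
        have R: "R \<in> T0" "R \<in> places k K" using V T0 by (auto simp: T_def R_def)
        interpret R: dplace R K by (rule F.place_dplace[OF R(2)])
        show ?thesis
        proof (cases "v i = 0")
          case True
          then show ?thesis using V T pl(1) sr_0 by auto
        next
          case False
          have o: "ord_at R (v i) \<ge> - E R" using F.semilocalD(2)[OF v(1)[OF i] False R(1)] .
          have "v i / eD V \<in> R"
          proof (cases "R \<in> S")
            case True
            note tt = t[OF True]
            have "v i * t R ^ dE R \<in> K" using vK[OF i] tt Kr by (intro sr_mult[OF Kr] sr_power[OF Kr]) auto
            moreover have "ord_at R (v i * t R ^ dE R) \<ge> 0"
              using o vK[OF i] tt False dE[of R] sr_power[OF Kr, of "t R" "dE R"] by (simp add: R.ord_mult R.ord_power)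
            ultimately have "v i * t R ^ dE R \<in> R" using R.R_iff[of "v i * t R ^ dE R"] False tt by simp
            then show ?thesis using True by (simp add: eD_def R_def divide_inverse)
          next
            case F: False
            then have "E R = 0" by (simp add: S_def)
            then have "v i \<in> R" using o R.R_iff[OF vK[OF i] False] by simp
            then show ?thesis using F by (simp add: eD_def R_def)
          qed
          then show ?thesis by (simp add: R_def)
        qed
      qed
      then show ?thesis using vK[OF i] KK' by (auto simp: fracmod_def)
    qed
    with ind show ?thesis unfolding dim_ge_def by blast
  qed
  have tV: "t (V \<inter> K) \<in> V" if "V \<inter> K \<in> S" for V using tR[OF that] by blast
  have DsubE: "?M T eD \<subseteq> ?M T e"
  proof (rule fracmod_mono)
    fix V assume V: "V \<in> T"
    then have Vp: "V \<in> places L K'" using T by blast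
    note sr = pl(1)[OF Vp]
    show "subring V \<Omega>" by (rule sr)
    show "eD V \<noteq> 0" by (rule eD0)
    have b: "inverse (beta (n - 1) V) \<in> V"
      using invV[OF y(1) _ Vp] sr by (auto simp: beta_def power_inverse[symmetric] intro: sr_1 sr_power)
    have al: "eD V / alpha a V \<in> V"
    proof (cases "V \<inter> K \<in> S")
      case True
      then show ?thesis using domx[OF Vp _ True tV[OF True]] domx'[OF Vp _ True tV[OF True]]
        by (auto simp: eD_def alpha_def divide_inverse power_inverse mult.commute)
    next
      case False
      then show ?thesis using QV[OF Vp] invV[OF x(1) _ Vp] sr
        by (auto simp: eD_def alpha_def divide_inverse power_inverse[symmetric] intro: sr_power)
    qed
    have "eD V / e V = eD V / alpha a V * inverse (beta (n - 1) V)" by (simp add: e_def divide_inverse)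
    then show "eD V / e V \<in> V" using sr_mult[OF sr al b] by simp
  qed
  \<comment> \<open>Away from \<open>T\<close> the functions \<open>x\<close> and \<open>y\<close>
    are finite, \<open>Q\<close> is a unit and \<open>E\<close> is trivial, so both divisors impose
    the same condition there.\<close>
  have cut: "?M P e \<inter> ?M T eD \<subseteq> ?M P eD"
  proof
    fix z assume z: "z \<in> ?M P e \<inter> ?M T eD"
    have "z / eD V \<in> V" if V: "V \<in> places L K'" for V
    proof (cases "V \<in> T")
      case True
      then show ?thesis using z by (simp add: fracmod_def)
    next
      case False
      note sr = pl(1)[OF V]
      have nT: "V \<inter> K \<notin> T0" using False V by (simp add: T_def)
      have nm: "inverse x \<notin> max_ideal V" "inverse y \<notin> max_ideal V" "Q \<notin> max_ideal V" "V \<inter> K \<notin> S"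
        using nT V by (auto simp: T0_def)
      have xV: "x \<in> V"
      proof (rule ccontr)
        assume "x \<notin> V"
        then show False using nm(1) invV[OF x(1) _ V] by (simp add: max_ideal_iff)
      qed
      have yV: "y \<in> V"
      proof (rule ccontr)
        assume "y \<notin> V"
        then show False using nm(2) invV[OF y(1) _ V] by (simp add: max_ideal_iff)
      qed
      have Qi: "inverse Q \<in> V" using nm(3) QV[OF V xV] by (simp add: max_ideal_iff)
      have "z / e V \<in> V" using z V by (simp add: fracmod_def P_def)
      then have "z * Q \<in> V" using xV yV by (simp add: e_def alpha_def beta_def divide_inverse)
      then have "z * Q * inverse Q \<in> V" using Qi by (rule sr_mult[OF sr])
      then show ?thesis using Q0 nm(4) by (simp add: eD_def mult.assoc)
    qed
    then show "z \<in> ?M P eD" using z by (simp add: fracmod_def P_def)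
  qed
  define l where "l = Om.dim k (riemann_roch_space k K E)"
  have RR: "dim_ge k (riemann_roch_space k K E) {0} m \<longleftrightarrow> m \<le> l" for m
    unfolding l_def by (rule F.RRspace_dim[OF const[unfolded C_def] E(1)])
  \<comment> \<open>Multiplying by a local equation of \<open>E\<close> reduces membership at
    \<open>R\<close> to \<open>L \<otimes> R\<close>; the intersection over all \<open>R\<close>
    commutes with base change and yields the Riemann-Roch space.\<close>
  have LD: "\<not> dim_ge L (?M P eD) {0} (Suc l)"
  proof -
    have "?M P eD \<subseteq> lspan L (riemann_roch_space k K E)"
    proof
      fix z assume z: "z \<in> ?M P eD"
      have zK: "z \<in> K'" using z by (simp add: fracmod_def)
      have loc: "z \<in> lspan L (F.semilocal {R} E)" if R: "R \<in> places k K" for R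
      proof -
        interpret R: dplace R K by (rule F.place_dplace[OF R])
        define h where "h = (if R \<in> S then t R ^ dE R else 1)"
        have h: "h \<in> K" "h \<noteq> 0" "ord_at R h = E R"
          using t[of R] Kr dE[of R] by (auto simp: h_def S_def R.ord_power intro: sr_intros)
        have "z * h \<in> lspan L R"
        proof (rule ccontr)
          assume "z * h \<notin> lspan L R"
          moreover have "z * h \<in> K'" using zK h KK' by (intro sr_mult[OF K'r]) auto
          ultimately obtain V where V: "V \<in> places L K'" "V \<inter> K = R" "z * h \<notin> V"
            using place_above[OF R] by blast
          have "z / eD V \<in> V" using z V(1) by (simp add: fracmod_def P_def)
          then show False using V by (simp add: eD_def h_def divide_inverse split: if_splits)
        qed
        then have "inverse h * (z * h) \<in> lspan L (F.semilocal {R} E)"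
        proof (rule lspan_scale')
          fix r assume r: "r \<in> R"
          show "inverse h * r \<in> F.semilocal {R} E"
          proof (rule F.semilocalI)
            show "inverse h * r \<in> K" using r h R.RK sf_inverse[OF K] by (intro sr_mult[OF Kr]) auto
            fix R' assume "inverse h * r \<noteq> 0" "R' \<in> {R}"
            moreover have "ord_at R r \<ge> 0" if "r \<noteq> 0" using R.R_iff[of r] r R.RK that by auto
            ultimately show "ord_at R' (inverse h * r) \<ge> - E R'"
              using h r R.RK sf_inverse[OF K, of h] by (auto simp: R.ord_mult R.ord_inverse)
          qed
        qed
        moreover have "inverse h * (z * h) = z" using h(2) by (simp add: field_simps)
        ultimately show ?thesis by simp
      qed
      have "z \<in> lspan L (K \<inter> \<Inter>((\<lambda>R. F.semilocal {R} E) ` places k K))"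
      proof (rule D.lspan_Int)
        show "z \<in> lspan L K" using zK K'_eq by simp
        show "z \<in> lspan C B" if "B \<in> (\<lambda>R. F.semilocal {R} E) ` places k K" for B
          using that loc lspan_mono[OF LC order_refl] by blast
        show "subspc k B \<and> B \<subseteq> K" if "B \<in> (\<lambda>R. F.semilocal {R} E) ` places k K" for B
        proof -
          from that obtain R where R: "R \<in> places k K" "B = F.semilocal {R} E" by blast
          have "subspc k B" unfolding R(2) by (rule F.subspc_semilocal) (use R in auto)
          then show ?thesis using R(2) by (auto simp: F.semilocal_def)
        qed
      qed (use LC kL kK Lr Kr in \<open>auto intro: spk\<close>)
      moreover have "K \<inter> \<Inter>((\<lambda>R. F.semilocal {R} E) ` places k K) \<subseteq> riemann_roch_space k K E"
        by (auto simp: F.semilocal_def riemann_roch_space_def)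
      ultimately show "z \<in> lspan L (riemann_roch_space k K E)" using lspan_mono[OF order_refl] by blast
    qed
    moreover have "\<not> dim_ge L (lspan L (riemann_roch_space k K E)) {0} (Suc l)"
    proof -
      have "\<not> dim_ge k (riemann_roch_space k K E) {0} (Suc l)" using RR by simp
      moreover have "subspc k (riemann_roch_space k K E)"
        unfolding F.RRspace_semilocal by (rule F.subspc_semilocal) simp
      ultimately obtain l' where l': "l' \<le> l" "Om.dimension l' k (riemann_roch_space k K E)"
        using dimension_ex[OF k] by blast
      have "\<not> dim_ge L (lspan L (riemann_roch_space k K E)) {0} (Suc l')"
        by (rule D.lspan_dim_le[OF L kL LC l'(2)]) (auto simp: riemann_roch_space_def)
      then show ?thesis using dim_ge_mono[of L _ "{0}" "Suc l" _ "{0}" "Suc l'"] l'(1) kr0 by blast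
    qed
    ultimately show ?thesis using dim_ge_mono[of L "?M P eD" "{0}" "Suc l"] kr0 by blast
  qed
  define dd where "dd = nat (div_degree k E)"
  have spP: "subspc L (?M P f)" for f by (rule sp) (simp add: P_def)
  \<comment> \<open>Ensures that the natural number \<open>N2 - dd\<close> is not truncated.\<close>
  have dN: "dd \<le> N2"
  proof (rule ccontr)
    assume "\<not> dd \<le> N2"
    then have "dim_ge L (?M T e) (?M T (\<lambda>_. 1)) (Suc N2)"
      by (intro dim_ge_mono[OF DE DsubE order_refl _ kr0(2)]) (simp add: dd_def)
    with U show False by blast
  qed
  have "\<not> dim_ge L (?M P e) (?M P eD) (Suc (N2 - dd))"
  proof
    assume "dim_ge L (?M P e) (?M P eD) (Suc (N2 - dd))"
    then have "dim_ge L (?M P e) (?M T eD) (Suc (N2 - dd))" by (rule dim_ge_Int[OF _ spP cut])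
    moreover have "?M P e \<subseteq> ?M T e" using T by (auto simp: fracmod_def P_def)
    ultimately have 1: "dim_ge L (?M T e) (?M T eD) (Suc (N2 - dd))"
      by (rule dim_ge_mono) (use kr0 in auto)
    have 2: "?M T (\<lambda>_. 1) \<subseteq> ?M T eD"
    proof (rule fracmod_mono)
      fix V assume V: "V \<in> T"
      then have Vp: "V \<in> places L K'" using T by blast
      show "subring V \<Omega>" by (rule pl(1)[OF Vp])
      show "1 / eD V \<in> V" using tV[of V] pl(1)[OF Vp] by (auto simp: eD_def divide_inverse intro: sr_1 sr_power)
    qed simp
    have "dim_ge L (?M T e) (?M T (\<lambda>_. 1)) (Suc (N2 - dd) + dd)"
      by (rule dim_ge_add[OF 1 DE[folded dd_def] sp[OF T] DsubE 2 Lr])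
    with U dN show False by simp
  qed
  then have "\<not> dim_ge L (?M P e) {0} (Suc (N2 - dd + l))"
    by (rule dim_le_add[OF _ LD L spP spP])
  then have "N1 \<le> N2 - dd + l" using dim_ge_mono[OF G order_refl order_refl _ kr0(2), of "Suc (N2 - dd + l)"] by force
  then have le: "int N1 \<le> int N2 - int dd + int l" using dN by linarith
  \<comment> \<open>Needed for the natural number \<open>n - 1\<close> in \<open>N2\<close> to be
    the integer \<open>n - 1\<close>.\<close>
  have n0: "n \<ge> 1"
  proof (rule ccontr)
    assume "\<not> n \<ge> 1"
    then have "n = 0" by simp
    then have "K' = {0}" using Om.dimension_zero[OF adjoin_props(1)] n by simp
    then show False using x x0 by simp
  qed
  \<comment> \<open>The multiples of \<open>a\<close> and \<open>d\<close> cancel and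
    \<open>n - (n - 1) n'\<close> remains.\<close>
  have "int N1 - int N2 = 1 - (int n - 1) * (int n' - 1)"
  proof -
    obtain n1 where "n = Suc n1" using n0 by (cases n) auto
    then show ?thesis by (simp add: N1_def N2_def algebra_simps)
  qed
  moreover have "int dd \<ge> div_degree k E" by (simp add: dd_def)
  ultimately have "div_degree k E + 1 - (int n - 1) * (int n' - 1) \<le> int l" using le by linarith
  then show ?thesis using RR[of l] by blast
qed

text \<open>The generation hypothesis says that the two maps do not factor through a common map of
  degree at least 2; the lines have genus zero, so only the mixed term of the general inequality is
  left.\<close>

lemma castelnuovo:
  assumes "x \<in> K'" "x \<notin> C" "y \<in> K'" "y \<notin> C"
    and "Om.dimension n (adjoin L x) K'" "Om.dimension n' (adjoin L y) K'"
    and "K' \<subseteq> adjoin (adjoin L x) y"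
  shows "genus k K \<le> (int n - 1) * (int n' - 1)"
  using castelnuovo_lower[OF assms] by (intro F.genus_le const[unfolded C_def]) auto

end

subsection \<open>Curves dominated by a smooth curve are smooth\<close>

context curve
begin

lemma max_ideal_restrict: "a \<in> max_ideal (V \<inter> K) \<Longrightarrow> a \<in> max_ideal V"
  using sf_inverse[OF K] by (auto simp: max_ideal_iff)

text \<open>
  \<open>V\<close> is a localization of the integral closure of \<open>V \<inter> K\<close>: truncate an equation of \<open>v\<close>
  at the last coefficient that is a unit.
\<close>

lemma place_localization:
  assumes V: "V \<in> places L K'" and v: "v \<in> V"
  shows "\<exists>b\<in>lspan L (V \<inter> K). b \<noteq> 0 \<and> inverse b \<in> V \<and> b * v \<in> lspan L (V \<inter> K)"
proof (cases "v = 0")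
  case True
  have "1 \<in> lspan L (V \<inter> K)" using lspan_R_props(1)[OF place_restrict[OF V]] by (rule sr_1)
  then show ?thesis using True sr_1[OF F'.placeD(1)[OF V]] by (intro bexI[of _ 1]) auto
next
  case v0: False
  note pl = F'.placeD[OF V]
  define R where "R = V \<inter> K"
  have R: "R \<in> places k K" unfolding R_def by (rule place_restrict[OF V])
  interpret R: dplace R K by (rule F.place_dplace[OF R])
  have vK: "v \<in> K'" using v pl(3) by blast
  have "C \<subseteq> alg_closure_of K" unfolding C_def by (rule alg_closure_of_mono[OF k K kK])
  then have "K' \<subseteq> alg_closure_of K"
    unfolding K'_eq using LC alg_closure_of_subfield[OF K]
    by (intro lspan_minimal subspc_subring) (auto intro: sf_sr)
  then obtain p where p: "p \<in> poly_over K" "p \<noteq> 0" "poly p v = 0" using vK alg_closure_of_iff[OF K] by blast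
  define I where "I = {i. i \<le> Polynomial.degree p \<and> Polynomial.coeff p i \<noteq> 0}"
  have finI: "finite I" by (simp add: I_def)
  have "Polynomial.degree p \<in> I" using p(2) by (simp add: I_def)
  then have neI: "I \<noteq> {}" by blast
  \<comment> \<open>Dividing by a coefficient of least order puts all coefficients into
    \<open>R\<close> and makes one of them 1, so that a last unit coefficient exists.\<close>
  define mo where "mo = Min ((\<lambda>i. ord_at R (Polynomial.coeff p i)) ` I)"
  have "mo \<in> (\<lambda>i. ord_at R (Polynomial.coeff p i)) ` I" unfolding mo_def using finI neI by (intro Min_in) auto
  then obtain m where m: "m \<in> I" "ord_at R (Polynomial.coeff p m) = mo" by auto
  have mo: "mo \<le> ord_at R (Polynomial.coeff p i)" if "i \<in> I" for i unfolding mo_def using finI that by (intro Min_le) auto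
  have cK: "Polynomial.coeff p i \<in> K" for i using p(1) by (simp add: poly_over_def)
  define N where "N = Polynomial.degree p"
  define a where "a i = Polynomial.coeff p i / Polynomial.coeff p m" for i
  have m0: "Polynomial.coeff p m \<noteq> 0" "m \<le> N" using m(1) by (auto simp: I_def N_def)
  have aR: "a i \<in> R" if "i \<le> N" for i
  proof (cases "Polynomial.coeff p i = 0")
    case True
    then show ?thesis by (simp add: a_def sr_0[OF R.Rr])
  next
    case False
    have "a i \<in> K" using cK by (auto simp: a_def intro: sf_divide[OF K])
    moreover have "ord_at R (a i) \<ge> 0"
      using mo[of i] m(2) False m0 that cK by (simp add: a_def R.ord_divide I_def N_def)
    ultimately show ?thesis using R.R_iff[of "a i"] False m0 by (simp add: a_def)
  qed
  have am: "a m = 1" using m0 by (simp add: a_def)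
  have sum0: "(\<Sum>i\<le>N. a i * v ^ i) = 0"
  proof -
    have "(\<Sum>i\<le>N. a i * v ^ i) = poly p v / Polynomial.coeff p m"
      by (simp add: poly_altdef N_def a_def sum_divide_distrib)
    then show ?thesis using p(3) by simp
  qed
  define U where "U = {i. i \<le> N \<and> a i \<notin> max_ideal R}"
  have "m \<in> U" using am m0 by (simp add: U_def)
  moreover have finU: "finite U" by (simp add: U_def)
  ultimately have "Max U \<in> U" by (intro Max_in) auto
  then obtain n where n: "n = Max U" "n \<le> N" "a n \<notin> max_ideal R" by (auto simp: U_def)
  have above: "a i \<in> max_ideal R" if "n < i" "i \<le> N" for i
  proof (rule ccontr)
    assume "a i \<notin> max_ideal R"
    then have "i \<le> Max U" using that(2) by (intro Max_ge finU) (simp add: U_def)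
    then show False using that(1) n(1) by simp
  qed
  \<comment> \<open>\<open>b\<close> is the part of the equation from the last unit coefficient on,
    divided by \<open>v ^ n\<close>; at \<open>V\<close> it is that unit plus an element of the
    maximal ideal. The equation becomes \<open>b v = - c\<close>, with \<open>c\<close> a polynomial
    in \<open>inverse v\<close>.\<close>
  define b where "b = (\<Sum>i\<in>{n..N}. a i * v ^ (i - n))"
  define c where "c = (\<Sum>i<n. a i * inverse v ^ (n - Suc i))"
  have split: "(\<Sum>i\<le>N. a i * v ^ i) = (\<Sum>i<n. a i * v ^ i) + b * v ^ n"
  proof -
    have "{..N} = {..<n} \<union> {n..N}" using n(2) by auto
    then have "(\<Sum>i\<le>N. a i * v ^ i) = (\<Sum>i<n. a i * v ^ i) + (\<Sum>i\<in>{n..N}. a i * v ^ i)"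
      by (simp add: sum.union_disjoint ivl_disj_int)
    also have "(\<Sum>i\<in>{n..N}. a i * v ^ i) = b * v ^ n"
      unfolding b_def sum_distrib_right
      by (intro sum.cong refl) (simp add: mult.assoc power_add[symmetric])
    finally show ?thesis .
  qed
  have bV: "b \<in> W" if "W \<in> places L K'" "W \<inter> K = R" "v \<in> W" for W
    unfolding b_def using aR that F'.placeD(1)[OF that(1)]
    by (intro sr_sum sr_mult sr_power) auto
  have cV: "c \<in> W" if "W \<in> places L K'" "W \<inter> K = R" "v \<notin> W" for W
    unfolding c_def using aR that F'.placeD(1,5)[OF that(1)] vK n(2)
    by (intro sr_sum sr_mult sr_power) (auto simp: valring_def)
  have b_unit: "b \<notin> max_ideal V"
  proof
    assume bm: "b \<in> max_ideal V"
    have "{n..N} = insert n {Suc n..N}" using n(2) by auto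
    then have b: "b = a n + (\<Sum>i\<in>{Suc n..N}. a i * v ^ (i - n))" by (simp add: b_def)
    have "(\<Sum>i\<in>{Suc n..N}. a i * v ^ (i - n)) \<in> max_ideal V"
    proof (rule max_ideal_sum[OF pl(5) K'])
      fix i assume "i \<in> {Suc n..N}"
      then have "a i \<in> max_ideal V" using above[of i] max_ideal_restrict by (simp add: R_def)
      then have "v ^ (i - n) * a i \<in> max_ideal V" by (intro max_ideal_mult[OF pl(1)] sr_power[OF pl(1)] v)
      then show "a i * v ^ (i - n) \<in> max_ideal V" by (simp add: mult.commute)
    qed
    then have "b + - (\<Sum>i\<in>{Suc n..N}. a i * v ^ (i - n)) \<in> max_ideal V"
      by (intro max_ideal_add[OF pl(5) K' bm] max_ideal_minus[OF pl(1)])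
    then have "a n \<in> max_ideal V" by (simp add: b)
    moreover have "a n \<in> R" "a n \<noteq> 0" "inverse (a n) \<in> R"
      using aR[OF n(2)] n(3) max_ideal_0[OF R.Rr] by (auto simp: max_ideal_iff)
    ultimately show False by (simp add: max_ideal_iff R_def)
  qed
  have bV': "b \<in> V" using bV[OF V] v by (simp add: R_def)
  have b0: "b \<noteq> 0" "inverse b \<in> V" using b_unit bV' by (auto simp: max_ideal_iff)
  have n0: "n > 0"
  proof (rule ccontr)
    assume "\<not> n > 0"
    then have "b = 0" using split sum0 by simp
    with b0 show False by simp
  qed
  have bvc: "b * v = - c"
  proof -
    have "(\<Sum>i<n. a i * v ^ i) = c * v ^ (n - 1)"
      unfolding c_def sum_distrib_right
    proof (intro sum.cong refl)
      fix i assume "i \<in> {..<n}"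
      then have "v ^ (n - 1) = v ^ (n - Suc i) * v ^ i" by (simp add: power_add[symmetric])
      then show "a i * v ^ i = a i * inverse v ^ (n - Suc i) * v ^ (n - 1)"
        using v0 by (simp add: power_inverse field_simps)
    qed
    moreover have "v ^ n = v * v ^ (n - 1)" using n0 by (cases n) auto
    ultimately have "(c + b * v) * v ^ (n - 1) = 0" using split sum0 by (simp add: distrib_right mult.assoc)
    then show ?thesis using v0 by (simp add: eq_neg_iff_add_eq_0 add.commute)
  qed
  have bK: "b \<in> K'" "b * v \<in> K'" using bV' v pl(1,3) by (auto intro: sr_mult)
  \<comment> \<open>Where \<open>v\<close> is integral so are \<open>b\<close> and
    \<open>b v\<close>. Elsewhere \<open>inverse v\<close> is integral, hence
    \<open>b v = - c\<close> is, and multiplying by \<open>inverse v\<close> gives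
    \<open>b\<close>.\<close>
  have in_all: "b \<in> W \<and> b * v \<in> W" if W: "W \<in> places L K'" "W \<inter> K = R" for W
  proof (cases "v \<in> W")
    case True
    then show ?thesis using bV[OF W True] F'.placeD(1)[OF W(1)] by (auto intro: sr_mult)
  next
    case False
    note sr = F'.placeD(1)[OF W(1)]
    have "b * v \<in> W" unfolding bvc using cV[OF W False] by (rule sr_minus[OF sr])
    moreover have "inverse v \<in> W" using False vK F'.placeD(5)[OF W(1)] by (auto simp: valring_def)
    ultimately have "b * v * inverse v \<in> W" by (rule sr_mult[OF sr])
    moreover have "b * v * inverse v = b" using v0 by simp
    ultimately show ?thesis using \<open>b * v \<in> W\<close> by simp
  qed
  have "b \<in> lspan L R" using place_above[OF R bK(1)] in_all by blast
  moreover have "b * v \<in> lspan L R" using place_above[OF R bK(2)] in_all by blast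
  ultimately show ?thesis using b0 unfolding R_def by blast
qed

text \<open>The product of the individual denominators works because \<open>Y\<close> is a module
  over the ring that contains them.\<close>

lemma common_denominator:
  assumes V: "V \<in> places L K'" and fin: "finite I"
    and w: "\<And>i. i \<in> I \<Longrightarrow> \<exists>b\<in>lspan L (V \<inter> K). b \<noteq> 0 \<and> inverse b \<in> V \<and> b * w i \<in> Y"
    and Y: "\<And>a y. a \<in> lspan L (V \<inter> K) \<Longrightarrow> y \<in> Y \<Longrightarrow> a * y \<in> Y"
  shows "\<exists>b\<in>lspan L (V \<inter> K). b \<noteq> 0 \<and> inverse b \<in> V \<and> (\<forall>i\<in>I. b * w i \<in> Y)"
  using fin w
proof (induction I)
  case empty
  have "1 \<in> lspan L (V \<inter> K)" using lspan_R_props(1)[OF place_restrict[OF V]] by (rule sr_1)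
  then show ?case using sr_1[OF F'.placeD(1)[OF V]] by (intro bexI[of _ 1]) auto
next
  case (insert i I)
  have Ar: "subring (lspan L (V \<inter> K)) \<Omega>" by (rule lspan_R_props(1)[OF place_restrict[OF V]])
  obtain b where b: "b \<in> lspan L (V \<inter> K)" "b \<noteq> 0" "inverse b \<in> V" "\<forall>i\<in>I. b * w i \<in> Y"
    using insert.IH insert.prems by blast
  obtain c where c: "c \<in> lspan L (V \<inter> K)" "c \<noteq> 0" "inverse c \<in> V" "c * w i \<in> Y"
    using insert.prems by blast
  show ?case
  proof (intro bexI[of _ "b * c"] conjI ballI)
    show "b * c \<in> lspan L (V \<inter> K)" using b c by (intro sr_mult[OF Ar])
    show "b * c \<noteq> 0" using b c by simp
    show "inverse (b * c) \<in> V" using sr_mult[OF F'.placeD(1)[OF V] c(3) b(3)] by (simp add: mult.commute)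
    fix j assume "j \<in> insert i I"
    then show "b * c * w j \<in> Y"
      using Y[OF b(1) c(4)] Y[OF c(1), of "b * w j"] b(4) by (auto simp: mult_ac)
  qed
qed

text \<open>Smoothness of the base change at \<open>V\<close>. A denominator \<open>b\<close> that
  is a unit at \<open>V\<close> turns the equation of \<open>z\<close> into an integral one for
  \<open>b z\<close> over \<open>C \<otimes> R\<close>, to which smoothness of the original curve
  applies; division by \<open>b\<close> is harmless in \<open>C \<otimes> V\<close>.\<close>

lemma integral_closed_at_place:
  assumes V: "V \<in> places L K'" and z: "z \<in> lspan C K'" "integral_over (lspan C V) z"
  shows "z \<in> lspan C V"
proof -
  note pl = F'.placeD[OF V]
  define R where "R = V \<inter> K"
  have R: "R \<in> places k K" unfolding R_def by (rule place_restrict[OF V])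
  have Rr: "subring R \<Omega>" by (rule F.placeD(1)[OF R])
  define A where "A = lspan L R"
  define B where "B = lspan C R"
  have Ar: "subring A \<Omega>" and Br: "subring B \<Omega>" unfolding A_def B_def by (intro subring_lspan Lr Cr Rr)+
  have AB: "A \<subseteq> B" unfolding A_def B_def by (rule lspan_mono[OF LC order_refl])
  have AV: "A \<subseteq> V" unfolding A_def R_def using pl by (intro lspan_minimal subspc_subring) auto
  have CA: "lspan C A \<subseteq> B" unfolding B_def by (rule lspan_minimal[OF subspc_lspan[OF Cr]]) (use AB B_def in blast)
  obtain p where p: "p \<in> poly_over (lspan C V)" "Polynomial.lead_coeff p = 1" "poly p z = 0"
    using z(2) by (auto simp: integral_over_def)
  define N where "N = Polynomial.degree p"
  have single: "\<exists>b\<in>lspan L (V \<inter> K). b \<noteq> 0 \<and> inverse b \<in> V \<and> b * w \<in> B" if w: "w \<in> lspan C V" for w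
    using w
  proof (elim lspanE)
    fix n :: nat and l v
    assume a: "\<And>i. i < n \<Longrightarrow> l i \<in> C" "\<And>i. i < n \<Longrightarrow> v i \<in> V" "w = (\<Sum>i<n. l i * v i)"
    have "\<exists>b\<in>lspan L (V \<inter> K). b \<noteq> 0 \<and> inverse b \<in> V \<and> (\<forall>i\<in>{..<n}. b * v i \<in> A)"
      by (rule common_denominator[OF V])
        (use a(2) place_localization[OF V] sr_mult[OF Ar] in \<open>auto simp: A_def R_def\<close>)
    then obtain b where b: "b \<in> lspan L (V \<inter> K)" "b \<noteq> 0" "inverse b \<in> V" "\<And>i. i < n \<Longrightarrow> b * v i \<in> A" by auto
    have "b * w = (\<Sum>i<n. l i * (b * v i))" by (simp add: a(3) sum_distrib_left mult_ac)
    also have "\<dots> \<in> lspan C A" by (rule lspanI) (use a(1) b(4) in auto)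
    finally show ?thesis using b CA by blast
  qed
  have "\<exists>b\<in>lspan L (V \<inter> K). b \<noteq> 0 \<and> inverse b \<in> V \<and> (\<forall>i\<in>{..N}. b * Polynomial.coeff p i \<in> B)"
  proof (rule common_denominator[OF V finite_atMost single])
    show "Polynomial.coeff p i \<in> lspan C V" for i using p(1) by (simp add: poly_over_def)
    show "a * y \<in> B" if "a \<in> lspan L (V \<inter> K)" "y \<in> B" for a y
      using that AB sr_mult[OF Br] by (auto simp: A_def R_def)
  qed
  then obtain b where b: "b \<in> A" "b \<noteq> 0" "inverse b \<in> V" "\<And>i. i \<le> N \<Longrightarrow> b * Polynomial.coeff p i \<in> B"
    by (auto simp: A_def R_def)
  \<comment> \<open>The monic polynomial whose roots are \<open>b\<close> times those of
    \<open>p\<close>. Each lower coefficient gains at least one factor \<open>b\<close>, which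
    clears its denominator.\<close>
  define q where "q = (\<Sum>i\<le>N. Polynomial.monom (b ^ (N - i) * Polynomial.coeff p i) i)"
  have coeffq: "Polynomial.coeff q i = (if i \<le> N then b ^ (N - i) * Polynomial.coeff p i else 0)" for i
    by (simp add: q_def coeff_sum)
  have lead: "Polynomial.coeff p N = 1" using p(2) by (simp add: N_def)
  have bB: "b \<in> B" using b AB by blast
  have "q \<in> poly_over B"
    unfolding poly_over_def mem_Collect_eq
  proof
    fix i
    show "Polynomial.coeff q i \<in> B"
    proof (cases "i < N")
      case True
      then have "b ^ (N - i) = b ^ (N - Suc i) * b" by (metis Suc_diff_Suc mult.commute power_Suc)
      then have "Polynomial.coeff q i = b ^ (N - Suc i) * (b * Polynomial.coeff p i)" using True by (simp add: coeffq mult.assoc)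
      also have "\<dots> \<in> B" using sr_mult[OF Br sr_power[OF Br bB] b(4)[of i]] True by simp
      finally show ?thesis .
    next
      case False
      then show ?thesis using lead sr_0[OF Br] sr_1[OF Br] by (auto simp: coeffq)
    qed
  qed
  moreover have "Polynomial.lead_coeff q = 1"
  proof -
    have "Polynomial.degree q \<le> N" by (rule degree_le) (simp add: coeffq)
    moreover have "Polynomial.coeff q N = 1" using lead by (simp add: coeffq)
    ultimately have "Polynomial.degree q = N" by (metis le_antisym le_degree zero_neq_one)
    then show ?thesis using \<open>Polynomial.coeff q N = 1\<close> by simp
  qed
  moreover have "poly q (b * z) = 0"
  proof -
    have "poly q (b * z) = (\<Sum>i\<le>N. b ^ N * (Polynomial.coeff p i * z ^ i))"
      unfolding q_def poly_sum poly_monom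
    proof (intro sum.cong refl)
      fix i assume "i \<in> {..N}"
      then have "b ^ N = b ^ (N - i) * b ^ i" by (simp add: power_add[symmetric])
      then show "b ^ (N - i) * Polynomial.coeff p i * (b * z) ^ i = b ^ N * (Polynomial.coeff p i * z ^ i)"
        by (simp add: power_mult_distrib mult_ac)
    qed
    also have "\<dots> = b ^ N * poly p z" by (simp add: poly_altdef N_def sum_distrib_left)
    finally show ?thesis using p(3) by simp
  qed
  ultimately have "integral_over B (b * z)" unfolding integral_over_def by blast
  moreover have "b * z \<in> lspan C K"
  proof -
    have sCK: "subring (lspan C K) \<Omega>" by (rule subring_lspan[OF Cr Kr])
    have "K' \<subseteq> lspan C K" unfolding K'_eq by (rule lspan_mono[OF LC order_refl])
    then have "lspan C K' \<subseteq> lspan C K" by (rule lspan_minimal[OF subspc_lspan[OF Cr]])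
    moreover have "b \<in> lspan C K" using b(1) AV pl(3) \<open>K' \<subseteq> lspan C K\<close> by blast
    ultimately show ?thesis using z(1) by (intro sr_mult[OF sCK]) auto
  qed
  ultimately have "b * z \<in> lspan C R" unfolding B_def by (intro smooth_at_C[OF R])
  then have "inverse b * (b * z) \<in> lspan C V"
    by (rule lspan_scale') (use b(3) pl(1) R_def in \<open>auto intro: sr_mult\<close>)
  then show ?thesis using b(2) by (simp add: mult.assoc[symmetric])
qed

text \<open>Disjointness is inherited from \<open>K'\<close>. For a place \<open>R\<close> of
  \<open>M\<close>, choose a place \<open>V\<close> of \<open>K'\<close> above it:
  \<open>C \<otimes> V\<close> is integrally closed, and coordinates in \<open>M\<close> of an
  element of \<open>C \<otimes> V\<close> lie in \<open>V \<inter> M = R\<close>.\<close>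

lemma smooth_curve_subfield:
  assumes M: "subfield M \<Omega>" "L \<subseteq> M" "M \<subseteq> K'" and x: "x \<in> M" "x \<notin> C"
  shows "smooth_curve L M"
  unfolding smooth_curve_def C_L
proof (intro conjI ballI)
  show ffM: "function_field L M" using function_field_subfield[OF ffL M x(1)] x(2) C_L by blast
  show "linearly_disjoint L M C"
    using D'.ld M(3) unfolding linearly_disjoint_def by blast
  interpret FM: ffield L M by (rule function_field_ffield[OF ffM])
  fix R assume R: "R \<in> places L M"
  note plR = FM.placeD[OF R]
  \<comment> \<open>Keeping \<open>inverse t\<close> out of \<open>V\<close> makes \<open>V\<close>
    proper and prevents it from containing \<open>M\<close>.\<close>
  obtain t where t: "t \<in> max_ideal R" "t \<noteq> 0" using FM.place_not_field[OF R] by blast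
  have tR: "t \<in> R" "inverse t \<notin> R" using t by (auto simp: max_ideal_iff)
  have tM: "inverse t \<in> M" using tR plR(3) sf_inverse[OF M(1)] by blast
  have RK': "R \<subseteq> K'" using plR(3) M(3) by blast
  have "\<not> integral_over R (inverse t)" using valring_integral[OF plR(5) tM] tR by blast
  then obtain V where V: "valring V K'" "R \<subseteq> V" "inverse t \<notin> V"
    using chevalley[OF plR(1) RK' K'] tM M(3) by blast
  have Vp: "V \<in> places L K'" using V plR(2) tM M(3) by (auto simp: places_iff)
  have Vr: "subring V \<Omega>" using V by (simp add: valring_def)
  have VM: "V \<inter> M = R"
    using V Vr tM by (intro dplace.valring_restrict_eq[OF FM.place_dplace[OF R]]) auto
  have gen: "generate_ring \<Omega> (R \<union> C) = lspan C R" by (rule generate_ring_Un[OF Cr plR(1)])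
  have comp: "compositum M C = lspan C M"
    by (rule compositum_eq_lspan[OF L M(1,2) C]) (simp add: C_L)
  show "smooth_at L M R"
    unfolding smooth_at_def C_L gen comp
  proof (intro ballI impI)
    fix z assume z: "z \<in> lspan C M" "integral_over (lspan C R) z"
    have "z \<in> lspan C V"
      by (rule integral_closed_at_place[OF Vp])
        (use z(1) lspan_mono[OF order_refl M(3), of C] integral_over_mono[OF z(2) lspan_mono[OF order_refl V(2)]] in auto)
    obtain I :: "nat set" and l m where a: "finite I" "\<And>i. i \<in> I \<Longrightarrow> l i \<in> C" "\<And>i. i \<in> I \<Longrightarrow> m i \<in> M"
      "z = (\<Sum>i\<in>I. l i * m i)" "indep_mod L {0} I l"
      using lspan_indep_repr[OF L subspc_subring[OF Cr LC] subspc_subring[OF sf_sr[OF M(1)] M(2)] z(1)] by metis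
    have "m i \<in> R" if i: "i \<in> I" for i
    proof -
      have "m i \<in> V"
      proof (rule D'.coords_in[OF a(1,2,5) _ _ _ _ i])
        show "subspc L V" by (rule subspc_subring[OF Vr F'.placeD(2)[OF Vp]])
        show "V \<subseteq> K'" by (rule F'.placeD(3)[OF Vp])
        show "(\<Sum>i\<in>I. l i * m i) \<in> lspan C V" using \<open>z \<in> lspan C V\<close> a(4) by simp
      qed (use a(3) M(3) in auto)
      then show ?thesis using VM a(3)[OF i] by blast
    qed
    then show "z \<in> lspan C R" unfolding a(4) using a(1,2) by (intro lspanI)
  qed
qed

section \<open>Degrees in towers, and uniqueness of the gonal map\<close>

lemma degree_mult:
  assumes x: "x \<in> K'" "x \<notin> C" and M: "subfield M \<Omega>" "adjoin L x \<subseteq> M" "M \<subseteq> K'"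
  shows "\<exists>a b. Om.dimension a (adjoin L x) M \<and> Om.dimension b M K' \<and> Om.dimension (a * b) (adjoin L x) K'"
proof -
  have fd: "Om.finite_dimension (adjoin L x) K'" using finite_over_adjoin[OF ffL x(1)] x(2) C_L by blast
  have "Om.finite_dimension (adjoin L x) M"
    using M by (intro finite_dimension_subspc[OF adjoin_props(1) fd _ M(3)] subspc_subring sf_sr)
  moreover have "Om.finite_dimension M K'"
    using M by (intro finite_dimension_larger_field[OF adjoin_props(1) M(1,2) fd] subspc_subring K'r)
  ultimately show ?thesis using tower[OF adjoin_props(1) M(1)] unfolding Om.finite_dimension_def by blast
qed

lemma dimension_1_eq:
  assumes F: "subfield F \<Omega>" and M: "F \<subseteq> M" "Om.dimension 1 F M"
  shows "M = F"
proof -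
  have "x \<in> F" if x: "x \<in> M" for x
  proof -
    define v where "v i = (if i = 0 then 1 else x)" for i :: nat
    have Fr: "subring F \<Omega>" using F by (rule sf_sr)
    have "\<not> dim_ge F M {0} (Suc 1)" using dimension_imp(2)[OF F M(2)] by simp
    moreover have "\<forall>i<Suc 1. v i \<in> M" using x M(1) sr_1[OF Fr] by (auto simp: v_def)
    ultimately have "\<not> indep_mod F {0} {..<Suc 1} v" unfolding dim_ge_def by blast
    then obtain c i where c: "\<And>i. i < Suc 1 \<Longrightarrow> c i \<in> F" "(\<Sum>i<Suc 1. c i * v i) = 0" "i < Suc 1" "c i \<noteq> 0"
      unfolding indep_mod_def by auto
    have s: "c 0 + c 1 * x = 0" using c(2) by (simp add: v_def)
    have "c 1 \<noteq> 0"
    proof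
      assume 0: "c 1 = 0"
      then have "c 0 = 0" using s by simp
      then show False using 0 c(3,4) by (cases i) auto
    qed
    then have "x = - c 0 / c 1" using s by (simp add: field_simps eq_neg_iff_add_eq_0)
    then show ?thesis using c(1)[of 0] c(1)[of 1] F by (simp add: sf_divide sr_minus[OF Fr])
  qed
  then show ?thesis using M(1) by blast
qed

lemma degree_pos:
  assumes "subfield F \<Omega>" "Om.dimension n F K'" shows "n \<noteq> 0"
proof
  assume "n = 0"
  then have "K' = {0}" using Om.dimension_zero[OF assms(1)] assms(2) by simp
  then show False using sr_1[OF K'r] by auto
qed

text \<open>A value of \<open>ext_degree\<close> does not by itself entail finite dimension. Since
  \<open>L\<close> is algebraically closed in \<open>K'\<close>, a nonconstant \<open>f\<close> is
  transcendental, which makes the extension finite and the degree genuine.\<close>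

lemma gonal_map_degree:
  assumes f: "gonal_map L K' f"
  shows "f \<in> K'" "f \<notin> C" "Om.dimension (gonality L K') (adjoin L f) K'"
proof -
  have f1: "f \<in> K' - L" "ext_degree (adjoin L f) K' = gonality L K'"
    using f by (auto simp: gonal_map_def nonconstant_maps_P1_def map_degree_def)
  then show "f \<in> K'" "f \<notin> C" using const' by auto
  then have "Om.finite_dimension (adjoin L f) K'" using finite_over_adjoin[OF ffL] C_L by blast
  then obtain n where "Om.dimension n (adjoin L f) K'" by (auto simp: Om.finite_dimension_def)
  then show "Om.dimension (gonality L K') (adjoin L f) K'"
    using f1(2) ext_degree_eq[OF adjoin_props(1)] by metis
qed

text \<open>An intermediate field would factor the prime gonality into two degrees of at least
  2.\<close>

lemma prime_simple:
  assumes f: "gonal_map L K' f" and prime: "prime (gonality L K')"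
  shows "simple_map_P1 L K' f"
  unfolding simple_map_P1_def simple_cover_def
proof
  assume "\<exists>M. smooth_curve L M \<and> adjoin L f \<subseteq> M \<and> M \<subseteq> K' \<and> 2 \<le> ext_degree M K' \<and> 2 \<le> ext_degree (adjoin L f) M"
  then obtain M where M: "smooth_curve L M" "adjoin L f \<subseteq> M" "M \<subseteq> K'"
    "2 \<le> ext_degree M K'" "2 \<le> ext_degree (adjoin L f) M" by blast
  have Mf: "subfield M \<Omega>" using M(1) function_fieldD by (auto simp: smooth_curve_def)
  note g = gonal_map_degree[OF f]
  obtain a b where ab: "Om.dimension a (adjoin L f) M" "Om.dimension b M K'" "Om.dimension (a * b) (adjoin L f) K'"
    using degree_mult[OF g(1,2) Mf M(2,3)] by blast
  have "a * b = gonality L K'" using Om.dimension_is_inj[OF adjoin_props(1) ab(3) g(3)] .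
  moreover have "a \<ge> 2" "b \<ge> 2" using M(4,5) ext_degree_eq[OF adjoin_props(1) ab(1)] ext_degree_eq[OF Mf ab(2)] by auto
  ultimately show False using prime by (metis One_nat_def Suc_1 not_less_eq_eq order_refl prime_product)
qed

lemma simple_unique:
  assumes f: "gonal_map L K' f" and simple: "simple_map_P1 L K' f"
    and g: "(int (gonality L K') - 1)\<^sup>2 < genus k K"
  shows "unique_gonal_map L K'"
  unfolding unique_gonal_map_def
proof (rule ex1I[of _ "adjoin L f"])
  note fd = gonal_map_degree[OF f]
  have FK: "adjoin L f \<subseteq> K'" by (rule adjoin_props(4)[OF K' LK' fd(1)])
  show "adjoin L f \<subseteq> K' \<and> rational_function_field L (adjoin L f) \<and> ext_degree (adjoin L f) K' = gonality L K'"
    using FK fd(2) ext_degree_eq[OF adjoin_props(1) fd(3)] C_L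
    by (auto simp: rational_function_field_def transcendental_iff)
  fix F assume F: "F \<subseteq> K' \<and> rational_function_field L F \<and> ext_degree F K' = gonality L K'"
  then obtain t where t: "t \<notin> C" "F = adjoin L t" using C_L by (auto simp: rational_function_field_def transcendental_iff)
  have tK: "t \<in> K'" using F t adjoin_props(3)[of t L] by blast
  have "Om.finite_dimension F K'" unfolding t(2) using finite_over_adjoin[OF ffL tK] t(1) C_L by blast
  then have td: "Om.dimension (gonality L K') (adjoin L t) K'"
    using F t(2) ext_degree_eq[OF adjoin_props(1)] unfolding Om.finite_dimension_def by metis
  define M where "M = adjoin (adjoin L f) t"
  have M: "subfield M \<Omega>" "adjoin L f \<subseteq> M" "t \<in> M" "M \<subseteq> K'"
    unfolding M_def using adjoin_props[where k = "adjoin L f" and x = t] adjoin_props(4)[OF K' FK tK] by auto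
  have LM: "L \<subseteq> M" "f \<in> M" using adjoin_props(2,3)[where k = L and x = f] M(2) by auto
  obtain a b where ab: "Om.dimension a (adjoin L f) M" "Om.dimension b M K'" "Om.dimension (a * b) (adjoin L f) K'"
    using degree_mult[OF fd(1,2) M(1,2,4)] by blast
  have prod: "a * b = gonality L K'" using Om.dimension_is_inj[OF adjoin_props(1) ab(3) fd(3)] .
  have pos: "a * b \<noteq> 0" using degree_pos[OF adjoin_props(1) ab(3)] .
  \<comment> \<open>Here \<open>f\<close> and \<open>t\<close> generate \<open>K'\<close>, and both
    have degree equal to the gonality, so Castelnuovo's bound is the square.\<close>
  have "b \<noteq> 1"
  proof
    assume "b = 1"
    then have "K' = M" using dimension_1_eq[OF M(1,4)] ab(2) by simp
    then have "genus k K \<le> (int (gonality L K') - 1) * (int (gonality L K') - 1)"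
      by (intro castelnuovo[OF fd(1,2) tK t(1) fd(3) td]) (simp add: M_def)
    then show False using g by (simp add: power2_eq_square)
  qed
  then have b2: "b \<ge> 2" using pos by (cases b) auto
  have "\<not> a \<ge> 2"
  proof
    assume "a \<ge> 2"
    moreover have "smooth_curve L M" by (rule smooth_curve_subfield[OF M(1) LM(1) M(4) LM(2) fd(2)])
    ultimately show False
      using simple b2 M(2,4) ext_degree_eq[OF adjoin_props(1) ab(1)] ext_degree_eq[OF M(1) ab(2)]
      unfolding simple_map_P1_def simple_cover_def by blast
  qed
  then have "a = 1" using pos by (cases a) auto
  then have "M = adjoin L f" using dimension_1_eq[OF adjoin_props(1) M(2)] ab(1) by simp
  then have tF: "adjoin L t \<subseteq> adjoin L f"
    using M(3) adjoin_props(2)[of L f] by (intro adjoin_props(4) adjoin_props(1)) auto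
  obtain a' b' where ab': "Om.dimension a' (adjoin L t) (adjoin L f)" "Om.dimension b' (adjoin L f) K'"
    "Om.dimension (a' * b') (adjoin L t) K'"
    using degree_mult[OF tK t(1) adjoin_props(1) tF FK] by blast
  have "a' * b' = gonality L K'" "b' = gonality L K'"
    using Om.dimension_is_inj[OF adjoin_props(1) ab'(3) td] Om.dimension_is_inj[OF adjoin_props(1) ab'(2) fd(3)] by auto
  then have "a' = 1" using pos prod by auto
  then show "F = adjoin L f" using dimension_1_eq[OF adjoin_props(1) tF] ab'(1) t(2) by simp
qed

end

text \<open>Simplicity is asked of one gonal map; the uniqueness obtained concerns all rational
  subfields of gonal degree.\<close>

theorem theorem2:
  fixes k K ksep Ksep :: "'a::alg_closed_field set" and g :: int and \<gamma> :: nat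
  assumes curve: "smooth_curve k K"
    and ksep: "ksep = sep_closure_of k"
    and Ksep: "Ksep = base_change_sep k K"
    and g: "g = genus k K"
    and gamma: "\<gamma> = sep_gonality k K"
  shows "(\<forall>f. gonal_map ksep Ksep f \<and> simple_map_P1 ksep Ksep f \<and> (int \<gamma> - 1)\<^sup>2 < g
            \<longrightarrow> unique_gonal_map ksep Ksep) \<and>
         (prime \<gamma> \<longrightarrow> (\<forall>f. gonal_map ksep Ksep f \<longrightarrow> simple_map_P1 ksep Ksep f))"
proof -
  interpret c: curve k K ksep "alg_closure_of k" Ksep
    by (rule curve.intro[OF curve ksep refl Ksep])
  have "\<gamma> = gonality ksep Ksep" by (simp add: gamma sep_gonality_def ksep Ksep)
  then show ?thesis using c.simple_unique c.prime_simple g by blast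
qed

end
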